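(* Let $(\xi_n)_{n\in\mathbb{Z}}$ be a stationary Markov chain with marginal distribution $\pi$ and normal transition operator $Q$, let $g\in\mathbb{L}_0^2(\pi)$, $X_i:=g(\xi_i)$, $S_n=\sum_{i=1}^nX_i$, and let $F$ be the spectral distribution function of $(X_n)$. Let $\alpha\in(0,2)$ and let $h$ be slowly varying at infinity. Then $$\mathrm{var}(S_n)\sim n^\alpha h(n)\ \text{ as } n\to\infty$$ if and only if $$F(x)\sim\tfrac12 C(\alpha)\,x^{2-\alpha}h(1/x)\ \text{ as } x\to0^+ .$$
   Context: $(\xi_n)_{n\in\mathbb{Z}}$ is a stationary Markov chain with values in a measurable space $(S,\mathcal{A})$, marginal law $\pi$ and regular conditional distribution $Q(x,A)=\mathbb{P}(\xi_1\in A\mid\xi_0=x)$; $Q$ also denotes the transition operator $(Qg)(x)=\int_S g(s)Q(x,\mathrm{d}s)$, which is normal if $QQ^*=Q^*Q$. $\mathbb{L}_0^2(\pi)$ is the set of real measurable $g$ with $\int g^2\,\mathrm{d}\pi<\infty$ and $\int g\,\mathrm{d}\pi=0$. The transition spectral measure $\nu$ of $Q$ with respect to $g$ is the finite measure on $D=\{|z|\le1\}$ given by the spectral theorem for the normal operator $Q$, with $\langle Q^ig,Q^jg\rangle=\int_D z^i\bar z^j\nu(\mathrm{d}z)$ for $i,j\ge 0$. The spectral distribution function $F$ is the non-decreasing function on $[0,2\pi]$ (with associated measure $F(\mathrm{d}\theta)$ on the circle $[0,2\pi)$, and $F(x)=F([0,x])$) such that $\mathrm{cov}(X_0,X_n)=\int_0^{2\pi}e^{\mathrm{i}n\theta}F(\mathrm{d}\theta)$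 for all $n\in\mathbb{Z}$. In terms of $\nu$, $F(\mathrm{d}t)=\nu_\Gamma(\mathrm{d}t)+f(t)\mathrm{d}t$, where $\nu_\Gamma$ is the restriction of $\nu$ to the unit circle (parametrized by angle) and $f(t)=\frac1{2\pi}\int_{\{|z|<1\}}\frac{1-|z|^2}{|1-ze^{\mathrm{i}t}|^2}\nu(\mathrm{d}z)$. $C(\alpha):=\Gamma(1+\alpha)\sin(\alpha\pi/2)/[\pi(2-\alpha)]$. A continuous function $h:(0,\infty)\to(0,\infty)$ is slowly varying at infinity if $h(st)/h(t)\to1$ as $t\to\infty$ for every $s>0$. $a\sim b$ means that the ratio tends to $1$. *)

theory Defs
  imports "HOL-Probability.Probability" "HOL-Library.Landau_Symbols"
begin

definition gen_sigma ::
  "'w measure \<Rightarrow> 's measure \<Rightarrow> (int \<Rightarrow> 'w \<Rightarrow> 's) \<Rightarrow> int set \<Rightarrow> 'w measure" where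
  "gen_sigma M S \<xi> I = sigma (space M) {\<xi> k -` A \<inter> space M | k A. k \<in> I \<and> A \<in> sets S}"

text \<open>Conditional probability of the event that the state at time \<open>n\<close> lies in \<open>A\<close>,
  given the states with time index in \<open>I\<close>.\<close>

definition cond_prob_state ::
  "'w measure \<Rightarrow> 's measure \<Rightarrow> (int \<Rightarrow> 'w \<Rightarrow> 's) \<Rightarrow> int \<Rightarrow> 's set \<Rightarrow> int set \<Rightarrow> 'w \<Rightarrow> real" where
  "cond_prob_state M S \<xi> n A I =
     real_cond_exp M (gen_sigma M S \<xi> I) (indicator (\<xi> n -` A \<inter> space M))"

definition stationary_process ::
  "'w measure \<Rightarrow> 's measure \<Rightarrow> (int \<Rightarrow> 'w \<Rightarrow> 's) \<Rightarrow> bool" where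
  "stationary_process M S \<xi> \<longleftrightarrow>
     (\<forall>n. \<xi> n \<in> measurable M S) \<and>
     (\<forall>k. distr M (PiM UNIV (\<lambda>_. S)) (\<lambda>\<omega> n. \<xi> (n + k) \<omega>)
        = distr M (PiM UNIV (\<lambda>_. S)) (\<lambda>\<omega> n. \<xi> n \<omega>))"

definition markov_property ::
  "'w measure \<Rightarrow> 's measure \<Rightarrow> (int \<Rightarrow> 'w \<Rightarrow> 's) \<Rightarrow> bool" where
  "markov_property M S \<xi> \<longleftrightarrow>
     (\<forall>n. \<forall>A\<in>sets S. AE \<omega> in M.
        cond_prob_state M S \<xi> (n + 1) A {..n} \<omega> = cond_prob_state M S \<xi> (n + 1) A {n} \<omega>)"

definition transition_kernel ::
  "'w measure \<Rightarrow> 's measure \<Rightarrow> (int \<Rightarrow> 'w \<Rightarrow> 's) \<Rightarrow> ('s \<Rightarrow> 's measure) \<Rightarrow> bool" where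
  "transition_kernel M S \<xi> Q \<longleftrightarrow>
     Q \<in> measurable S (prob_algebra S) \<and>
     (\<forall>A\<in>sets S. AE \<omega> in M. cond_prob_state M S \<xi> 1 A {0} \<omega> = measure (Q (\<xi> 0 \<omega>)) A)"

definition stationary_markov_chain ::
  "'w measure \<Rightarrow> 's measure \<Rightarrow> (int \<Rightarrow> 'w \<Rightarrow> 's) \<Rightarrow> 's measure \<Rightarrow> ('s \<Rightarrow> 's measure) \<Rightarrow> bool" where
  "stationary_markov_chain M S \<xi> \<pi> Q \<longleftrightarrow>
     prob_space M \<and> stationary_process M S \<xi> \<and> markov_property M S \<xi> \<and>
     \<pi> = distr M S (\<xi> 0) \<and> transition_kernel M S \<xi> Q"

definition L2 :: "'s measure \<Rightarrow> ('s \<Rightarrow> real) set" where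
  "L2 \<pi> = {f \<in> borel_measurable \<pi>. integrable \<pi> (\<lambda>x. (f x)\<^sup>2)}"

definition L2_0 :: "'s measure \<Rightarrow> ('s \<Rightarrow> real) set" where
  "L2_0 \<pi> = {f \<in> L2 \<pi>. (\<integral>x. f x \<partial>\<pi>) = 0}"

definition inner_L2 :: "'s measure \<Rightarrow> ('s \<Rightarrow> real) \<Rightarrow> ('s \<Rightarrow> real) \<Rightarrow> real" where
  "inner_L2 \<pi> f g = (\<integral>x. f x * g x \<partial>\<pi>)"

definition transition_operator :: "('s \<Rightarrow> 's measure) \<Rightarrow> ('s \<Rightarrow> real) \<Rightarrow> ('s \<Rightarrow> real)" where
  "transition_operator Q f = (\<lambda>x. \<integral>s. f s \<partial>(Q x))"

text \<open>Operators on the Hilbert space of square-integrable functions are represented by maps on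
  functions, and identities between them are required only almost everywhere. Such an adjoint is
  determined up to null sets.\<close>

definition is_adjoint_L2 ::
  "'s measure \<Rightarrow> (('s \<Rightarrow> real) \<Rightarrow> ('s \<Rightarrow> real)) \<Rightarrow> (('s \<Rightarrow> real) \<Rightarrow> ('s \<Rightarrow> real)) \<Rightarrow> bool" where
  "is_adjoint_L2 \<pi> T T' \<longleftrightarrow>
     (\<forall>f\<in>L2 \<pi>. T' f \<in> L2 \<pi>) \<and>
     (\<forall>f\<in>L2 \<pi>. \<forall>g\<in>L2 \<pi>. inner_L2 \<pi> (T f) g = inner_L2 \<pi> f (T' g))"

definition normal_operator_L2 ::
  "'s measure \<Rightarrow> (('s \<Rightarrow> real) \<Rightarrow> ('s \<Rightarrow> real)) \<Rightarrow> bool" where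
  "normal_operator_L2 \<pi> T \<longleftrightarrow>
     (\<exists>T'. is_adjoint_L2 \<pi> T T' \<and> (\<forall>f\<in>L2 \<pi>. AE x in \<pi>. T (T' f) x = T' (T f) x))"

definition covar :: "'w measure \<Rightarrow> ('w \<Rightarrow> real) \<Rightarrow> ('w \<Rightarrow> real) \<Rightarrow> real" where
  "covar M X Y =
     (\<integral>\<omega>. (X \<omega> - (\<integral>\<omega>'. X \<omega>' \<partial>M)) * (Y \<omega> - (\<integral>\<omega>'. Y \<omega>' \<partial>M)) \<partial>M)"

text \<open>The spectral measure lives on the circle, parametrized by \<open>[0, 2\<pi>)\<close>; an atom at angle \<open>0\<close>
  is counted in \<open>F 0\<close>. Values of \<open>F\<close> outside \<open>[0, 2\<pi>]\<close> are irrelevant.\<close>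

definition spectral_distribution_function ::
  "'w measure \<Rightarrow> (int \<Rightarrow> 'w \<Rightarrow> real) \<Rightarrow> (real \<Rightarrow> real) \<Rightarrow> bool" where
  "spectral_distribution_function M X F \<longleftrightarrow>
     (\<exists>\<mu> :: real measure.
        finite_borel_measure \<mu> \<and>
        (AE \<theta> in \<mu>. \<theta> \<in> {0..<2 * pi}) \<and>
        (\<forall>n::int. complex_of_real (covar M (X 0) (X n)) = (\<integral>\<theta>. cis (of_int n * \<theta>) \<partial>\<mu>)) \<and>
        (\<forall>x\<in>{0..2 * pi}. F x = measure \<mu> {0..x}))"

definition slowly_varying :: "(real \<Rightarrow> real) \<Rightarrow> bool" where
  "slowly_varying h \<longleftrightarrow>
     continuous_on {0<..} h \<and> (\<forall>t>0. h t > 0) \<and>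
     (\<forall>s>0. ((\<lambda>t. h (s * t) / h t) \<longlongrightarrow> 1) at_top)"

definition C_const :: "real \<Rightarrow> real" where
  "C_const \<alpha> = Gamma (1 + \<alpha>) * sin (\<alpha> * pi / 2) / (pi * (2 - \<alpha>))"

end

theory Submission
  imports Defs "HOL-Real_Asymp.Real_Asymp"
begin

text \<open>The variance of \<open>S\<^sub>n\<close> is a functional of the spectral measure \<open>\<mu>\<close> alone: summing the
covariances gives \<open>var S\<^sub>n = \<integral> (sin (n t / 2) / sin (t / 2))\<^sup>2 \<mu>(dt)\<close>. The claim is therefore an Abelian
and Tauberian theorem for this kernel. Covariances are real, so all sine coefficients of \<open>\<mu>\<close>
vanish, and Weierstrass approximation in \<open>cos t\<close> shows that \<open>\<mu>\<close> is symmetric under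
\<open>t \<mapsto> 2\<pi> - t\<close>. Folding the circle onto \<open>[0, \<pi>]\<close> gives a measure \<open>\<rho>\<close> with
\<open>\<rho>[0, x] = 2 F(x) - F(0)\<close> for \<open>x < \<pi>\<close> (lemma \<open>mass_fold\<close>); this is where the factor \<open>1/2\<close> in the
theorem comes from. The kernel makes sense for real \<open>s\<close> in place of \<open>n\<close>; write \<open>V(s)\<close> for its
integral against \<open>\<rho>\<close>. The ratio of sines is Lipschitz in \<open>s\<close>, and \<open>h\<close> varies slowly uniformly
on compact sets, so \<open>V(n) \<sim> n\<^sup>\<alpha> h(n)\<close> along integers is the same as along reals.

From variance to spectrum (lemma \<open>spectral_mass_of_growth\<close>): the kernel \<open>k\<^sub>s\<close> satisfies
\<open>k\<^sub>s\<^sub>+\<^sub>u + k\<^sub>s\<^sub>-\<^sub>u - 2 k\<^sub>s = 2 cos (s t) k\<^sub>u\<close>. So half the second difference of \<open>V\<close> with step \<open>s\<close>,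
divided by \<open>V(s)\<close>, is the cosine transform of the probability measure \<open>k\<^sub>s d\<rho> / V(s)\<close>, seen at scale
\<open>1/s\<close>. If
\<open>V(s t) / V(s) \<longrightarrow> |t|\<^sup>\<alpha>\<close>, these transforms converge to \<open>(|t+1|\<^sup>\<alpha> + |t-1|\<^sup>\<alpha> - 2|t|\<^sup>\<alpha>) / 2\<close>, which is the
cosine transform of the law with density proportional to \<open>(1 - cos y) / y\<^sup>1\<^sup>+\<^sup>\<alpha>\<close> on
\<open>y > 0\<close>. By Levy's continuity theorem the rescaled measures converge weakly, once
they are made symmetric. Dividing out the
kernel on \<open>[0, 1]\<close> turns this into the convergence of \<open>s\<^sup>2 \<rho>[0, 1/s] / V(s)\<close>.

From spectrum to variance (lemma \<open>growth_of_spectral_mass\<close>): regular variation of \<open>\<rho>[0, x]\<close> says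
that \<open>\<rho>\<close> restricted to \<open>[0, c/s]\<close> and rescaled by \<open>s\<close> converges to a power law, so the part of \<open>V(s)\<close>
coming from frequencies below \<open>c/s\<close>, divided by \<open>s\<^sup>\<alpha> h(s)\<close>, converges to the mass that the limit law
gives to \<open>[0, c]\<close>. On the same scale the frequencies above \<open>c/s\<close> contribute in the limit at most a
constant times \<open>c\<^sup>-\<^sup>\<alpha>\<close> (lemma \<open>tail_le_mass\<close>), which is small for large \<open>c\<close>.

The constant \<open>C(\<alpha>)\<close> is \<open>1 / (2 (2 - \<alpha>) I)\<close>, where \<open>I\<close> is the integral of
\<open>(1 - cos y) / y\<^sup>1\<^sup>+\<^sup>\<alpha>\<close> over \<open>y > 0\<close>; it is evaluated by writing the power as a Gamma integral.\<close>

section \<open>Slowly varying functions\<close>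

text \<open>The additive form of the uniform convergence theorem for slowly varying functions. The sets of
shifts that are controlled from time \<open>n\<close> on are closed and cover the line, so by Baire one of them
contains an interval. Differences of its points give all short shifts, and finitely many grid points
reach the shifts up to \<open>1\<close>.\<close>

lemma uniform_of_pointwise_translation_limit:
  fixes f :: "real \<Rightarrow> real"
  assumes cont: "continuous_on UNIV f"
    and lim: "\<And>s. ((\<lambda>x. f (x + s) - f x) \<longlongrightarrow> 0) at_top"
    and "e > 0"
  shows "\<exists>X. \<forall>x\<ge>X. \<forall>s\<in>{0..1}. \<bar>f (x + s) - f x\<bar> \<le> e"
proof -
  define e' where "e' = e / 3"
  have e': "e' > 0" using \<open>e > 0\<close> by (simp add: e'_def)
  define E where "E n = {s. \<forall>x\<ge>real n. \<bar>f (x + s) - f x\<bar> \<le> e'}" for n :: nat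
  have closed_E: "closed (E n)" for n
  proof -
    have "E n = (\<Inter>x\<in>{real n..}. {s. \<bar>f (x + s) - f x\<bar> \<le> e'})"
      by (auto simp: E_def)
    moreover have "closed {s. \<bar>f (x + s) - f x\<bar> \<le> e'}" for x
      by (intro closed_Collect_le continuous_intros continuous_on_compose2[OF cont]) auto
    ultimately show ?thesis by auto
  qed
  have cover: "\<exists>n. s \<in> E n" for s
  proof -
    have "eventually (\<lambda>x. \<bar>f (x + s) - f x\<bar> < e') at_top"
      using tendstoD[OF lim e'] by (simp add: dist_real_def)
    then obtain B where B: "\<And>x. x \<ge> B \<Longrightarrow> \<bar>f (x + s) - f x\<bar> < e'"
      by (auto simp: eventually_at_top_linorder)
    obtain n :: nat where "real n \<ge> B" using real_arch_simple by blast
    then have "s \<in> E n" using B by (auto simp: E_def intro!: less_imp_le[OF B])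
    then show ?thesis ..
  qed
  have "\<exists>n. interior (E n) \<noteq> {}"
  proof (rule ccontr)
    assume "\<not> ?thesis"
    then have "\<And>n. closure (- E n) = UNIV" by (simp add: closure_complement)
    then have "UNIV \<subseteq> closure (\<Inter>(range (\<lambda>n. - E n)))"
      using closed_E by (intro Baire) (auto simp: open_Compl)
    moreover have "\<Inter>(range (\<lambda>n. - E n)) = {}" using cover by auto
    ultimately show False by simp
  qed
  then obtain n a where "a \<in> interior (E n)" by auto
  then obtain d where d: "d > 0" "cball a d \<subseteq> E n"
    by (meson interior_subset mem_interior_cball)
  \<comment> \<open>Both \<open>a\<close> and \<open>a + r\<close> are controlled shifts; comparing them at \<open>x - a\<close> controls the shift \<open>r\<close> at \<open>x\<close>.\<close>
  have short: "\<bar>f (x + r) - f x\<bar> \<le> 2 * e'" if "x \<ge> real n + a" "0 \<le> r" "r \<le> d" for x r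
  proof -
    have "a \<in> E n" "a + r \<in> E n"
      using d that by (auto simp: subset_iff dist_real_def)
    moreover have "x - a \<ge> real n" using that by simp
    ultimately have "\<bar>f (x - a + (a + r)) - f (x - a)\<bar> \<le> e'" "\<bar>f (x - a + a) - f (x - a)\<bar> \<le> e'"
      unfolding E_def by blast+
    then show ?thesis by simp
  qed
  obtain N :: nat where N: "1 / d \<le> real N" using real_arch_simple by blast
  have "eventually (\<lambda>x. \<forall>i\<in>{..N}. \<bar>f (x + real i * d) - f x\<bar> < e') at_top"
    using tendstoD[OF lim e'] by (intro eventually_ball_finite) (auto simp: dist_real_def)
  then obtain B where B: "\<And>x i. x \<ge> B \<Longrightarrow> i \<le> N \<Longrightarrow> \<bar>f (x + real i * d) - f x\<bar> < e'"
    by (auto simp: eventually_at_top_linorder)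
  show ?thesis
  proof (intro exI[of _ "max B (real n + a)"] allI impI ballI)
    fix x s :: real
    assume x: "x \<ge> max B (real n + a)" and s: "s \<in> {0..1}"
    define i where "i = nat \<lfloor>s / d\<rfloor>"
    define r where "r = s - real i * d"
    have "s / d \<ge> 0" using s d by simp
    then have i: "real i \<le> s / d" "s / d < real i + 1"
      unfolding i_def by linarith+
    have "s / d \<le> 1 / d" using s d by (simp add: divide_right_mono)
    then have "i \<le> N" using i(1) N by linarith
    moreover have r: "0 \<le> r" "r \<le> d"
      using i d by (auto simp: r_def field_simps)
    moreover have "x + real i * d \<ge> real n + a" using x d by (simp add: add_increasing2)
    ultimately have "\<bar>f (x + real i * d + r) - f (x + real i * d)\<bar> \<le> 2 * e'"
      "\<bar>f (x + real i * d) - f x\<bar> < e'"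
      using short B x by auto
    moreover have "x + real i * d + r = x + s" by (simp add: r_def)
    ultimately show "\<bar>f (x + s) - f x\<bar> \<le> e" unfolding e'_def by (simp only:)
  qed
qed

lemma slowly_varying_log_uniform:
  assumes "slowly_varying h" "e > 0"
  shows "\<exists>X. \<forall>x\<ge>X. \<forall>s\<in>{0..1}. \<bar>ln (h (exp (x + s))) - ln (h (exp x))\<bar> \<le> e"
proof -
  have cont: "continuous_on {0<..} h" and pos: "\<And>t. t > 0 \<Longrightarrow> h t > 0"
    and lim: "\<And>s. s > 0 \<Longrightarrow> ((\<lambda>t. h (s * t) / h t) \<longlongrightarrow> 1) at_top"
    using assms(1) by (auto simp: slowly_varying_def)
  have "((\<lambda>x. ln (h (exp (x + s))) - ln (h (exp x))) \<longlongrightarrow> 0) at_top" for s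
  proof -
    have "((\<lambda>x. h (exp s * exp x) / h (exp x)) \<longlongrightarrow> 1) at_top"
      by (rule filterlim_compose[OF lim exp_at_top]) simp
    then have "((\<lambda>x. ln (h (exp s * exp x) / h (exp x))) \<longlongrightarrow> ln 1) at_top"
      by (intro tendsto_ln) auto
    moreover have "ln (h (exp s * exp x) / h (exp x)) = ln (h (exp (x + s))) - ln (h (exp x))" for x
      using pos[of "exp s * exp x"] pos[of "exp x"]
      by (simp add: ln_div exp_add mult.commute less_imp_neq[symmetric])
    ultimately show ?thesis by simp
  qed
  moreover have "continuous_on UNIV (\<lambda>x. ln (h (exp x)))"
    using pos by (intro continuous_on_ln continuous_on_compose2[OF cont] continuous_intros)
      (auto simp: less_imp_neq[symmetric])
  ultimately show ?thesis
    using uniform_of_pointwise_translation_limit[of "\<lambda>x. ln (h (exp x))" e] assms(2) by simp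
qed

text \<open>Slow variation as growth slower than any power: uniform control over unit steps of \<open>ln t\<close> is summed
along \<open>ln t\<close> steps.\<close>

lemma slowly_varying_log_growth:
  assumes h: "slowly_varying h" and d: "d > 0"
  shows "\<exists>c. eventually (\<lambda>t. \<bar>ln (h t)\<bar> \<le> d * ln t + c) at_top"
proof -
  define f where "f x = ln (h (exp x))" for x
  obtain X where X: "\<And>x s. x \<ge> X \<Longrightarrow> s \<in> {0..1} \<Longrightarrow> \<bar>f (x + s) - f x\<bar> \<le> d"
    using slowly_varying_log_uniform[OF h d] unfolding f_def by blast
  have steps: "\<bar>f (X + s + real k) - f X\<bar> \<le> d * (real k + 1)" if "s \<in> {0..1}" for s k
  proof (induction k)
    case 0
    show ?case using X[of X s] that by simp
  next
    case (Suc k)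
    have "\<bar>f (X + s + real k + 1) - f (X + s + real k)\<bar> \<le> d"
      using that by (intro X) auto
    then show ?case using Suc by (simp add: algebra_simps)
  qed
  have "\<bar>ln (h t)\<bar> \<le> d * ln t + (d * (1 - X) + \<bar>f X\<bar>)" if "t \<ge> exp X" for t
  proof -
    have "t > 0" using that by (meson exp_gt_zero less_le_trans)
    then have "ln t \<ge> X" using that by (simp add: ln_ge_iff)
    define k where "k = nat \<lfloor>ln t - X\<rfloor>"
    define s where "s = ln t - X - real k"
    have k: "real k \<le> ln t - X" "ln t - X < real k + 1"
      using \<open>ln t \<ge> X\<close> unfolding k_def by linarith+
    then have "\<bar>f (X + s + real k) - f X\<bar> \<le> d * (real k + 1)"
      by (intro steps) (auto simp: s_def)
    also have "\<dots> \<le> d * (ln t - X + 1)" using k d by (intro mult_left_mono) auto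
    also have "X + s + real k = ln t" by (simp add: s_def)
    finally show ?thesis using \<open>t > 0\<close> by (simp add: f_def algebra_simps)
  qed
  then show ?thesis by (intro exI[of _ "d * (1 - X) + \<bar>f X\<bar>"]) (auto simp: eventually_at_top_linorder)
qed

lemma slowly_varying_pos: "slowly_varying h \<Longrightarrow> t > 0 \<Longrightarrow> h t > 0"
  by (simp add: slowly_varying_def)

lemma slowly_varying_times_power_at_top:
  assumes h: "slowly_varying h" and a: "a > 0"
  shows "filterlim (\<lambda>t. t powr a * h t) at_top at_top"
proof -
  obtain c where c: "eventually (\<lambda>t. \<bar>ln (h t)\<bar> \<le> a / 2 * ln t + c) at_top"
    using slowly_varying_log_growth[OF h, of "a / 2"] a by auto
  have "filterlim (\<lambda>t. exp (a / 2 * ln t - c)) at_top at_top"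
    using a by real_asymp
  then show ?thesis
  proof (rule filterlim_at_top_mono)
    show "eventually (\<lambda>t. exp (a / 2 * ln t - c) \<le> t powr a * h t) at_top"
      using c eventually_gt_at_top[of 0]
    proof eventually_elim
      case (elim t)
      have "exp (a / 2 * ln t - c) \<le> exp (a * ln t + ln (h t))" using elim by simp
      also have "\<dots> = t powr a * h t"
        using elim slowly_varying_pos[OF h, of t] by (simp add: exp_add powr_def)
      finally show ?case .
    qed
  qed
qed

lemma slowly_varying_times_power_to_0:
  assumes h: "slowly_varying h" and a: "a < 0"
  shows "((\<lambda>t. t powr a * h t) \<longlongrightarrow> 0) at_top"
proof -
  obtain c where c: "eventually (\<lambda>t. \<bar>ln (h t)\<bar> \<le> - a / 2 * ln t + c) at_top"
    using slowly_varying_log_growth[OF h, of "- a / 2"] a by auto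
  have "((\<lambda>t. exp (a / 2 * ln t + c)) \<longlongrightarrow> 0) at_top"
    using a by real_asymp
  then show ?thesis
  proof (rule Lim_null_comparison[rotated])
    show "eventually (\<lambda>t. norm (t powr a * h t) \<le> exp (a / 2 * ln t + c)) at_top"
      using c eventually_gt_at_top[of 0]
    proof eventually_elim
      case (elim t)
      have "norm (t powr a * h t) = exp (a * ln t + ln (h t))"
        using elim slowly_varying_pos[OF h, of t] by (simp add: exp_add powr_def)
      also have "\<dots> \<le> exp (a / 2 * ln t + c)" using elim by (auto simp: abs_le_iff algebra_simps)
      finally show ?case .
    qed
  qed
qed

text \<open>Rounding moves \<open>ln t\<close> by at most \<open>1\<close>, so this is an instance of uniform convergence; the pointwise
definition of slow variation says nothing here, since the ratio of \<open>t\<close> to its floor varies with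
\<open>t\<close>.\<close>

lemma slowly_varying_floor:
  assumes h: "slowly_varying h"
  shows "((\<lambda>t. h (real (nat \<lfloor>t\<rfloor>)) / h t) \<longlongrightarrow> 1) at_top"
proof -
  have "((\<lambda>t. ln (h (real (nat \<lfloor>t\<rfloor>)) / h t)) \<longlongrightarrow> 0) at_top"
  proof (rule tendstoI)
    fix e :: real assume "e > 0"
    then obtain X where X: "\<And>x s. x \<ge> X \<Longrightarrow> s \<in> {0..1} \<Longrightarrow>
        \<bar>ln (h (exp (x + s))) - ln (h (exp x))\<bar> \<le> e / 2"
      using slowly_varying_log_uniform[OF h, of "e / 2"] half_gt_zero by metis
    show "eventually (\<lambda>t. dist (ln (h (real (nat \<lfloor>t\<rfloor>)) / h t)) 0 < e) at_top"
      using eventually_ge_at_top[of "max 1 (exp X + 1)"]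
    proof eventually_elim
      case (elim t)
      define m where "m = real (nat \<lfloor>t\<rfloor>)"
      have m: "m \<ge> 1" "m \<le> t" "t < m + 1" "m \<ge> exp X"
      proof -
        have "t \<ge> 1" "t \<ge> exp X + 1" using elim by (simp_all only: max.bounded_iff)
        moreover have "m \<ge> 1" "m \<le> t" "t < m + 1"
          using calculation floor_correct[of t] by (simp_all add: m_def)
        ultimately show "m \<ge> 1" "m \<le> t" "t < m + 1" "m \<ge> exp X" by linarith+
      qed
      then have "ln m \<ge> X" by (simp add: ln_ge_iff)
      moreover have "ln t - ln m \<ge> 0" using m by simp
      moreover have "t / m \<le> exp 1"
      proof -
        have "t / m \<le> 2" using m by (simp add: field_simps)
        also have "2 \<le> exp (1::real)" using exp_ge_add_one_self[of 1] by simp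
        finally show ?thesis .
      qed
      then have "ln (t / m) \<le> ln (exp 1)"
        using m by (subst ln_le_cancel_iff) auto
      then have "ln t - ln m \<le> 1" using m by (simp add: ln_div)
      ultimately have "\<bar>ln (h (exp (ln m + (ln t - ln m)))) - ln (h (exp (ln m)))\<bar> \<le> e / 2"
        by (intro X) auto
      then show ?case
        using m \<open>e > 0\<close> slowly_varying_pos[OF h, of t] slowly_varying_pos[OF h, of m]
        by (simp add: dist_real_def ln_div m_def[symmetric] abs_minus_commute[of "ln (h m)"])
    qed
  qed
  then have "((\<lambda>t. exp (ln (h (real (nat \<lfloor>t\<rfloor>)) / h t))) \<longlongrightarrow> exp 0) at_top"
    by (rule tendsto_exp)
  moreover have "eventually (\<lambda>t. exp (ln (h (real (nat \<lfloor>t\<rfloor>)) / h t)) = h (real (nat \<lfloor>t\<rfloor>)) / h t) at_top"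
    using eventually_ge_at_top[of 1]
  proof eventually_elim
    case (elim t)
    then have "real (nat \<lfloor>t\<rfloor>) > 0" by linarith
    then show ?case using elim slowly_varying_pos[OF h] by simp
  qed
  ultimately show ?thesis by (simp add: tendsto_cong)
qed

section \<open>The integral of one minus cosine against a power\<close>

lemma nn_integral_Gamma_scaled:
  fixes s a :: real
  assumes "s > 0" "a > 0"
  shows "(\<integral>\<^sup>+u. ennreal (u powr (s - 1) * exp (- (a * u))) * indicator {0<..} u \<partial>lborel) = ennreal (Gamma s / a powr s)"
proof -
  have "ennreal (Gamma s) = (\<integral>\<^sup>+t. ennreal (indicator {0..} t * t powr (s - 1) / exp t) \<partial>lborel)"
    by (rule Gamma_conv_nn_integral_real) fact
  also have "\<dots> = ennreal a * (\<integral>\<^sup>+u. ennreal (indicator {0..} (0 + a * u) * (0 + a * u) powr (s - 1) / exp (0 + a * u)) \<partial>lborel)"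
    using assms by (subst nn_integral_real_affine[where c=a and t=0]) auto
  also have "(\<integral>\<^sup>+u. ennreal (indicator {0..} (0 + a * u) * (0 + a * u) powr (s - 1) / exp (0 + a * u)) \<partial>lborel)
     = (\<integral>\<^sup>+u. ennreal (a powr (s - 1)) * (ennreal (u powr (s - 1) * exp (- (a * u))) * indicator {0<..} u) \<partial>lborel)"
  proof (intro nn_integral_cong)
    fix u :: real
    show "ennreal (indicator {0..} (0 + a * u) * (0 + a * u) powr (s - 1) / exp (0 + a * u))
      = ennreal (a powr (s - 1)) * (ennreal (u powr (s - 1) * exp (- (a * u))) * indicator {0<..} u)"
      using assms by (auto simp: indicator_def ennreal_mult[symmetric] powr_mult exp_minus zero_le_mult_iff field_simps)
  qed
  also have "\<dots> = ennreal (a powr (s - 1)) * (\<integral>\<^sup>+u. ennreal (u powr (s - 1) * exp (- (a * u))) * indicator {0<..} u \<partial>lborel)"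
    by (rule nn_integral_cmult) measurable
  finally have "ennreal (Gamma s) = ennreal (a powr s) * (\<integral>\<^sup>+u. ennreal (u powr (s - 1) * exp (- (a * u))) * indicator {0<..} u \<partial>lborel)"
    using assms by (simp add: mult.assoc[symmetric] ennreal_mult[symmetric] powr_mult_base)
  moreover have "ennreal (1 / a powr s) * ennreal (a powr s) = 1"
    using assms by (simp add: ennreal_mult[symmetric])
  ultimately show ?thesis
    using assms by (metis (no_types, lifting) mult.assoc mult_1 mult.commute ennreal_mult[symmetric]
        Gamma_real_pos less_imp_le powr_ge_zero divide_inverse inverse_eq_divide zero_le_divide_1_iff)
qed

lemma nn_integral_exp_scaled:
  fixes a :: real
  assumes "a > 0"
  shows "(\<integral>\<^sup>+u. ennreal (exp (- (a * u))) * indicator {0<..} u \<partial>lborel) = ennreal (1 / a)"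
proof -
  have "(\<integral>\<^sup>+u. ennreal (exp (- (a * u))) * indicator {0<..} u \<partial>lborel)
      = (\<integral>\<^sup>+u. ennreal (u powr (1 - 1) * exp (- (a * u))) * indicator {0<..} u \<partial>lborel)"
    by (intro nn_integral_cong) (auto simp: indicator_def)
  then show ?thesis using nn_integral_Gamma_scaled[of 1 a] assms by simp
qed

lemma nn_integral_one_minus_cos_exp:
  fixes u :: real
  assumes "u > 0"
  shows "(\<integral>\<^sup>+y. ennreal ((1 - cos y) * exp (- (u * y))) * indicator {0<..} y \<partial>lborel) = ennreal (1 / (u * (1 + u\<^sup>2)))"
proof -
  have nz: "1 + u\<^sup>2 > 0" by (simp add: add_pos_nonneg)
  define P where "P y = - exp (- (u * y)) / u - exp (- (u * y)) * (sin y - u * cos y) / (1 + u\<^sup>2)" for y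
  have "(P \<longlongrightarrow> 0) at_top"
  proof (rule Lim_null_comparison)
    show "eventually (\<lambda>y. norm (P y) \<le> exp (- (u * y)) * (1 / u + (1 + u) / (1 + u\<^sup>2))) at_top"
    proof (rule always_eventually, rule allI)
      fix y
      have "\<bar>sin y - u * cos y\<bar> \<le> \<bar>sin y\<bar> + \<bar>u * cos y\<bar>" by linarith
      also have "\<dots> \<le> 1 + u"
        using assms by (intro add_mono) (auto simp: abs_mult intro: mult_left_le)
      finally have "\<bar>(sin y - u * cos y) / (1 + u\<^sup>2)\<bar> \<le> (1 + u) / (1 + u\<^sup>2)"
        using nz by (simp add: abs_div divide_right_mono)
      then have "\<bar>1 / u + (sin y - u * cos y) / (1 + u\<^sup>2)\<bar> \<le> 1 / u + (1 + u) / (1 + u\<^sup>2)"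
        using assms by (intro order_trans[OF abs_triangle_ineq] add_mono) auto
      then have "exp (- (u * y)) * \<bar>1 / u + (sin y - u * cos y) / (1 + u\<^sup>2)\<bar> \<le> exp (- (u * y)) * (1 / u + (1 + u) / (1 + u\<^sup>2))"
        by (intro mult_left_mono) auto
      moreover have "P y = - (exp (- (u * y)) * (1 / u + (sin y - u * cos y) / (1 + u\<^sup>2)))"
        by (simp add: P_def algebra_simps)
      ultimately show "norm (P y) \<le> exp (- (u * y)) * (1 / u + (1 + u) / (1 + u\<^sup>2))"
        by (simp add: abs_mult)
    qed
    show "((\<lambda>y. exp (- (u * y)) * (1 / u + (1 + u) / (1 + u\<^sup>2))) \<longlongrightarrow> 0) at_top"
      using assms by real_asymp
  qed
  moreover have "(P has_real_derivative (1 - cos y) * exp (- (u * y))) (at y)" for y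
    unfolding P_def using assms nz
    by (auto intro!: derivative_eq_intros) (simp add: field_simps power2_eq_square; algebra)?
  ultimately have "(\<integral>\<^sup>+y. ennreal ((1 - cos y) * exp (- (u * y))) * indicator {0..} y \<partial>lborel) = ennreal (0 - P 0)"
    by (intro nn_integral_FTC_atLeast) auto
  also have "0 - P 0 = 1 / (u * (1 + u\<^sup>2))"
    using assms nz by (simp add: P_def field_simps power2_eq_square)
  also have "(\<integral>\<^sup>+y. ennreal ((1 - cos y) * exp (- (u * y))) * indicator {0..} y \<partial>lborel)
    = (\<integral>\<^sup>+y. ennreal ((1 - cos y) * exp (- (u * y))) * indicator {0<..} y \<partial>lborel)"
    by (intro nn_integral_cong) (auto simp: indicator_def)
  finally show ?thesis .
qed

text \<open>The substitution \<open>v = u\<^sup>2\<close> in the Gamma integral, done on bounded intervals and extended by monotone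
convergence.\<close>

lemma nn_integral_powr_gauss:
  fixes a w :: real
  assumes "a > 0" "w > 0"
  shows "(\<integral>\<^sup>+u. ennreal (u powr (a - 1) * exp (- (w * u\<^sup>2))) * indicator {0<..} u \<partial>lborel) = ennreal (Gamma (a / 2) / 2 / w powr (a / 2))"
proof -
  define f where "f v = v powr (a / 2 - 1) * exp (- (w * v))" for v :: real
  have fin: "(\<integral>\<^sup>+v. ennreal (f v) * indicator {0..(real n)\<^sup>2} v \<partial>lborel)
     = 2 * (\<integral>\<^sup>+u. ennreal (u powr (a - 1) * exp (- (w * u\<^sup>2))) * indicator {0..real n} u \<partial>lborel)" for n :: nat
  proof (cases "n = 0")
    case True
    have "AE v in lborel. v \<noteq> (0::real)" by (simp add: AE_lborel_singleton)
    then have "AE v in lborel. ennreal (f v) * indicator {0..(real n)\<^sup>2} v = 0"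
      "AE u in lborel. ennreal (u powr (a - 1) * exp (- (w * u\<^sup>2))) * indicator {0..real n} u = 0"
      using True by (auto elim!: eventually_mono simp: indicator_def)
    then show ?thesis by (simp add: nn_integral_cong_AE[where v="\<lambda>_. 0"])
  next
    case False
    have m: "(\<lambda>v. f v * indicator {0..(real n)\<^sup>2} v) \<in> borel_measurable borel"
      unfolding f_def by measurable
    have set: "(\<integral>\<^sup>+v. ennreal (f v) * indicator {0..(real n)\<^sup>2} v \<partial>lborel) = (\<integral>\<^sup>+v. ennreal (f v * indicator {0\<^sup>2..(real n)\<^sup>2} v) \<partial>lborel)"
      by (intro nn_integral_cong) (auto simp: indicator_def)
    have "(\<integral>\<^sup>+v. ennreal (f v * indicator {0\<^sup>2..(real n)\<^sup>2} v) \<partial>lborel)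
      = (\<integral>\<^sup>+u. ennreal (f (u\<^sup>2) * (2 * u) * indicator {0..real n} u) \<partial>lborel)"
    proof (rule nn_integral_substitution)
      show "set_borel_measurable borel {0\<^sup>2..(real n)\<^sup>2} f"
        unfolding set_borel_measurable_def f_def by measurable
    qed (use False in \<open>auto intro!: derivative_eq_intros continuous_intros\<close>)
    also have "\<dots> = (\<integral>\<^sup>+u. 2 * (ennreal (u powr (a - 1) * exp (- (w * u\<^sup>2))) * indicator {0..real n} u) \<partial>lborel)"
    proof (intro nn_integral_cong)
      fix u :: real
      have "(u\<^sup>2) powr (a / 2 - 1) * u = u powr (a - 1)" if "u \<ge> 0"
      proof (cases "u = 0")
        case False
        then have "u\<^sup>2 = u powr 2" using that by (simp add: powr_numeral)
        then have "(u\<^sup>2) powr (a / 2 - 1) = u powr (a - 2)" by (simp add: powr_powr algebra_simps)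
        also have "\<dots> * u = u powr (a - 2 + 1)" using that False by (simp only: powr_add) simp
        finally show ?thesis by simp
      qed simp
      then show "ennreal (f (u\<^sup>2) * (2 * u) * indicator {0..real n} u) = 2 * (ennreal (u powr (a - 1) * exp (- (w * u\<^sup>2))) * indicator {0..real n} u)"
        by (auto simp: f_def indicator_def ennreal_mult' mult_ac simp flip: ennreal_numeral ennreal_mult')
    qed
    also have "\<dots> = 2 * (\<integral>\<^sup>+u. ennreal (u powr (a - 1) * exp (- (w * u\<^sup>2))) * indicator {0..real n} u \<partial>lborel)"
      by (rule nn_integral_cmult) measurable
    finally show ?thesis using set by simp
  qed
  have lim: "(\<lambda>n. \<integral>\<^sup>+v. g v * indicator {0..b n} v \<partial>lborel) \<longlonglongrightarrow> (\<integral>\<^sup>+v. g v * indicator {0<..} v \<partial>lborel)"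
    if g: "g \<in> borel_measurable borel" and b: "mono b" "filterlim b at_top sequentially"
    for g :: "real \<Rightarrow> ennreal" and b :: "nat \<Rightarrow> real"
  proof -
    have "(\<lambda>n. \<integral>\<^sup>+v. g v * indicator {0..b n} v \<partial>lborel) \<longlonglongrightarrow> (\<integral>\<^sup>+v. g v * indicator {0..} v \<partial>lborel)"
    proof (rule nn_integral_LIMSEQ)
      show "incseq (\<lambda>n v. g v * indicator {0..b n} v)"
        using b(1) by (auto simp: incseq_def le_fun_def indicator_def monoD intro: order_trans)
      fix v :: real
      have "eventually (\<lambda>n. v \<le> b n) sequentially" using b(2) by (simp add: filterlim_at_top)
      then have "eventually (\<lambda>n. g v * indicator {0..b n} v = g v * indicator {0..} v) sequentially"
        by eventually_elim (auto simp: indicator_def)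
      then show "(\<lambda>n. g v * indicator {0..b n} v) \<longlonglongrightarrow> g v * indicator {0..} v"
        by (rule tendsto_eventually)
    qed (use g in measurable)
    also have "(\<integral>\<^sup>+v. g v * indicator {0..} v \<partial>lborel) = (\<integral>\<^sup>+v. g v * indicator {0<..} v \<partial>lborel)"
      using AE_lborel_singleton[of "0::real"]
      by (intro nn_integral_cong_AE) (auto elim!: eventually_mono simp: indicator_def)
    finally show ?thesis .
  qed
  have "(\<lambda>n. \<integral>\<^sup>+v. ennreal (f v) * indicator {0..(real n)\<^sup>2} v \<partial>lborel) \<longlonglongrightarrow> (\<integral>\<^sup>+v. ennreal (f v) * indicator {0<..} v \<partial>lborel)"
    by (rule lim) (auto simp: f_def mono_def power_mono intro!: filterlim_pow_at_top filterlim_real_sequentially)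
  moreover have "(\<lambda>n. 2 * (\<integral>\<^sup>+u. ennreal (u powr (a - 1) * exp (- (w * u\<^sup>2))) * indicator {0..real n} u \<partial>lborel))
     \<longlonglongrightarrow> 2 * (\<integral>\<^sup>+u. ennreal (u powr (a - 1) * exp (- (w * u\<^sup>2))) * indicator {0<..} u \<partial>lborel)"
    by (intro tendsto_mult_ennreal tendsto_const lim) (auto simp: mono_def intro!: filterlim_real_sequentially)
  ultimately have "(\<integral>\<^sup>+v. ennreal (f v) * indicator {0<..} v \<partial>lborel) = 2 * (\<integral>\<^sup>+u. ennreal (u powr (a - 1) * exp (- (w * u\<^sup>2))) * indicator {0<..} u \<partial>lborel)"
    unfolding fin by (rule LIMSEQ_unique)
  moreover have "(\<integral>\<^sup>+v. ennreal (f v) * indicator {0<..} v \<partial>lborel) = ennreal (Gamma (a / 2) / w powr (a / 2))"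
    unfolding f_def using assms by (intro nn_integral_Gamma_scaled) auto
  ultimately have *: "2 * (\<integral>\<^sup>+u. ennreal (u powr (a - 1) * exp (- (w * u\<^sup>2))) * indicator {0<..} u \<partial>lborel) = ennreal (Gamma (a / 2) / w powr (a / 2))" (is "2 * ?J = _")
    by simp
  have "?J = ennreal (1/2) * (2 * ?J)"
    using ennreal_mult'[of 2 "1/2"] by (simp add: mult.assoc[symmetric] mult.commute)
  also have "\<dots> = ennreal (Gamma (a / 2) / 2 / w powr (a / 2))"
    unfolding * by (subst ennreal_mult'[symmetric]) simp_all
  finally show ?thesis .
qed

text \<open>Writing \<open>1 / (1 + u\<^sup>2)\<close> as the integral of \<open>exp (- (1 + u\<^sup>2) w)\<close> over \<open>w > 0\<close> and exchanging the order
of integration leaves \<open>\<Gamma>(a/2) \<Gamma>(1 - a/2) / 2\<close>, to which the reflection formula applies.\<close>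

lemma nn_integral_powr_over_one_plus_square:
  fixes a :: real
  assumes a: "0 < a" "a < 2"
  shows "(\<integral>\<^sup>+u. ennreal (u powr (a - 1) / (1 + u\<^sup>2)) * indicator {0<..} u \<partial>lborel) = ennreal (pi / (2 * sin (pi * a / 2)))"
proof -
  define f where "f u w = ennreal (u powr (a - 1) * exp (- ((1 + u\<^sup>2) * w))) * indicator {0<..} w * indicator {0<..} u" for u w :: real
  have [measurable]: "case_prod f \<in> borel_measurable (lborel \<Otimes>\<^sub>M lborel)"
    unfolding f_def by measurable
  have inner_w: "(\<integral>\<^sup>+w. f u w \<partial>lborel) = ennreal (u powr (a - 1) / (1 + u\<^sup>2)) * indicator {0<..} u" for u
  proof -
    have p: "1 + u\<^sup>2 > 0" by (simp add: add_pos_nonneg)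
    define e where "e w = ennreal (exp (- ((1 + u\<^sup>2) * w))) * indicator {0<..} w" for w :: real
    have e: "e \<in> borel_measurable lborel" "(\<integral>\<^sup>+w. e w \<partial>lborel) = ennreal (1 / (1 + u\<^sup>2))"
      using nn_integral_exp_scaled[OF p] unfolding e_def by auto
    have "f u w = ennreal (u powr (a - 1)) * indicator {0<..} u * e w" for w
      by (auto simp: f_def e_def indicator_def ennreal_mult')
    then have "(\<integral>\<^sup>+w. f u w \<partial>lborel) = ennreal (u powr (a - 1)) * indicator {0<..} u * ennreal (1 / (1 + u\<^sup>2))"
      using e by (simp add: nn_integral_cmult)
    also have "\<dots> = ennreal (u powr (a - 1) / (1 + u\<^sup>2)) * indicator {0<..} u"
      using p by (auto simp: indicator_def simp flip: ennreal_mult')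
    finally show ?thesis .
  qed
  have inner_u: "(\<integral>\<^sup>+u. f u w \<partial>lborel) = ennreal (Gamma (a / 2) / 2) * (ennreal (w powr ((1 - a / 2) - 1) * exp (- (1 * w))) * indicator {0<..} w)" for w
  proof (cases "w > 0")
    case True
    have "(\<integral>\<^sup>+u. f u w \<partial>lborel) = (\<integral>\<^sup>+u. ennreal (exp (- w)) * (ennreal (u powr (a - 1) * exp (- (w * u\<^sup>2))) * indicator {0<..} u) \<partial>lborel)"
      using True by (intro nn_integral_cong) (auto simp: f_def indicator_def ring_distribs exp_diff exp_minus mult_ac divide_inverse simp flip: ennreal_mult')
    also have "\<dots> = ennreal (exp (- w)) * ennreal (Gamma (a / 2) / 2 / w powr (a / 2))"
      using True a by (subst nn_integral_cmult) (simp_all add: nn_integral_powr_gauss)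
    also have "\<dots> = ennreal (Gamma (a / 2) / 2) * (ennreal (w powr ((1 - a / 2) - 1) * exp (- (1 * w))) * indicator {0<..} w)"
      using True a by (simp add: powr_minus field_simps Gamma_real_pos less_imp_le flip: ennreal_mult')
    finally show ?thesis .
  qed (simp add: f_def)
  have "(\<integral>\<^sup>+u. ennreal (u powr (a - 1) / (1 + u\<^sup>2)) * indicator {0<..} u \<partial>lborel) = (\<integral>\<^sup>+u. (\<integral>\<^sup>+w. f u w \<partial>lborel) \<partial>lborel)"
    by (simp add: inner_w)
  also have "\<dots> = (\<integral>\<^sup>+w. (\<integral>\<^sup>+u. f u w \<partial>lborel) \<partial>lborel)"
    by (rule lborel_pair.Fubini'[symmetric]) measurable
  also have "\<dots> = ennreal (Gamma (a / 2) / 2) * ennreal (Gamma (1 - a / 2) / 1 powr (1 - a / 2))"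
  proof -
    have "1 - a / 2 > 0" using a by simp
    from nn_integral_Gamma_scaled[OF this zero_less_one] show ?thesis
      unfolding inner_u by (subst nn_integral_cmult) simp_all
  qed
  also have "\<dots> = ennreal (Gamma (a / 2) * Gamma (1 - a / 2) / 2)"
  proof -
    have "Gamma (a / 2) > 0" using a by (intro Gamma_real_pos) simp
    then show ?thesis by (subst ennreal_mult'[symmetric]) simp_all
  qed
  also have "Gamma (a / 2) * Gamma (1 - a / 2) = pi / sin (pi * (a / 2))"
  proof -
    have "complex_of_real (Gamma (a / 2) * Gamma (1 - a / 2)) = of_real (pi / sin (pi * (a / 2)))"
    proof -
      have "complex_of_real (Gamma (a / 2) * Gamma (1 - a / 2)) = Gamma (of_real (a / 2)) * Gamma (of_real (1 - a / 2))"
        by (simp only: Gamma_complex_of_real of_real_mult)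
      also have "\<dots> = of_real pi / sin (of_real pi * of_real (a / 2))"
        unfolding of_real_diff of_real_1 by (rule Gamma_reflection_complex)
      also have "\<dots> = of_real (pi / sin (pi * (a / 2)))"
        by (subst of_real_mult[symmetric], subst sin_of_real, subst of_real_divide) (rule refl)
      finally show ?thesis .
    qed
    then show ?thesis by (simp only: of_real_eq_iff)
  qed
  finally show ?thesis by (simp add: field_simps)
qed

definition cos_powr_integral :: "real \<Rightarrow> real" where
  "cos_powr_integral a = pi / (2 * Gamma (1 + a) * sin (pi * a / 2))"

lemma cos_powr_integral_pos:
  assumes "0 < a" "a < 2"
  shows "cos_powr_integral a > 0"
proof -
  have "pi * a < pi * 2" using assms by (intro mult_strict_left_mono) auto
  then have "sin (pi * a / 2) > 0" using assms by (intro sin_gt_zero) auto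
  moreover have "Gamma (1 + a) > 0" using assms by (intro Gamma_real_pos) auto
  ultimately show ?thesis by (simp add: cos_powr_integral_def)
qed

text \<open>\<open>y powr (-1 - a)\<close> is \<open>1 / \<Gamma>(1 + a)\<close> times the integral of \<open>u powr a * exp (- u y)\<close> over \<open>u > 0\<close>. After
Tonelli the inner integral over \<open>y\<close> is the Laplace transform of \<open>1 - cos\<close>.\<close>

lemma nn_integral_one_minus_cos_powr:
  fixes a :: real
  assumes a: "0 < a" "a < 2"
  shows "(\<integral>\<^sup>+y. ennreal ((1 - cos y) * y powr (- 1 - a)) * indicator {0<..} y \<partial>lborel) = ennreal (cos_powr_integral a)"
proof -
  define f where "f y u = ennreal ((1 - cos y) * u powr a * exp (- (u * y))) * indicator {0<..} y * indicator {0<..} u" for y u :: real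
  have [measurable]: "case_prod f \<in> borel_measurable (lborel \<Otimes>\<^sub>M lborel)"
    unfolding f_def by measurable
  have G: "Gamma (1 + a) > 0" using a by (intro Gamma_real_pos) auto
  have inner_u: "(\<integral>\<^sup>+u. f y u \<partial>lborel) = ennreal (Gamma (1 + a)) * (ennreal ((1 - cos y) * y powr (- 1 - a)) * indicator {0<..} y)" for y
  proof (cases "y > 0")
    case True
    have "(\<integral>\<^sup>+u. f y u \<partial>lborel) = (\<integral>\<^sup>+u. ennreal (1 - cos y) * (ennreal (u powr ((1 + a) - 1) * exp (- (y * u))) * indicator {0<..} u) \<partial>lborel)"
      using True by (intro nn_integral_cong) (auto simp: f_def indicator_def mult_ac simp flip: ennreal_mult')
    also have "\<dots> = ennreal (1 - cos y) * ennreal (Gamma (1 + a) / y powr (1 + a))"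
      using True a by (subst nn_integral_cmult) (simp_all only: nn_integral_Gamma_scaled, simp_all)
    also have "\<dots> = ennreal (Gamma (1 + a)) * (ennreal ((1 - cos y) * y powr (- 1 - a)) * indicator {0<..} y)"
      using True G powr_minus[of y "1 + a"] by (simp add: field_simps flip: ennreal_mult')
    finally show ?thesis .
  qed (simp add: f_def)
  have inner_y: "(\<integral>\<^sup>+y. f y u \<partial>lborel) = ennreal (u powr (a - 1) / (1 + u\<^sup>2)) * indicator {0<..} u" for u
  proof (cases "u > 0")
    case True
    have "(\<integral>\<^sup>+y. f y u \<partial>lborel) = (\<integral>\<^sup>+y. ennreal (u powr a) * (ennreal ((1 - cos y) * exp (- (u * y))) * indicator {0<..} y) \<partial>lborel)"
      using True by (intro nn_integral_cong) (auto simp: f_def indicator_def mult_ac simp flip: ennreal_mult')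
    also have "\<dots> = ennreal (u powr a) * ennreal (1 / (u * (1 + u\<^sup>2)))"
      using True by (subst nn_integral_cmult) (simp_all add: nn_integral_one_minus_cos_exp)
    also have "\<dots> = ennreal (u powr (a - 1) / (1 + u\<^sup>2)) * indicator {0<..} u"
      using True by (simp add: powr_diff field_simps flip: ennreal_mult')
    finally show ?thesis .
  qed (simp add: f_def)
  have "ennreal (Gamma (1 + a)) * (\<integral>\<^sup>+y. ennreal ((1 - cos y) * y powr (- 1 - a)) * indicator {0<..} y \<partial>lborel)
     = (\<integral>\<^sup>+y. (\<integral>\<^sup>+u. f y u \<partial>lborel) \<partial>lborel)"
    unfolding inner_u by (rule nn_integral_cmult[symmetric]) measurable
  also have "\<dots> = (\<integral>\<^sup>+u. (\<integral>\<^sup>+y. f y u \<partial>lborel) \<partial>lborel)"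
    by (rule lborel_pair.Fubini'[symmetric]) measurable
  also have "\<dots> = ennreal (pi / (2 * sin (pi * a / 2)))"
    unfolding inner_y using a by (rule nn_integral_powr_over_one_plus_square)
  finally have *: "ennreal (Gamma (1 + a)) * (\<integral>\<^sup>+y. ennreal ((1 - cos y) * y powr (- 1 - a)) * indicator {0<..} y \<partial>lborel)
     = ennreal (pi / (2 * sin (pi * a / 2)))" (is "_ * ?J = _") .
  have "?J = ennreal (1 / Gamma (1 + a)) * (ennreal (Gamma (1 + a)) * ?J)"
    using G by (simp add: mult.assoc[symmetric] flip: ennreal_mult')
  also have "\<dots> = ennreal (cos_powr_integral a)"
    unfolding * cos_powr_integral_def using G by (simp add: mult_ac flip: ennreal_mult')
  finally show ?thesis .
qed

text \<open>The Levy-Khinchin representation of \<open>|t| powr a\<close>, obtained from the case \<open>t = 1\<close> by scaling.\<close>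

lemma has_bochner_integral_one_minus_cos_powr:
  fixes a t :: real
  assumes a: "0 < a" "a < 2"
  shows "has_bochner_integral lborel (\<lambda>y. (1 - cos (t * y)) * y powr (- 1 - a) * indicator {0<..} y) (\<bar>t\<bar> powr a * cos_powr_integral a)"
proof -
  have unit: "has_bochner_integral lborel (\<lambda>y. (1 - cos y) * y powr (- 1 - a) * indicator {0<..} y) (cos_powr_integral a)"
  proof (rule has_bochner_integral_nn_integral)
    show "(\<integral>\<^sup>+y. ennreal ((1 - cos y) * y powr (- 1 - a) * indicator {0<..} y) \<partial>lborel) = ennreal (cos_powr_integral a)"
      unfolding nn_integral_one_minus_cos_powr[OF a, symmetric]
      by (intro nn_integral_cong) (auto simp: indicator_def)
  qed (use cos_powr_integral_pos[OF a] in \<open>auto simp: indicator_def\<close>)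
  show ?thesis
  proof (cases "t = 0")
    case True
    then show ?thesis by (simp add: has_bochner_integral_zero)
  next
    case False
    have "has_bochner_integral lborel (\<lambda>y. (1 - cos (0 + \<bar>t\<bar> * y)) * (0 + \<bar>t\<bar> * y) powr (- 1 - a) * indicator {0<..} (0 + \<bar>t\<bar> * y)) (cos_powr_integral a /\<^sub>R \<bar>\<bar>t\<bar>\<bar>)"
      using False by (intro lborel_has_bochner_integral_real_affine_iff[THEN iffD1, OF _ unit]) auto
    then have scaled: "has_bochner_integral lborel (\<lambda>y. \<bar>t\<bar> powr (1 + a) * ((1 - cos (0 + \<bar>t\<bar> * y)) * (0 + \<bar>t\<bar> * y) powr (- 1 - a) * indicator {0<..} (0 + \<bar>t\<bar> * y)))
       (\<bar>t\<bar> powr (1 + a) * (cos_powr_integral a /\<^sub>R \<bar>\<bar>t\<bar>\<bar>))"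
      by (rule has_bochner_integral_mult_right)
    have eq: "\<bar>t\<bar> powr (1 + a) * ((1 - cos (0 + \<bar>t\<bar> * y)) * (0 + \<bar>t\<bar> * y) powr (- 1 - a) * indicator {0<..} (0 + \<bar>t\<bar> * y))
       = (1 - cos (t * y)) * y powr (- 1 - a) * indicator {0<..} y" for y
    proof (cases "y > 0")
      case True
      have "\<bar>t\<bar> powr (1 + a) * (\<bar>t\<bar> * y) powr (- 1 - a) = \<bar>t\<bar> powr ((1 + a) + (- 1 - a)) * y powr (- 1 - a)"
        using True False unfolding powr_add by (simp add: powr_mult)
      also have "\<dots> = y powr (- 1 - a)" using False by simp
      finally have "\<bar>t\<bar> powr (1 + a) * (\<bar>t\<bar> * y) powr (- 1 - a) = y powr (- 1 - a)" .
      moreover have "cos (\<bar>t\<bar> * y) = cos (t * y)" by (cases "t \<ge> 0") auto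
      ultimately show ?thesis using True False by (simp add: mult.assoc mult.left_commute)
    next
      case False
      then show ?thesis by (simp add: indicator_def zero_less_mult_iff)
    qed
    have "\<bar>t\<bar> powr (1 + a) * (cos_powr_integral a /\<^sub>R \<bar>\<bar>t\<bar>\<bar>) = \<bar>t\<bar> powr a * cos_powr_integral a"
      using False by (simp add: powr_add)
    with scaled show ?thesis unfolding eq by (simp only:)
  qed
qed

section \<open>The squared Dirichlet ratio as a kernel\<close>

text \<open>A constant in place of the abbreviation \<open>sinc\<close>, so that the case distinction at \<open>0\<close> is not unfolded
by the simplifier.\<close>

definition sin_over :: "real \<Rightarrow> real" where
  "sin_over x = sinc x"

lemma sin_over_0 [simp]: "sin_over 0 = 1"
  by (simp add: sin_over_def)

lemma sin_half_eq_sin_over: "sin (t / 2) = t / 2 * sin_over (t / 2)" for t :: real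
  by (simp add: sin_over_def)

lemma sin_over_lower_bound: "1 - x\<^sup>2 / 6 \<le> sin_over x" for x :: real
proof -
  have sin_lower: "x - x ^ 3 / 6 \<le> sin x" if "x > 0" for x :: real
  proof -
    have *: "\<bar>sin x - (\<Sum>m<3. sin_coeff m * x ^ m)\<bar> \<le> inverse (fact 3) * \<bar>x\<bar> ^ 3"
      by (rule Maclaurin_sin_bound)
    have "\<bar>sin x - x\<bar> \<le> x ^ 3 / 6"
    proof -
      have "(\<Sum>m<3. sin_coeff m * x ^ m) = x"
        by (simp add: eval_nat_numeral sin_coeff_def)
      moreover have "inverse (fact 3 :: real) * \<bar>x\<bar> ^ 3 = x ^ 3 / 6"
        using that by (simp add: fact_numeral)
      ultimately show ?thesis using *  by simp
    qed
    then show ?thesis by linarith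
  qed
  have pos: "1 - x\<^sup>2 / 6 \<le> sin_over x" if "x > 0" for x :: real
  proof -
    have "1 - x\<^sup>2 / 6 = (x - x ^ 3 / 6) / x" using that by (simp add: field_simps power2_eq_square power3_eq_cube)
    also have "\<dots> \<le> sin x / x" using that sin_lower[OF that] by (intro divide_right_mono) auto
    finally show ?thesis using that by (simp add: sin_over_def)
  qed
  consider "x = 0" | "x > 0" | "x < 0" by linarith
  then show ?thesis
  proof cases
    case 3
    then show ?thesis using pos[of "- x"] by (simp add: sin_over_def)
  qed (use pos in auto)
qed

lemma abs_sin_over_le_1: "\<bar>sin_over x\<bar> \<le> 1" for x :: real
  using abs_sin_x_le_abs_x[of x] by (auto simp: sin_over_def abs_div divide_simps)

lemma sin_over_half_ge:
  fixes t :: real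
  assumes "0 \<le> t" "t \<le> pi"
  shows "1 / 3 \<le> sin_over (t / 2)"
proof -
  have "t\<^sup>2 \<le> 4\<^sup>2" using assms pi_less_4 by (intro power_mono) auto
  then have "1 / 3 \<le> 1 - (t / 2)\<^sup>2 / 6" by (simp add: power_divide)
  also have "\<dots> \<le> sin_over (t / 2)" by (rule sin_over_lower_bound)
  finally show ?thesis .
qed

text \<open>For \<open>t \<noteq> 0\<close> this is \<open>sin (s t / 2) / sin (t / 2)\<close>; at \<open>t = 0\<close> it takes the limiting value \<open>s\<close>, so
a spectral atom at frequency \<open>0\<close> needs no separate treatment. For \<open>s = n\<close> its modulus is that of the
sum of \<open>exp (i j t)\<close> over \<open>j = 1, \<dots>, n\<close>.\<close>

definition dirichlet_ratio :: "real \<Rightarrow> real \<Rightarrow> real" where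
  "dirichlet_ratio s t = s * sin_over (s * t / 2) / sin_over (t / 2)"

lemma dirichlet_ratio_0 [simp]: "dirichlet_ratio s 0 = s"
  by (simp add: dirichlet_ratio_def)

lemma dirichlet_ratio_nz:
  assumes "t \<noteq> 0"
  shows "dirichlet_ratio s t = sin (s * t / 2) / sin (t / 2)"
  using assms by (auto simp: dirichlet_ratio_def sin_over_def)

lemma isCont_sin_over: "isCont sin_over x"
  unfolding sin_over_def[abs_def] by (rule isCont_sinc)

lemma measurable_sin_over [measurable]: "sin_over \<in> borel_measurable borel"
  by (intro borel_measurable_continuous_onI continuous_at_imp_continuous_on ballI isCont_sin_over)

lemma dirichlet_ratio_measurable [measurable]: "dirichlet_ratio s \<in> borel_measurable borel"
  unfolding dirichlet_ratio_def by measurable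

lemma dirichlet_ratio_uminus [simp]: "dirichlet_ratio (- s) t = - dirichlet_ratio s t"
  by (simp add: dirichlet_ratio_def sin_over_def)

lemma dirichlet_ratio_diff_le:
  assumes "0 \<le> t" "t \<le> pi"
  shows "\<bar>dirichlet_ratio s t - dirichlet_ratio u t\<bar> \<le> 3 * \<bar>s - u\<bar>"
proof (cases "t = 0")
  case False
  have sin_over: "1 / 3 \<le> sin_over (t / 2)" using assms by (rule sin_over_half_ge)
  have "\<bar>sin (s * t / 2) - sin (u * t / 2)\<bar> = 2 * \<bar>sin ((s - u) * t / 4)\<bar> * \<bar>cos ((s + u) * t / 4)\<bar>"
    by (subst sin_diff_sin) (simp add: abs_mult field_simps)
  also have "\<dots> \<le> 2 * \<bar>(s - u) * t / 4\<bar> * 1"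
    by (intro mult_mono mult_left_mono abs_sin_x_le_abs_x abs_cos_le_one) auto
  finally have "\<bar>sin (s * t / 2) - sin (u * t / 2)\<bar> \<le> \<bar>s - u\<bar> * (t / 2)"
    using assms by (simp add: abs_mult mult.commute)
  then have "\<bar>sin (s * t / 2) - sin (u * t / 2)\<bar> / sin (t / 2) \<le> \<bar>s - u\<bar> * (t / 2) / sin (t / 2)"
    using assms sin_over unfolding sin_half_eq_sin_over[of t] by (intro divide_right_mono) auto
  also have "\<dots> = \<bar>s - u\<bar> / sin_over (t / 2)"
    using False unfolding sin_half_eq_sin_over[of t] by simp
  also have "\<dots> \<le> \<bar>s - u\<bar> / (1 / 3)" using sin_over by (intro divide_left_mono) auto
  also have "\<bar>sin (s * t / 2) - sin (u * t / 2)\<bar> / sin (t / 2) = \<bar>dirichlet_ratio s t - dirichlet_ratio u t\<bar>"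
  proof -
    have "sin (t / 2) > 0" using assms False by (intro sin_gt_zero) auto
    then show ?thesis using False by (simp add: dirichlet_ratio_nz abs_div diff_divide_distrib[symmetric])
  qed
  finally show ?thesis by simp
qed simp

lemma abs_dirichlet_ratio_le: "0 \<le> t \<Longrightarrow> t \<le> pi \<Longrightarrow> \<bar>dirichlet_ratio s t\<bar> \<le> 3 * \<bar>s\<bar>"
  using dirichlet_ratio_diff_le[of t s 0] by (simp add: dirichlet_ratio_def)

text \<open>The identity behind the Tauberian half. Since \<open>2 sin\<^sup>2(x/2) = 1 - cos x\<close>, it is the addition
theorem for the cosine.\<close>

lemma dirichlet_ratio_second_difference:
  assumes "0 \<le> t" "t \<le> pi"
  shows "(dirichlet_ratio (s + u) t)\<^sup>2 + (dirichlet_ratio (s - u) t)\<^sup>2 - 2 * (dirichlet_ratio s t)\<^sup>2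
    = 2 * cos (s * t) * (dirichlet_ratio u t)\<^sup>2"
proof (cases "t = 0")
  case True
  then show ?thesis by (simp add: power2_eq_square algebra_simps)
next
  case False
  have half: "(sin (x / 2))\<^sup>2 = (1 - cos x) / 2" for x :: real
    using cos_double_sin[of "x / 2"] by simp
  have nz: "sin (t / 2) \<noteq> 0" using sin_gt_zero[of "t / 2"] assms False by auto
  have "(sin ((s + u) * t / 2))\<^sup>2 + (sin ((s - u) * t / 2))\<^sup>2 - 2 * (sin (s * t / 2))\<^sup>2
     = 2 * cos (s * t) * (sin (u * t / 2))\<^sup>2"
  proof -
    have "cos ((s + u) * t) = cos (s * t) * cos (u * t) - sin (s * t) * sin (u * t)"
      "cos ((s - u) * t) = cos (s * t) * cos (u * t) + sin (s * t) * sin (u * t)"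
      by (simp_all add: distrib_right left_diff_distrib cos_add cos_diff)
    then show ?thesis
      unfolding half by (simp only: diff_divide_distrib add_divide_distrib right_diff_distrib)
  qed
  then have "((sin ((s + u) * t / 2))\<^sup>2 + (sin ((s - u) * t / 2))\<^sup>2 - 2 * (sin (s * t / 2))\<^sup>2) / (sin (t / 2))\<^sup>2
     = 2 * cos (s * t) * (sin (u * t / 2))\<^sup>2 / (sin (t / 2))\<^sup>2" by simp
  then show ?thesis
    using False by (simp add: dirichlet_ratio_nz power_divide diff_divide_distrib add_divide_distrib)
qed

section \<open>Measures on the circle with vanishing sine coefficients\<close>

lemma (in finite_borel_measure) integrable_bounded_borel:
  fixes f :: "real \<Rightarrow> 'b::{banach, second_countable_topology}"
  assumes "f \<in> borel_measurable borel" "\<And>x. norm (f x) \<le> B"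
  shows "integrable M f"
  using assms M_is_borel
  by (intro integrable_const_bound[of _ B]) (auto cong: measurable_cong_sets)

text \<open>Multiplication by \<open>cos x\<close> maps \<open>sin (j x)\<close> to the mean of its two neighbours.\<close>

lemma (in finite_borel_measure) integral_cos_power_sin_eq_0:
  assumes odd: "\<And>n::int. (\<integral>x. sin (of_int n * x) \<partial>M) = 0"
  shows "(\<integral>x. cos x ^ k * sin (of_int j * x) \<partial>M) = 0"
proof (induction k arbitrary: j)
  case 0
  show ?case using odd by simp
next
  case (Suc k)
  have int: "integrable M (\<lambda>x. cos x ^ k * sin (of_int i * x))" for i :: int
    by (rule integrable_bounded_borel[of _ 1])
       (auto simp: abs_mult power_abs intro!: mult_le_one power_le_one)
  have eq: "cos x ^ Suc k * sin (of_int j * x)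
     = (1/2) * (cos x ^ k * sin (of_int (j + 1) * x)) + (1/2) * (cos x ^ k * sin (of_int (j - 1) * x))" for x :: real
  proof -
    have "sin (of_int (j + 1) * x) + sin (of_int (j - 1) * x) = 2 * (cos x * sin (of_int j * x))"
      by (simp add: ring_distribs sin_add sin_diff)
    then have "cos x * sin (of_int j * x) = (1/2) * sin (of_int (j + 1) * x) + (1/2) * sin (of_int (j - 1) * x)"
      by simp
    then show ?thesis by (simp only: power_Suc2 mult.assoc) (simp add: ring_distribs)
  qed
  have "(\<integral>x. cos x ^ Suc k * sin (of_int j * x) \<partial>M)
     = (1/2) * (\<integral>x. cos x ^ k * sin (of_int (j + 1) * x) \<partial>M) + (1/2) * (\<integral>x. cos x ^ k * sin (of_int (j - 1) * x) \<partial>M)"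
    unfolding eq by (simp only: Bochner_Integration.integral_add integrable_mult_right int integral_mult_right_zero)
  then show ?case by (simp only: Suc mult_zero_right add_0)
qed

lemma (in finite_borel_measure) integral_continuous_cos_sin_eq_0:
  assumes odd: "\<And>n::int. (\<integral>x. sin (of_int n * x) \<partial>M) = 0"
    and f: "continuous_on UNIV f"
  shows "(\<integral>x. f (cos x) * sin x \<partial>M) = 0"
proof -
  have "bounded (f ` {-1..1})"
    by (intro compact_imp_bounded compact_continuous_image continuous_on_subset[OF f]) auto
  then obtain B where "\<forall>y\<in>f ` {-1..1}. norm y \<le> B" unfolding bounded_iff by blast
  then have B: "\<bar>f c\<bar> \<le> B" if "c \<in> {-1..1}" for c using that by auto
  have [measurable]: "f \<in> borel_measurable borel" by (rule borel_measurable_continuous_onI[OF f])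
  have "B \<ge> 0" using B[of 0] by simp
  have int_f: "integrable M (\<lambda>x. f (cos x) * sin x)"
    using B \<open>B \<ge> 0\<close> by (intro integrable_bounded_borel[of _ "B * 1"]) (auto simp: abs_mult simp del: mult_1_right intro!: mult_mono)
  have bound: "\<bar>\<integral>x. f (cos x) * sin x \<partial>M\<bar> \<le> e * measure M (space M)" if "e > 0" for e
  proof -
    obtain p where p: "real_polynomial_function p" "\<And>c. c \<in> {-1..1} \<Longrightarrow> \<bar>f c - p c\<bar> < e"
      using Stone_Weierstrass_real_polynomial_function[of "{-1..1}" f e] \<open>e > 0\<close> continuous_on_subset[OF f]
      by auto
    obtain a n where pa: "p = (\<lambda>x. \<Sum>i\<le>n. a i * x ^ i)"
      using p(1) real_polynomial_function_iff_sum by auto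
    have int_p: "integrable M (\<lambda>x. a i * (cos x ^ i * sin x))" for i
      by (intro integrable_mult_right integrable_bounded_borel[of _ 1])
         (auto simp: abs_mult power_abs intro!: mult_le_one power_le_one)
    have p_sum: "p (cos x) * sin x = (\<Sum>i\<le>n. a i * (cos x ^ i * sin x))" for x
      by (simp add: pa sum_distrib_right mult.assoc)
    have "(\<integral>x. p (cos x) * sin x \<partial>M) = (\<Sum>i\<le>n. a i * (\<integral>x. cos x ^ i * sin x \<partial>M))"
      unfolding p_sum using int_p by (subst Bochner_Integration.integral_sum) auto
    also have "\<dots> = 0"
      using integral_cos_power_sin_eq_0[OF odd, of _ 1] by simp
    finally have "(\<integral>x. f (cos x) * sin x \<partial>M) = (\<integral>x. f (cos x) * sin x \<partial>M) - (\<integral>x. p (cos x) * sin x \<partial>M)"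
      by simp
    also have "\<dots> = (\<integral>x. f (cos x) * sin x - p (cos x) * sin x \<partial>M)"
      using int_f int_p by (subst Bochner_Integration.integral_diff) (auto simp: p_sum)
    also have "\<bar>\<dots>\<bar> \<le> (\<integral>x. e \<partial>M)"
    proof (rule order_trans[OF integral_abs_bound integral_mono])
      show "integrable M (\<lambda>x. \<bar>f (cos x) * sin x - p (cos x) * sin x\<bar>)"
        using int_f int_p by (intro integrable_abs Bochner_Integration.integrable_diff) (auto simp: p_sum)
      fix x
      have "\<bar>f (cos x) * sin x - p (cos x) * sin x\<bar> = \<bar>f (cos x) - p (cos x)\<bar> * \<bar>sin x\<bar>"
        by (simp add: abs_mult[symmetric] left_diff_distrib)
      also have "\<dots> \<le> e * 1"
        using p(2)[of "cos x"] \<open>e > 0\<close> by (intro mult_mono) auto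
      finally show "\<bar>f (cos x) * sin x - p (cos x) * sin x\<bar> \<le> e" by simp
    qed auto
    finally show ?thesis by (simp add: mult.commute)
  qed
  have "\<bar>\<integral>x. f (cos x) * sin x \<partial>M\<bar> \<le> 0"
  proof (rule field_le_epsilon)
    fix e :: real assume "e > 0"
    define m where "m = measure M (space M) + 1"
    have "m > 0" using measure_nonneg[of M "space M"] unfolding m_def by linarith
    then have "\<bar>\<integral>x. f (cos x) * sin x \<partial>M\<bar> \<le> e / m * measure M (space M)"
      using \<open>e > 0\<close> by (intro bound) auto
    also have "\<dots> \<le> e / m * m" using \<open>m > 0\<close> \<open>e > 0\<close> by (intro mult_left_mono) (auto simp: m_def)
    finally show "\<bar>\<integral>x. f (cos x) * sin x \<partial>M\<bar> \<le> 0 + e" using \<open>m > 0\<close> by simp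
  qed
  then show ?thesis by simp
qed

text \<open>\<open>sgn (sin x)\<close> on a level set of the cosine is the bounded pointwise limit of \<open>g(cos x) sin x\<close> with \<open>g\<close>
continuous: divide by \<open>|sin x|\<close>, a function of \<open>cos x\<close>, away from its zeros. For the spectral measure
this compares the mass of an arc above the real axis with that of its mirror image.\<close>

lemma (in finite_borel_measure) integral_cos_threshold_sgn_sin_eq_0:
  assumes odd: "\<And>n::int. (\<integral>x. sin (of_int n * x) \<partial>M) = 0"
  shows "(\<integral>x. indicator {x. cos x \<ge> c} x * sgn (sin x) \<partial>M) = 0"
proof -
  \<comment> \<open>The numerator tends to the indicator of \<open>y \<ge> c\<close>; the cutoff \<open>1 / (k + 1)\<close> keeps \<open>g k\<close> continuous.\<close>
  define g where "g k y = max 0 (1 - real k * max 0 (c - y)) / max (sqrt \<bar>1 - y\<^sup>2\<bar>) (1 / real (Suc k))" for k y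
  have pos: "max (sqrt \<bar>1 - y\<^sup>2\<bar>) (1 / real (Suc k)) > 0" for k y
    by (rule less_le_trans[of _ "1 / real (Suc k)"]) auto
  have cont: "continuous_on UNIV (g k)" for k
    unfolding g_def using pos by (intro continuous_intros) (auto simp: less_imp_neq[symmetric])
  have sqrt_sin: "sqrt \<bar>1 - (cos x)\<^sup>2\<bar> = \<bar>sin x\<bar>" for x :: real
    by (simp add: sin_squared_eq[symmetric])
  have "(\<lambda>k. \<integral>x. g k (cos x) * sin x \<partial>M) \<longlonglongrightarrow> (\<integral>x. indicator {x. cos x \<ge> c} x * sgn (sin x) \<partial>M)"
  proof (rule integral_dominated_convergence[where w="\<lambda>_. 1"])
    have [measurable_cong]: "sets M = sets borel" by (rule M_is_borel)
    show "(\<lambda>x. indicator {x. cos x \<ge> c} x * sgn (sin x)) \<in> borel_measurable M"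
      unfolding sgn_real_def by measurable
    show "(\<lambda>x. g k (cos x) * sin x) \<in> borel_measurable M" for k
      unfolding g_def by measurable
    show "integrable M (\<lambda>_. 1::real)" by simp
    show "AE x in M. norm (g k (cos x) * sin x) \<le> 1" for k
    proof (rule AE_I2)
      fix x
      have "norm (g k (cos x) * sin x) = max 0 (1 - real k * max 0 (c - cos x)) * (\<bar>sin x\<bar> / max \<bar>sin x\<bar> (1 / real (Suc k)))"
        unfolding g_def sqrt_sin by (simp add: abs_mult)
      also have "\<dots> \<le> 1 * 1"
        using pos[of "cos x" k] unfolding sqrt_sin by (intro mult_mono) (auto simp: divide_simps)
      finally show "norm (g k (cos x) * sin x) \<le> 1" by simp
    qed
    show "AE x in M. (\<lambda>k. g k (cos x) * sin x) \<longlonglongrightarrow> indicator {x. cos x \<ge> c} x * sgn (sin x)"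
    proof (rule AE_I2)
      fix x
      show "(\<lambda>k. g k (cos x) * sin x) \<longlonglongrightarrow> indicator {x. cos x \<ge> c} x * sgn (sin x)"
      proof (cases "sin x = 0")
        case False
        have "eventually (\<lambda>k. 1 / real (Suc k) < \<bar>sin x\<bar>) sequentially"
          using order_tendstoD(2)[OF LIMSEQ_inverse_real_of_nat, of "\<bar>sin x\<bar>"] False
          by (simp add: inverse_eq_divide)
        moreover have "eventually (\<lambda>k. max 0 (1 - real k * max 0 (c - cos x)) = indicator {x. cos x \<ge> c} x) sequentially"
        proof (cases "cos x \<ge> c")
          case True
          then show ?thesis by simp
        next
          case False
          then have "filterlim (\<lambda>k. real k * (c - cos x)) at_top sequentially"
            by (intro filterlim_at_top_mult_tendsto_pos[OF tendsto_const _ filterlim_real_sequentially, of "c - cos x", simplified mult.commute]) auto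
          then have "eventually (\<lambda>k. real k * (c - cos x) \<ge> 1) sequentially"
            by (simp add: filterlim_at_top)
          then show ?thesis by eventually_elim (use False in \<open>auto simp: max_def\<close>)
        qed
        ultimately have "eventually (\<lambda>k. g k (cos x) * sin x = indicator {x. cos x \<ge> c} x * sgn (sin x)) sequentially"
        proof eventually_elim
          case (elim k)
          then show ?case using False
            unfolding g_def sqrt_sin by (simp add: max_def sgn_real_def split: if_splits)
        qed
        then show ?thesis by (rule tendsto_eventually)
      qed simp
    qed
  qed
  moreover have "(\<integral>x. g k (cos x) * sin x \<partial>M) = 0" for k
    by (rule integral_continuous_cos_sin_eq_0[OF odd cont])
  ultimately show ?thesis by (simp add: LIMSEQ_const_iff)
qed

section \<open>Variance growth of a measure on the half circle\<close>

locale half_circle_measure = finite_borel_measure M for M :: "real measure" +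
  assumes AE_half_circle: "AE t in M. 0 \<le> t \<and> t \<le> pi"
begin

lemma integrable_AE_bounded:
  fixes f :: "real \<Rightarrow> real"
  assumes "f \<in> borel_measurable borel" "\<And>t. 0 \<le> t \<Longrightarrow> t \<le> pi \<Longrightarrow> \<bar>f t\<bar> \<le> B"
  shows "integrable M f"
proof (rule integrable_const_bound[of _ B])
  show "AE t in M. norm (f t) \<le> B" using AE_half_circle by eventually_elim (auto intro: assms)
qed (use assms(1) M_is_borel in \<open>simp cong: measurable_cong_sets\<close>)

text \<open>At integers \<open>s = n\<close> this is the variance of the \<open>n\<close>-th partial sum of a sequence with folded spectral
measure \<open>M\<close>.\<close>

definition growth :: "real \<Rightarrow> real" where
  "growth s = (\<integral>t. (dirichlet_ratio s t)\<^sup>2 \<partial>M)"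

lemma integrable_dirichlet_ratio:
  assumes "f \<in> borel_measurable borel" "\<And>t. \<bar>f t\<bar> \<le> B"
  shows "integrable M (\<lambda>t. f t * (dirichlet_ratio s t)\<^sup>2)"
proof (rule integrable_AE_bounded[of _ "B * (3 * \<bar>s\<bar>)\<^sup>2"])
  fix t :: real assume "0 \<le> t" "t \<le> pi"
  then have "\<bar>dirichlet_ratio s t\<bar>\<^sup>2 \<le> (3 * \<bar>s\<bar>)\<^sup>2" by (intro power_mono abs_dirichlet_ratio_le) auto
  then show "\<bar>f t * (dirichlet_ratio s t)\<^sup>2\<bar> \<le> B * (3 * \<bar>s\<bar>)\<^sup>2"
    using order_trans[OF abs_ge_zero assms(2)[of t]] unfolding abs_mult by (intro mult_mono assms(2)) auto
qed (use assms(1) in measurable)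

lemma integrable_dirichlet_ratio': "integrable M (\<lambda>t. (dirichlet_ratio s t)\<^sup>2)"
  using integrable_dirichlet_ratio[of "\<lambda>_. 1" 1 s] by simp

lemma growth_nonneg: "growth s \<ge> 0"
  by (simp add: growth_def)

lemma growth_uminus [simp]: "growth (- s) = growth s"
  by (simp add: growth_def)

lemma growth_abs: "growth \<bar>s\<bar> = growth s"
  by (cases "s \<ge> 0") auto

lemma growth_0 [simp]: "growth 0 = 0"
  by (simp add: growth_def dirichlet_ratio_def)

lemma growth_second_difference:
  "growth (s + u) + growth (s - u) - 2 * growth s = 2 * (\<integral>t. cos (s * t) * (dirichlet_ratio u t)\<^sup>2 \<partial>M)"
proof -
  have "growth (s + u) + growth (s - u) - 2 * growth s
    = (\<integral>t. (dirichlet_ratio (s + u) t)\<^sup>2 + (dirichlet_ratio (s - u) t)\<^sup>2 - 2 * (dirichlet_ratio s t)\<^sup>2 \<partial>M)"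
    unfolding growth_def using integrable_dirichlet_ratio' by simp
  also have "\<dots> = (\<integral>t. 2 * (cos (s * t) * (dirichlet_ratio u t)\<^sup>2) \<partial>M)"
  proof (rule integral_cong_AE)
    show "AE t in M. (dirichlet_ratio (s + u) t)\<^sup>2 + (dirichlet_ratio (s - u) t)\<^sup>2 - 2 * (dirichlet_ratio s t)\<^sup>2
        = 2 * (cos (s * t) * (dirichlet_ratio u t)\<^sup>2)"
      using AE_half_circle by eventually_elim (simp add: dirichlet_ratio_second_difference)
  qed (use M_is_borel in \<open>simp_all cong: measurable_cong_sets\<close>)
  finally show ?thesis by simp
qed

text \<open>With \<open>a\<close> the difference of the two ratios and \<open>b\<close> the ratio at \<open>u\<close>, the squares differ by
\<open>a\<^sup>2 + 2 a b\<close>, where \<open>|a| \<le> 3\<close>; the inequality \<open>6 |b| \<le> e b\<^sup>2 + 9 / e\<close> makes the error a small multiple of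
the growth itself plus a constant.\<close>

lemma growth_diff_le:
  assumes "\<bar>s - u\<bar> \<le> 1" "e > 0"
  shows "\<bar>growth s - growth u\<bar> \<le> e * growth u + (9 + 9 / e) * measure M (space M)"
proof -
  have pointwise: "\<bar>(dirichlet_ratio s t)\<^sup>2 - (dirichlet_ratio u t)\<^sup>2\<bar> \<le> e * (dirichlet_ratio u t)\<^sup>2 + (9 + 9 / e)"
    if "0 \<le> t" "t \<le> pi" for t
  proof -
    define a b where "a = dirichlet_ratio s t - dirichlet_ratio u t" and "b = dirichlet_ratio u t"
    have "\<bar>a\<bar> \<le> 3 * \<bar>s - u\<bar>" unfolding a_def using that by (rule dirichlet_ratio_diff_le)
    also have "\<dots> \<le> 3 * 1" using assms(1) by (intro mult_left_mono) auto
    finally have a: "\<bar>a\<bar> \<le> 3" by simp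
    have "a\<^sup>2 \<le> 3\<^sup>2" using a by (subst abs_le_square_iff[symmetric]) simp
    have "2 * \<bar>a\<bar> * \<bar>b\<bar> \<le> 2 * 3 * \<bar>b\<bar>" using a by (intro mult_right_mono) auto
    also have "\<dots> \<le> e * b\<^sup>2 + 9 / e"
    proof -
      have "0 \<le> (e * \<bar>b\<bar> - 3)\<^sup>2 / e" using assms(2) by simp
      also have "\<dots> = e * b\<^sup>2 - 6 * \<bar>b\<bar> + 9 / e"
        using assms(2) by (simp add: power2_diff field_simps power2_eq_square)
      finally show ?thesis by simp
    qed
    finally have ab: "2 * \<bar>a\<bar> * \<bar>b\<bar> \<le> e * b\<^sup>2 + 9 / e" .
    have "(dirichlet_ratio s t)\<^sup>2 - (dirichlet_ratio u t)\<^sup>2 = a\<^sup>2 + 2 * a * b"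
      by (simp add: a_def b_def power2_eq_square algebra_simps)
    then have "\<bar>(dirichlet_ratio s t)\<^sup>2 - (dirichlet_ratio u t)\<^sup>2\<bar> \<le> a\<^sup>2 + 2 * \<bar>a\<bar> * \<bar>b\<bar>"
      using abs_triangle_ineq[of "a\<^sup>2" "2 * a * b"] by (simp add: abs_mult)
    then show ?thesis using ab \<open>a\<^sup>2 \<le> 3\<^sup>2\<close> by (simp add: b_def)
  qed
  have "growth s - growth u = (\<integral>t. (dirichlet_ratio s t)\<^sup>2 - (dirichlet_ratio u t)\<^sup>2 \<partial>M)"
    unfolding growth_def using integrable_dirichlet_ratio' by simp
  also have "\<bar>\<dots>\<bar> \<le> (\<integral>t. e * (dirichlet_ratio u t)\<^sup>2 + (9 + 9 / e) \<partial>M)"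
  proof (rule order_trans[OF integral_abs_bound integral_mono_AE])
    show "AE t in M. \<bar>(dirichlet_ratio s t)\<^sup>2 - (dirichlet_ratio u t)\<^sup>2\<bar> \<le> e * (dirichlet_ratio u t)\<^sup>2 + (9 + 9 / e)"
      using AE_half_circle by eventually_elim (auto intro: pointwise)
  qed (auto intro!: integrable_dirichlet_ratio')
  also have "\<dots> = e * growth u + (9 + 9 / e) * measure M (space M)"
    using integrable_dirichlet_ratio'[of u] by (simp add: growth_def)
  finally show ?thesis .
qed

text \<open>Rounding \<open>s\<close> down changes the growth by a lower order term, and the weight \<open>s powr \<alpha> * h s\<close> by a factor
that tends to \<open>1\<close> because slow variation is uniform.\<close>

lemma growth_asymp_of_nat:
  assumes h: "slowly_varying h" and \<alpha>: "\<alpha> > 0"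
    and lim: "(\<lambda>n. growth (real n) / (real n powr \<alpha> * h (real n))) \<longlonglongrightarrow> 1"
  shows "((\<lambda>s. growth s / (s powr \<alpha> * h s)) \<longlongrightarrow> 1) at_top"
proof -
  define w where "w s = s powr \<alpha> * h s" for s
  define m where "m s = real (nat \<lfloor>s\<rfloor>)" for s :: real
  have w: "filterlim w at_top at_top"
    unfolding w_def by (rule slowly_varying_times_power_at_top[OF h \<alpha>])
  have nat_floor: "filterlim (\<lambda>s::real. nat \<lfloor>s\<rfloor>) sequentially at_top"
    by (intro filterlim_compose[OF filterlim_nat_sequentially filterlim_floor_sequentially])
  have floor_lim: "((\<lambda>s. growth (m s) / w (m s)) \<longlongrightarrow> 1) at_top"
    using filterlim_compose[OF lim nat_floor] by (simp add: m_def w_def)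
  have "((\<lambda>s. (m s / s) powr \<alpha> * (h (m s) / h s)) \<longlongrightarrow> 1 powr \<alpha> * 1) at_top"
  proof (intro tendsto_mult tendsto_powr)
    show "((\<lambda>s. m s / s) \<longlongrightarrow> 1) at_top"
    proof (rule tendsto_sandwich)
      show "((\<lambda>s::real. 1 - 1 / s) \<longlongrightarrow> 1) at_top" by real_asymp
      show "eventually (\<lambda>s. 1 - 1 / s \<le> m s / s) at_top"
        using eventually_gt_at_top[of 0]
      proof eventually_elim
        case (elim s)
        have "s - 1 \<le> m s" unfolding m_def by linarith
        then have "(s - 1) / s \<le> m s / s" using elim by (intro divide_right_mono) auto
        then show ?case using elim by (simp add: diff_divide_distrib)
      qed
      show "eventually (\<lambda>s. m s / s \<le> 1) at_top"
        using eventually_gt_at_top[of 0]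
      proof eventually_elim
        case (elim s)
        then have "m s \<le> s" unfolding m_def by linarith
        then show ?case using elim by simp
      qed
    qed auto
    show "((\<lambda>s. h (m s) / h s) \<longlongrightarrow> 1) at_top"
      unfolding m_def by (rule slowly_varying_floor[OF h])
  qed auto
  moreover have "eventually (\<lambda>s. (m s / s) powr \<alpha> * (h (m s) / h s) = w (m s) / w s) at_top"
    using eventually_ge_at_top[of 1]
    by eventually_elim (auto simp: w_def m_def powr_divide)
  ultimately have w_ratio: "((\<lambda>s. w (m s) / w s) \<longlongrightarrow> 1) at_top" by (simp add: tendsto_cong)
  have w_pos: "eventually (\<lambda>s. w s > 0) at_top"
    using eventually_gt_at_top[of 0]
    by eventually_elim (auto simp: w_def slowly_varying_pos[OF h])
  have at_floor: "((\<lambda>s. growth (m s) / w s) \<longlongrightarrow> 1) at_top"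
  proof -
    have "((\<lambda>s. growth (m s) / w (m s) * (w (m s) / w s)) \<longlongrightarrow> 1 * 1) at_top"
      by (intro tendsto_mult floor_lim w_ratio)
    moreover have "eventually (\<lambda>s. growth (m s) / w (m s) * (w (m s) / w s) = growth (m s) / w s) at_top"
      using eventually_ge_at_top[of 1]
    proof eventually_elim
      case (elim s)
      then have "m s > 0" by (simp add: m_def)
      then have "w (m s) > 0" by (simp add: w_def slowly_varying_pos[OF h])
      then show ?case by simp
    qed
    ultimately have "((\<lambda>s. growth (m s) / w s) \<longlongrightarrow> 1 * 1) at_top"
      by (rule Lim_transform_eventually)
    then show ?thesis by simp
  qed
  have "((\<lambda>s. growth s / w s - growth (m s) / w s) \<longlongrightarrow> 0) at_top"
  proof (rule tendstoI)
    fix e :: real assume "e > 0"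
    define K where "K = (9 + 9 / (e / 3)) * measure M (space M)"
    have "((\<lambda>s. K / w s) \<longlongrightarrow> 0) at_top"
      by (intro tendsto_divide_0[OF tendsto_const] filterlim_at_top_imp_at_infinity w)
    then have "eventually (\<lambda>s. K / w s < e / 3) at_top"
      using \<open>e > 0\<close> by (intro order_tendstoD(2)[where y=0]) auto
    moreover have "eventually (\<lambda>s. growth (m s) / w s < 2) at_top"
      by (intro order_tendstoD(2)[OF at_floor]) simp
    ultimately show "eventually (\<lambda>s. dist (growth s / w s - growth (m s) / w s) 0 < e) at_top"
      using w_pos eventually_gt_at_top[of 0]
    proof eventually_elim
      case (elim s)
      have "\<bar>s - m s\<bar> \<le> 1" using elim unfolding m_def by linarith
      then have "\<bar>growth s - growth (m s)\<bar> \<le> e / 3 * growth (m s) + K"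
        unfolding K_def using \<open>e > 0\<close> by (intro growth_diff_le) auto
      then have "\<bar>growth s - growth (m s)\<bar> / w s \<le> (e / 3 * growth (m s) + K) / w s"
        using elim by (intro divide_right_mono) auto
      also have "\<dots> = e / 3 * (growth (m s) / w s) + K / w s" by (simp add: add_divide_distrib)
      also have "\<dots> < e / 3 * 2 + e / 3"
        using elim \<open>e > 0\<close> by (intro add_strict_mono mult_strict_left_mono) auto
      finally show ?case using elim by (simp add: dist_real_def diff_divide_distrib[symmetric] abs_div)
    qed
  qed
  from tendsto_add[OF this at_floor] show ?thesis by (simp add: w_def)
qed

end

section \<open>The limit law\<close>

lemma has_bochner_integral_powr_initial:
  fixes a c :: real
  assumes "a > -1" "c \<ge> 0"
  shows "has_bochner_integral lborel (\<lambda>y. y powr a * indicator {0<..c} y) (c powr (a + 1) / (a + 1))"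
proof (rule has_bochner_integral_nn_integral)
  have "(\<integral>\<^sup>+y. ennreal (indicator {0..c} y * y powr a) \<partial>lborel) = ennreal (c powr (a + 1) / (a + 1))"
    by (rule nn_integral_has_integral_lebesgue[OF _ has_integral_powr_from_0]) (use assms in auto)
  moreover have "(\<integral>\<^sup>+y. ennreal (indicator {0..c} y * y powr a) \<partial>lborel) = (\<integral>\<^sup>+y. ennreal (y powr a * indicator {0<..c} y) \<partial>lborel)"
    by (intro nn_integral_cong) (auto simp: indicator_def)
  ultimately show "(\<integral>\<^sup>+y. ennreal (y powr a * indicator {0<..c} y) \<partial>lborel) = ennreal (c powr (a + 1) / (a + 1))"
    by simp
qed (use assms in auto)

definition limit_density :: "real \<Rightarrow> real \<Rightarrow> real" where
  "limit_density \<alpha> y = (1 - cos y) * y powr (- 1 - \<alpha>) * indicator {0<..} y / cos_powr_integral \<alpha>"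

text \<open>The weak limit of the rescaled spectral measure weighted by the kernel.\<close>

definition limit_law :: "real \<Rightarrow> real measure" where
  "limit_law \<alpha> = density lborel (\<lambda>y. ennreal (limit_density \<alpha> y))"

context
  fixes \<alpha> :: real
  assumes \<alpha>: "0 < \<alpha>" "\<alpha> < 2"
begin

lemma limit_density_nonneg: "limit_density \<alpha> y \<ge> 0"
  unfolding limit_density_def using cos_powr_integral_pos[OF \<alpha>]
  by (intro divide_nonneg_pos mult_nonneg_nonneg) auto

lemma limit_density_measurable [measurable]: "limit_density \<alpha> \<in> borel_measurable borel"
  unfolding limit_density_def by measurable

lemma has_bochner_integral_limit_density: "has_bochner_integral lborel (limit_density \<alpha>) 1"
  using has_bochner_integral_divide_zero[OF has_bochner_integral_one_minus_cos_powr[OF \<alpha>, of 1], of "cos_powr_integral \<alpha>"]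
    cos_powr_integral_pos[OF \<alpha>]
  by (simp add: limit_density_def[abs_def])

lemma real_distribution_limit_law: "real_distribution (limit_law \<alpha>)"
proof -
  have "emeasure (limit_law \<alpha>) (space (limit_law \<alpha>)) = (\<integral>\<^sup>+y. ennreal (limit_density \<alpha> y) \<partial>lborel)"
    unfolding limit_law_def by (subst emeasure_density) auto
  also have "\<dots> = ennreal (integral\<^sup>L lborel (limit_density \<alpha>))"
    using has_bochner_integral_limit_density limit_density_nonneg
    by (intro nn_integral_eq_integral) (auto simp: has_bochner_integral_iff)
  also have "\<dots> = 1"
    using has_bochner_integral_limit_density by (simp add: has_bochner_integral_iff)
  finally have "prob_space (limit_law \<alpha>)" by (rule prob_spaceI)
  then show ?thesis
    by (simp add: real_distribution_def real_distribution_axioms_def limit_law_def)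
qed

lemma integral_limit_law:
  fixes f :: "real \<Rightarrow> real"
  assumes "f \<in> borel_measurable borel"
  shows "integral\<^sup>L (limit_law \<alpha>) f = (\<integral>y. limit_density \<alpha> y * f y \<partial>lborel)"
  unfolding limit_law_def using assms limit_density_nonneg
  by (subst integral_density) auto

text \<open>\<open>cos (t y) (1 - cos y)\<close> is half of the second difference of \<open>t \<mapsto> 1 - cos (t y)\<close> with step \<open>1\<close>,
so the Levy-Khinchin representation of \<open>|t| powr \<alpha>\<close> gives the transform.\<close>

lemma integral_cos_limit_law:
  "(\<integral>y. cos (t * y) \<partial>limit_law \<alpha>) = (\<bar>t + 1\<bar> powr \<alpha> + \<bar>t - 1\<bar> powr \<alpha> - 2 * \<bar>t\<bar> powr \<alpha>) / 2"
proof -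
  let ?I = "cos_powr_integral \<alpha>"
  define k where "k s y = (1 - cos (s * y)) * y powr (- 1 - \<alpha>) * indicator {0<..} y" for s y :: real
  have k: "has_bochner_integral lborel (k s) (\<bar>s\<bar> powr \<alpha> * ?I)" for s
    unfolding k_def by (rule has_bochner_integral_one_minus_cos_powr[OF \<alpha>])
  have "has_bochner_integral lborel (\<lambda>y. (k (t + 1) y + k (t - 1) y - 2 * k t y) / (2 * ?I))
     ((\<bar>t + 1\<bar> powr \<alpha> * ?I + \<bar>t - 1\<bar> powr \<alpha> * ?I - 2 * (\<bar>t\<bar> powr \<alpha> * ?I)) / (2 * ?I))"
    by (intro has_bochner_integral_divide_zero has_bochner_integral_diff has_bochner_integral_add
        has_bochner_integral_mult_right k)
  moreover have "(k (t + 1) y + k (t - 1) y - 2 * k t y) / (2 * ?I) = limit_density \<alpha> y * cos (t * y)" for y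
  proof -
    have "cos ((t + 1) * y) + cos ((t - 1) * y) = 2 * (cos (t * y) * cos y)"
      by (simp add: distrib_right left_diff_distrib cos_add cos_diff)
    then have "(1 - cos ((t + 1) * y)) + (1 - cos ((t - 1) * y)) - 2 * (1 - cos (t * y)) = 2 * (cos (t * y) * (1 - cos y))"
      by (simp add: algebra_simps)
    moreover have "k (t + 1) y + k (t - 1) y - 2 * k t y
        = ((1 - cos ((t + 1) * y)) + (1 - cos ((t - 1) * y)) - 2 * (1 - cos (t * y))) * (y powr (- 1 - \<alpha>) * indicator {0<..} y)"
      unfolding k_def by (simp only: distrib_right left_diff_distrib mult.assoc)
    ultimately have "k (t + 1) y + k (t - 1) y - 2 * k t y
        = 2 * (cos (t * y) * (1 - cos y)) * (y powr (- 1 - \<alpha>) * indicator {0<..} y)" by simp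
    then show ?thesis by (simp add: limit_density_def)
  qed
  moreover have "(\<bar>t + 1\<bar> powr \<alpha> * ?I + \<bar>t - 1\<bar> powr \<alpha> * ?I - 2 * (\<bar>t\<bar> powr \<alpha> * ?I)) / (2 * ?I)
     = (\<bar>t + 1\<bar> powr \<alpha> + \<bar>t - 1\<bar> powr \<alpha> - 2 * \<bar>t\<bar> powr \<alpha>) / 2"
  proof -
    have "\<bar>t + 1\<bar> powr \<alpha> * ?I + \<bar>t - 1\<bar> powr \<alpha> * ?I - 2 * (\<bar>t\<bar> powr \<alpha> * ?I)
       = (\<bar>t + 1\<bar> powr \<alpha> + \<bar>t - 1\<bar> powr \<alpha> - 2 * \<bar>t\<bar> powr \<alpha>) * ?I"
      by (simp only: distrib_right left_diff_distrib mult.assoc)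
    then show ?thesis using cos_powr_integral_pos[OF \<alpha>] by simp
  qed
  ultimately show ?thesis by (simp add: integral_limit_law has_bochner_integral_iff)
qed

lemma C_const_eq: "C_const \<alpha> = 1 / (2 * (2 - \<alpha>) * cos_powr_integral \<alpha>)"
proof -
  define e where "e = 2 - \<alpha>"
  have "e \<noteq> 0" using \<alpha> by (simp add: e_def)
  then show ?thesis
    unfolding C_const_def cos_powr_integral_def e_def[symmetric] by (simp add: mult_ac)
qed

text \<open>The same density seen from the power law: the spectral mass near \<open>0\<close> behaves like
\<open>C(\<alpha>) y powr (2 - \<alpha>)\<close>, and the kernel at unit scale is \<open>(sin (y/2) / (y/2))\<^sup>2\<close>.\<close>

lemma limit_density_eq:
  "limit_density \<alpha> y = C_const \<alpha> * (2 - \<alpha>) * (sin_over (y / 2))\<^sup>2 * y powr (1 - \<alpha>) * indicator {0<..} y"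
proof (cases "y > 0")
  case True
  have "1 - cos y = 2 * (sin (y / 2))\<^sup>2" using cos_double_sin[of "y / 2"] by simp
  also have "\<dots> = y\<^sup>2 / 2 * (sin_over (y / 2))\<^sup>2"
    unfolding sin_half_eq_sin_over[of y] by (simp add: power_mult_distrib power_divide)
  finally have c: "1 - cos y = y\<^sup>2 / 2 * (sin_over (y / 2))\<^sup>2" .
  have "y powr (1 - \<alpha>) = y powr (2 + (- 1 - \<alpha>))" by simp
  also have "\<dots> = y\<^sup>2 * y powr (- 1 - \<alpha>)" using True by (simp only: powr_add) (simp add: powr_numeral)
  finally have p: "y powr (1 - \<alpha>) = y\<^sup>2 * y powr (- 1 - \<alpha>)" .
  define e where "e = 2 - \<alpha>"
  have "e \<noteq> 0" using \<alpha> by (simp add: e_def)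
  then show ?thesis
    unfolding limit_density_def c p C_const_eq e_def[symmetric] using True by simp
qed (simp add: limit_density_def)

lemma integral_limit_law_truncated:
  "(\<integral>y. indicator {-1..1} y / (sin_over (y / 2))\<^sup>2 \<partial>limit_law \<alpha>) = C_const \<alpha>"
proof -
  have "(\<integral>y. indicator {-1..1} y / (sin_over (y / 2))\<^sup>2 \<partial>limit_law \<alpha>)
     = (\<integral>y. C_const \<alpha> * (2 - \<alpha>) * (y powr (1 - \<alpha>) * indicator {0<..1} y) \<partial>lborel)"
  proof (subst integral_limit_law, measurable, intro Bochner_Integration.integral_cong refl)
    fix y :: real
    show "limit_density \<alpha> y * (indicator {-1..1} y / (sin_over (y / 2))\<^sup>2)
      = C_const \<alpha> * (2 - \<alpha>) * (y powr (1 - \<alpha>) * indicator {0<..1} y)"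
    proof (cases "0 < y \<and> y \<le> 1")
      case True
      then have "sin_over (y / 2) > 0" using sin_over_half_ge[of y] pi_gt3 by linarith
      then show ?thesis using True by (simp add: limit_density_eq)
    next
      case False
      then show ?thesis by (auto simp: limit_density_eq indicator_def)
    qed
  qed
  also have "\<dots> = C_const \<alpha> * (2 - \<alpha>) * (1 powr (1 - \<alpha> + 1) / (1 - \<alpha> + 1))"
    using has_bochner_integral_powr_initial[of "1 - \<alpha>" 1] \<alpha> by (simp add: has_bochner_integral_iff)
  also have "\<dots> = C_const \<alpha>" using \<alpha> by simp
  finally show ?thesis .
qed

end

section \<open>A continuity theorem for cosine transforms\<close>

text \<open>The law of a variable with law \<open>P\<close> multiplied by an independent fair sign.\<close>

definition symmetrize :: "real measure \<Rightarrow> real measure" where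
  "symmetrize P = distr (P \<Otimes>\<^sub>M measure_pmf (bernoulli_pmf (1/2))) borel (\<lambda>(x, b). if b then x else - x)"

lemma symmetrize_measurable:
  fixes P :: "real measure"
  assumes "sets P = sets borel"
  shows "(\<lambda>(x, b). if b then x else - x) \<in> borel_measurable (P \<Otimes>\<^sub>M measure_pmf (bernoulli_pmf (1/2)))"
proof -
  let ?B = "measure_pmf (bernoulli_pmf (1/2))"
  have "fst \<in> borel_measurable (P \<Otimes>\<^sub>M ?B)"
    using measurable_fst[of P ?B] assms by (simp cong: measurable_cong_sets)
  moreover have "Measurable.pred (P \<Otimes>\<^sub>M ?B) snd"
    using measurable_snd[of P ?B] by (simp cong: measurable_cong_sets)
  ultimately show ?thesis
    unfolding case_prod_beta using borel_measurable_uminus[of fst "P \<Otimes>\<^sub>M ?B"]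
    by (intro measurable_If) simp_all
qed

lemma real_distribution_symmetrize:
  assumes "real_distribution P"
  shows "real_distribution (symmetrize P)"
proof -
  interpret R: real_distribution P by fact
  interpret pair_prob_space P "measure_pmf (bernoulli_pmf (1/2))" ..
  show ?thesis unfolding symmetrize_def
    by (intro real_distribution_distr symmetrize_measurable) simp
qed

lemma integral_symmetrize:
  fixes f :: "real \<Rightarrow> 'b::{banach, second_countable_topology}"
  assumes P: "real_distribution P" and f: "f \<in> borel_measurable borel" and bdd: "\<And>x. norm (f x) \<le> B"
  shows "integral\<^sup>L (symmetrize P) f = (1/2) *\<^sub>R ((\<integral>x. f x \<partial>P) + (\<integral>x. f (- x) \<partial>P))"
proof -
  interpret R: real_distribution P by fact
  let ?B = "measure_pmf (bernoulli_pmf (1/2))"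
  interpret PB: pair_prob_space P ?B ..
  note [measurable] = f
  have m: "(\<lambda>(x, b). f (if b then x else - x)) \<in> borel_measurable (P \<Otimes>\<^sub>M ?B)"
    using measurable_compose[OF symmetrize_measurable f] by (simp add: case_prod_beta)
  have int: "integrable (P \<Otimes>\<^sub>M ?B) (\<lambda>(x, b). f (if b then x else - x))"
    using bdd by (intro PB.P.integrable_const_bound[of _ B] m) auto
  have intP: "integrable P f" "integrable P (\<lambda>x. f (- x))"
    using bdd by (auto intro!: R.integrable_const_bound[of _ B])
  have "integral\<^sup>L (symmetrize P) f = (\<integral>z. (case z of (x, b) \<Rightarrow> f (if b then x else - x)) \<partial>(P \<Otimes>\<^sub>M ?B))"
    unfolding symmetrize_def
    by (subst integral_distr[OF symmetrize_measurable]) (auto intro!: Bochner_Integration.integral_cong)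
  also have "\<dots> = (\<integral>x. (\<integral>b. f (if b then x else - x) \<partial>?B) \<partial>P)"
    using PB.integral_fst'[OF int] by simp
  also have "\<dots> = (\<integral>x. (1/2) *\<^sub>R f x + (1/2) *\<^sub>R f (- x) \<partial>P)"
    by (intro Bochner_Integration.integral_cong refl, subst integral_measure_pmf[of UNIV])
       (auto simp: UNIV_bool)
  also have "\<dots> = (1/2) *\<^sub>R ((\<integral>x. f x \<partial>P) + (\<integral>x. f (- x) \<partial>P))"
    using intP by (simp add: scaleR_add_right)
  finally show ?thesis .
qed

text \<open>The reason for symmetrizing: the cosine transform alone becomes the characteristic function.\<close>

lemma char_symmetrize:
  assumes P: "real_distribution P"
  shows "char (symmetrize P) t = complex_of_real (\<integral>x. cos (t * x) \<partial>P)"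
proof -
  interpret R: real_distribution P by fact
  have "char (symmetrize P) t = (1/2) *\<^sub>R ((\<integral>x. iexp (t * x) \<partial>P) + (\<integral>x. iexp (t * (- x)) \<partial>P))"
    unfolding char_def by (rule integral_symmetrize[OF P, of _ 1]) auto
  also have "(\<integral>x. iexp (t * x) \<partial>P) + (\<integral>x. iexp (t * (- x)) \<partial>P) = (\<integral>x. iexp (t * x) + iexp (t * (- x)) \<partial>P)"
    by (intro Bochner_Integration.integral_add[symmetric] R.integrable_const_bound[of _ 1]) auto
  also have "\<dots> = (\<integral>x. complex_of_real (2 * cos (t * x)) \<partial>P)"
    by (intro Bochner_Integration.integral_cong refl) (simp add: complex_eq_iff Re_exp Im_exp)
  also have "\<dots> = complex_of_real (\<integral>x. 2 * cos (t * x) \<partial>P)" by (rule integral_complex_of_real)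
  also have "(\<integral>x. 2 * cos (t * x) \<partial>P) = 2 * (\<integral>x. cos (t * x) \<partial>P)" by simp
  finally show ?thesis by (simp add: scaleR_conv_of_real)
qed

text \<open>Levy's continuity theorem for the symmetrized laws. Even test functions do not see the
symmetrization, and for the indicators needed later the set of discontinuities is symmetric.\<close>

lemma cosine_continuity_theorem:
  fixes f :: "real \<Rightarrow> real"
  assumes P: "\<And>n. real_distribution (P n)" and P': "real_distribution P'"
    and cos_conv: "\<And>t. (\<lambda>n. \<integral>x. cos (t * x) \<partial>P n) \<longlonglongrightarrow> (\<integral>x. cos (t * x) \<partial>P')"
    and f: "f \<in> borel_measurable borel" "\<And>x. \<bar>f x\<bar> \<le> B" and even: "\<And>x. f (- x) = f x"
    and N: "{x. \<not> isCont f x} \<subseteq> N" "N \<in> sets borel" "uminus ` N = N" "emeasure P' N = 0"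
  shows "(\<lambda>n. integral\<^sup>L (P n) f) \<longlonglongrightarrow> integral\<^sup>L P' f"
proof -
  interpret P': real_distribution P' by fact
  have S: "\<And>n. real_distribution (symmetrize (P n))" and S': "real_distribution (symmetrize P')"
    using P P' by (auto intro: real_distribution_symmetrize)
  interpret S': real_distribution "symmetrize P'" by fact
  have weak: "weak_conv_m (\<lambda>n. symmetrize (P n)) (symmetrize P')"
    using S S' by (rule levy_continuity) (auto simp: char_symmetrize P P' intro!: tendsto_of_real cos_conv)
  have "measure (symmetrize P') N = (\<integral>x. indicator N x \<partial>symmetrize P')"
    by (simp add: N)
  also have "\<dots> = (1/2) *\<^sub>R ((\<integral>x. indicator N x \<partial>P') + (\<integral>x. indicator N (- x) \<partial>P'))"
    using N by (intro integral_symmetrize[OF P', of _ 1]) (auto simp: indicator_def)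
  also have "(\<lambda>x. indicator N (- x) :: real) = indicator N"
    using N(3) by (auto simp: indicator_def fun_eq_iff) (metis imageI minus_minus)+
  finally have "measure (symmetrize P') N = 0"
    using N by (simp add: measure_def)
  then have null: "emeasure (symmetrize P') N = 0" by (simp add: S'.emeasure_eq_measure)
  then have "emeasure (symmetrize P') {x. \<not> isCont f x} = 0"
    using N by (intro emeasure_eq_0[OF _ null]) auto
  from weak_conv_imp_bdd_ae_continuous_conv[OF S S' weak this, of B] f
  have "(\<lambda>n. integral\<^sup>L (symmetrize (P n)) f) \<longlonglongrightarrow> integral\<^sup>L (symmetrize P') f"
    by simp
  moreover have "integral\<^sup>L (symmetrize R) f = integral\<^sup>L R f" if "real_distribution R" for R
    using f by (subst integral_symmetrize[OF that, of _ B]) (auto simp: even)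
  ultimately show ?thesis using P P' by simp
qed

section \<open>From variance growth to spectral mass\<close>

context half_circle_measure begin

text \<open>The kernel at time \<open>s\<close>, normalized to a probability measure and observed at frequency scale \<open>1/s\<close>.\<close>

definition growth_law :: "real \<Rightarrow> real measure" where
  "growth_law s = distr (density M (\<lambda>t. ennreal ((dirichlet_ratio s t)\<^sup>2 / growth s))) borel (\<lambda>t. s * t)"

lemma measurable_M_eq: "measurable M N = measurable borel N"
  by (rule measurable_cong_sets) (simp_all add: M_is_borel)

lemma real_distribution_growth_law:
  assumes "growth s > 0"
  shows "real_distribution (growth_law s)"
proof -
  let ?D = "density M (\<lambda>t. ennreal ((dirichlet_ratio s t)\<^sup>2 / growth s))"
  have "emeasure ?D (space ?D) = (\<integral>\<^sup>+t. ennreal ((dirichlet_ratio s t)\<^sup>2 / growth s) \<partial>M)"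
    by (subst emeasure_density) (auto simp: measurable_M_eq intro!: nn_integral_cong)
  also have "\<dots> = ennreal (\<integral>t. (dirichlet_ratio s t)\<^sup>2 / growth s \<partial>M)"
    using assms integrable_dirichlet_ratio' by (intro nn_integral_eq_integral) auto
  also have "\<dots> = 1" using assms by (simp add: growth_def)
  finally have "prob_space ?D" by (rule prob_spaceI)
  then show ?thesis unfolding growth_law_def
    by (intro prob_space.real_distribution_distr) (simp_all add: measurable_M_eq)
qed

lemma integral_growth_law:
  fixes f :: "real \<Rightarrow> real"
  assumes "growth s > 0" and [measurable]: "f \<in> borel_measurable borel"
  shows "integral\<^sup>L (growth_law s) f = (\<integral>t. f (s * t) * (dirichlet_ratio s t)\<^sup>2 \<partial>M) / growth s"
proof -
  have "integral\<^sup>L (growth_law s) f = (\<integral>t. f (s * t) \<partial>density M (\<lambda>t. ennreal ((dirichlet_ratio s t)\<^sup>2 / growth s)))"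
    unfolding growth_law_def by (subst integral_distr) (auto simp: measurable_M_eq)
  also have "\<dots> = (\<integral>t. (dirichlet_ratio s t)\<^sup>2 / growth s * f (s * t) \<partial>M)"
    using assms(1) by (subst integral_density) (auto simp: measurable_M_eq)
  also have "\<dots> = (\<integral>t. f (s * t) * (dirichlet_ratio s t)\<^sup>2 / growth s \<partial>M)"
    by (intro Bochner_Integration.integral_cong) auto
  finally show ?thesis by simp
qed

definition mass :: "real \<Rightarrow> real" where
  "mass x = measure M {0..x}"

lemma integral_indicator_mass: "(\<integral>t. indicator {0..x} t \<partial>M) = mass x"
  by (simp add: mass_def M_is_borel borel_UNIV)

lemma mass_nonneg: "mass x \<ge> 0"
  by (simp add: mass_def)

lemma mass_mono: "x \<le> y \<Longrightarrow> mass x \<le> mass y"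
  unfolding mass_def by (intro finite_measure_mono) (auto simp: M_is_borel)

lemma integrable_indicator_mass [simp]: "integrable M (\<lambda>t. indicator {0..x} t :: real)"
  by (rule integrable_AE_bounded[of _ 1]) (auto simp: indicator_def)

text \<open>The test function undoes the kernel: on \<open>t \<le> 1/s\<close> the squared Dirichlet ratio divided by
\<open>sin_over (s t / 2)\<close> squared is \<open>s\<^sup>2\<close> up to the factor \<open>sin_over (t / 2)\<close> squared, which lies between
\<open>(1 - 1 / (24 s\<^sup>2))\<^sup>2\<close> and \<open>1\<close>.\<close>

lemma growth_law_truncated_bounds:
  assumes s: "s \<ge> 1" and pos: "growth s > 0"
  defines "J \<equiv> (\<integral>y. indicator {-1..1} y / (sin_over (y / 2))\<^sup>2 \<partial>growth_law s)"
  shows "s\<^sup>2 * mass (1 / s) / growth s \<le> J"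
    and "(1 - 1 / (24 * s\<^sup>2))\<^sup>2 * J \<le> s\<^sup>2 * mass (1 / s) / growth s"
proof -
  define b where "b = 1 - 1 / (24 * s\<^sup>2)"
  have b: "b > 0"
  proof -
    have "24 * 1 \<le> 24 * s\<^sup>2" using s by (intro mult_left_mono) auto
    then have "1 / (24 * s\<^sup>2) \<le> 1 / 24" by (intro divide_left_mono) auto
    then show ?thesis unfolding b_def by simp
  qed
  define f where "f t = indicator {0..1 / s} t * (s\<^sup>2 / (sin_over (t / 2))\<^sup>2)" for t
  have J: "J = (\<integral>t. f t \<partial>M) / growth s"
  proof -
    have "J = (\<integral>t. indicator {-1..1} (s * t) / (sin_over (s * t / 2))\<^sup>2 * (dirichlet_ratio s t)\<^sup>2 \<partial>M) / growth s"
      unfolding J_def by (rule integral_growth_law[OF pos]) measurable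
    also have "(\<integral>t. indicator {-1..1} (s * t) / (sin_over (s * t / 2))\<^sup>2 * (dirichlet_ratio s t)\<^sup>2 \<partial>M) = (\<integral>t. f t \<partial>M)"
    proof (rule integral_cong_AE)
      show "AE t in M. indicator {-1..1} (s * t) / (sin_over (s * t / 2))\<^sup>2 * (dirichlet_ratio s t)\<^sup>2 = f t"
        using AE_half_circle
      proof eventually_elim
        case (elim t)
        show ?case
        proof (cases "s * t \<le> 1")
          case True
          then have "t \<le> 1 / s" using s by (simp add: field_simps)
          have "0 \<le> s * t" using s elim by simp
          then have "sin_over (s * t / 2) > 0" using sin_over_half_ge[of "s * t"] True pi_gt3 by linarith
          then show ?thesis using True elim \<open>t \<le> 1 / s\<close> \<open>0 \<le> s * t\<close>
            by (simp add: f_def dirichlet_ratio_def power_divide power_mult_distrib)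
        next
          case False
          then have "\<not> t \<le> 1 / s" using s by (simp add: field_simps)
          then show ?thesis using False by (simp add: f_def)
        qed
      qed
    qed (unfold measurable_M_eq f_def, measurable)
    finally show ?thesis .
  qed
  have f_bounds: "indicator {0..1 / s} t * s\<^sup>2 \<le> f t" "f t \<le> indicator {0..1 / s} t * s\<^sup>2 / b\<^sup>2" for t
  proof -
    have "indicator {0..1 / s} t * s\<^sup>2 \<le> f t \<and> f t \<le> indicator {0..1 / s} t * s\<^sup>2 / b\<^sup>2"
    proof (cases "t \<in> {0..1 / s}")
      case True
      have "t\<^sup>2 \<le> (1 / s)\<^sup>2" using True by (intro power_mono) auto
      then have "b \<le> 1 - (t / 2)\<^sup>2 / 6" by (simp add: b_def power_divide)
      then have le: "b \<le> sin_over (t / 2)" using sin_over_lower_bound[of "t / 2"] by linarith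
      have sq: "b\<^sup>2 \<le> (sin_over (t / 2))\<^sup>2" "(sin_over (t / 2))\<^sup>2 \<le> 1\<^sup>2"
        using abs_sin_over_le_1[of "t / 2"] le b by (auto intro!: power_mono simp: abs_square_le_1)
      have pos: "0 < (sin_over (t / 2))\<^sup>2 * 1\<^sup>2" "0 < b\<^sup>2 * (sin_over (t / 2))\<^sup>2" using b le by simp_all
      have "s\<^sup>2 / 1\<^sup>2 \<le> s\<^sup>2 / (sin_over (t / 2))\<^sup>2"
        using sq(2) pos(1) by (intro divide_left_mono) (auto simp: mult.commute)
      moreover have "s\<^sup>2 / (sin_over (t / 2))\<^sup>2 \<le> s\<^sup>2 / b\<^sup>2"
        using sq(1) pos(2) by (intro divide_left_mono) (auto simp: mult.commute)
      ultimately show ?thesis using True by (simp add: f_def)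
    qed (simp add: f_def)
    then show "indicator {0..1 / s} t * s\<^sup>2 \<le> f t" "f t \<le> indicator {0..1 / s} t * s\<^sup>2 / b\<^sup>2" by auto
  qed
  have f_nonneg: "f t \<ge> 0" for t by (simp add: f_def)
  have f_int: "integrable M f"
  proof (rule integrable_AE_bounded[of _ "s\<^sup>2 / b\<^sup>2"])
    show "f \<in> borel_measurable borel" unfolding f_def by measurable
    fix t
    show "\<bar>f t\<bar> \<le> s\<^sup>2 / b\<^sup>2"
      using f_nonneg[of t] order_trans[OF f_bounds(2)[of t], of "s\<^sup>2 / b\<^sup>2"] by (simp add: indicator_def split: if_splits)
  qed
  have "mass (1 / s) * s\<^sup>2 = (\<integral>t. indicator {0..1 / s} t * s\<^sup>2 \<partial>M)"
    by (simp only: integral_mult_left_zero integral_indicator_mass)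
  also have "\<dots> \<le> (\<integral>t. f t \<partial>M)"
    using f_int f_bounds(1) by (intro integral_mono) auto
  finally show "s\<^sup>2 * mass (1 / s) / growth s \<le> J"
    unfolding J using pos by (intro divide_right_mono) (auto simp: mult.commute)
  have "(\<integral>t. f t \<partial>M) \<le> (\<integral>t. indicator {0..1 / s} t * s\<^sup>2 / b\<^sup>2 \<partial>M)"
    using f_int f_bounds(2) by (intro integral_mono) auto
  also have "\<dots> = mass (1 / s) * s\<^sup>2 / b\<^sup>2"
    by (simp only: integral_divide_zero integral_mult_left_zero integral_indicator_mass)
  finally have "b\<^sup>2 * (\<integral>t. f t \<partial>M) \<le> s\<^sup>2 * mass (1 / s)"
    using b by (simp add: field_simps)
  then have "b\<^sup>2 * (\<integral>t. f t \<partial>M) / growth s \<le> s\<^sup>2 * mass (1 / s) / growth s"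
    using pos by (intro divide_right_mono) auto
  then show "(1 - 1 / (24 * s\<^sup>2))\<^sup>2 * J \<le> s\<^sup>2 * mass (1 / s) / growth s"
    unfolding J b_def by simp
qed

end

context half_circle_measure begin

lemma growth_scaling:
  assumes h: "slowly_varying h"
    and lim: "((\<lambda>s. growth s / (s powr \<alpha> * h s)) \<longlongrightarrow> 1) at_top"
  shows "((\<lambda>s. growth (s * t) / growth s) \<longlongrightarrow> \<bar>t\<bar> powr \<alpha>) at_top"
proof (cases "t = 0")
  case False
  define w where "w s = s powr \<alpha> * h s" for s
  have w_pos: "w s > 0" if "s > 0" for s
    using that slowly_varying_pos[OF h] by (simp add: w_def)
  have scale: "filterlim (\<lambda>s. \<bar>t\<bar> * s) at_top at_top"
    using False by (intro filterlim_tendsto_pos_mult_at_top[OF tendsto_const] filterlim_ident) auto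
  have lim': "((\<lambda>s. growth s / w s) \<longlongrightarrow> 1) at_top" using lim by (simp add: w_def)
  have 1: "((\<lambda>s. growth (\<bar>t\<bar> * s) / w (\<bar>t\<bar> * s)) \<longlongrightarrow> 1) at_top"
    by (rule filterlim_compose[OF lim' scale])
  have "((\<lambda>s. \<bar>t\<bar> powr \<alpha> * (h (\<bar>t\<bar> * s) / h s)) \<longlongrightarrow> \<bar>t\<bar> powr \<alpha> * 1) at_top"
    using h False by (intro tendsto_mult tendsto_const) (auto simp: slowly_varying_def)
  moreover have "eventually (\<lambda>s. \<bar>t\<bar> powr \<alpha> * (h (\<bar>t\<bar> * s) / h s) = w (\<bar>t\<bar> * s) / w s) at_top"
    using eventually_gt_at_top[of 0] by eventually_elim (simp add: w_def powr_mult)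
  ultimately have 2: "((\<lambda>s. w (\<bar>t\<bar> * s) / w s) \<longlongrightarrow> \<bar>t\<bar> powr \<alpha> * 1) at_top"
    by (rule Lim_transform_eventually)
  have 3: "((\<lambda>s. inverse (growth s / w s)) \<longlongrightarrow> inverse 1) at_top"
    by (intro tendsto_inverse lim') simp
  have "((\<lambda>s. growth (\<bar>t\<bar> * s) / w (\<bar>t\<bar> * s) * (w (\<bar>t\<bar> * s) / w s) * inverse (growth s / w s)) \<longlongrightarrow> 1 * (\<bar>t\<bar> powr \<alpha> * 1) * inverse 1) at_top"
    by (intro tendsto_mult 1 2 3)
  moreover have "eventually (\<lambda>s. growth (\<bar>t\<bar> * s) / w (\<bar>t\<bar> * s) * (w (\<bar>t\<bar> * s) / w s) * inverse (growth s / w s) = growth (s * t) / growth s) at_top"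
    using eventually_gt_at_top[of 0]
  proof eventually_elim
    case (elim s)
    have "growth (\<bar>t\<bar> * s) = growth (s * t)"
      using growth_abs[of "s * t"] elim by (simp add: abs_mult mult.commute)
    moreover have "w s > 0" "w (\<bar>t\<bar> * s) > 0" using elim False by (auto intro: w_pos)
    ultimately show ?case by (simp add: field_simps)
  qed
  ultimately have "((\<lambda>s. growth (s * t) / growth s) \<longlongrightarrow> 1 * (\<bar>t\<bar> powr \<alpha> * 1) * inverse 1) at_top"
    by (rule Lim_transform_eventually)
  then show ?thesis by simp
qed simp

text \<open>The Tauberian half. The second differences of the growth function are the cosine transforms of the
growth laws, so they converge to the limit law.\<close>

lemma spectral_mass_of_growth:
  assumes h: "slowly_varying h" and \<alpha>: "0 < \<alpha>" "\<alpha> < 2"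
    and lim: "((\<lambda>s. growth s / (s powr \<alpha> * h s)) \<longlongrightarrow> 1) at_top"
  shows "((\<lambda>s. s\<^sup>2 * mass (1 / s) / growth s) \<longlongrightarrow> C_const \<alpha>) at_top"
proof (rule tendsto_at_topI_sequentially)
  fix X :: "nat \<Rightarrow> real"
  assume X: "filterlim X at_top sequentially"
  have "eventually (\<lambda>s. growth s / (s powr \<alpha> * h s) > 0) at_top"
    by (rule order_tendstoD(1)[OF lim]) simp
  then have "eventually (\<lambda>s. growth s > 0 \<and> s \<ge> 1) at_top"
    using eventually_ge_at_top[of 1]
  proof eventually_elim
    case (elim s)
    then have "growth s \<noteq> 0" by auto
    then show ?case using growth_nonneg[of s] elim by simp
  qed
  then have "eventually (\<lambda>n. growth (X n) > 0 \<and> X n \<ge> 1) sequentially"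
    using X by (rule eventually_compose_filterlim)
  then obtain N where N: "\<And>n. n \<ge> N \<Longrightarrow> growth (X n) > 0 \<and> X n \<ge> 1"
    by (auto simp: eventually_sequentially)
  define Y where "Y n = X (n + N)" for n
  have Y_pos: "growth (Y n) > 0" and Y_ge: "Y n \<ge> 1" for n using N[of "n + N"] by (auto simp: Y_def)
  have Y: "filterlim Y at_top sequentially"
    unfolding Y_def using X by (rule filterlim_compose) (rule filterlim_add_const_nat_at_top)
  define f where "f y = indicator {-1..1} y / (sin_over (y / 2))\<^sup>2" for y :: real
  have conv: "(\<lambda>n. \<integral>y. cos (t * y) \<partial>growth_law (Y n)) \<longlonglongrightarrow> (\<integral>y. cos (t * y) \<partial>limit_law \<alpha>)" for t
  proof -
    have scal: "(\<lambda>n. growth (Y n * u) / growth (Y n)) \<longlonglongrightarrow> \<bar>u\<bar> powr \<alpha>" for u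
      by (rule filterlim_compose[OF growth_scaling[OF h lim] Y])
    have "(\<lambda>n. (growth (Y n * (t + 1)) / growth (Y n) + growth (Y n * (t - 1)) / growth (Y n) - 2 * (growth (Y n * t) / growth (Y n))) / 2)
       \<longlonglongrightarrow> (\<bar>t + 1\<bar> powr \<alpha> + \<bar>t - 1\<bar> powr \<alpha> - 2 * \<bar>t\<bar> powr \<alpha>) / 2"
      by (intro tendsto_divide tendsto_diff tendsto_add tendsto_mult tendsto_const scal) simp
    moreover have "(\<integral>y. cos (t * y) \<partial>growth_law (Y n))
       = (growth (Y n * (t + 1)) / growth (Y n) + growth (Y n * (t - 1)) / growth (Y n) - 2 * (growth (Y n * t) / growth (Y n))) / 2" for n
    proof -
      have "(\<integral>y. cos (t * y) \<partial>growth_law (Y n)) = (\<integral>x. cos (Y n * t * x) * (dirichlet_ratio (Y n) x)\<^sup>2 \<partial>M) / growth (Y n)"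
        by (subst integral_growth_law[OF Y_pos]) (simp_all add: mult_ac)
      also have "\<dots> = (growth (Y n * t + Y n) + growth (Y n * t - Y n) - 2 * growth (Y n * t)) / 2 / growth (Y n)"
        by (simp add: growth_second_difference)
      also have "\<dots> = (growth (Y n * (t + 1)) + growth (Y n * (t - 1)) - 2 * growth (Y n * t)) / 2 / growth (Y n)"
        by (simp add: algebra_simps)
      finally show ?thesis by (simp add: add_divide_distrib diff_divide_distrib)
    qed
    ultimately show ?thesis unfolding integral_cos_limit_law[OF \<alpha>] by (simp only:)
  qed
  have null: "emeasure (limit_law \<alpha>) {-1, 1} = 0"
  proof -
    have "{-1, 1::real} \<in> null_sets lborel" by (intro finite_imp_null_set_lborel) simp
    then show ?thesis
      unfolding limit_law_def using limit_density_measurable[OF \<alpha>]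
      by (subst emeasure_density) (auto simp: nn_integral_null_set)
  qed
  have discont: "{y. \<not> isCont f y} \<subseteq> {-1, 1}"
  proof -
    have "isCont f y" if "y \<noteq> 1" "y \<noteq> -1" for y
    proof (cases "\<bar>y\<bar> < 1")
      case True
      have near: "eventually (\<lambda>z. z \<in> {-1<..<1}) (nhds y)"
        using True by (intro eventually_nhds_in_open) auto
      have "sin_over (y / 2) > 0"
        using True sin_over_lower_bound[of "y / 2"] abs_square_le_1[of y] by (simp add: power_divide)
      then have "isCont (\<lambda>z. 1 / (sin_over (z / 2))\<^sup>2) y"
        by (intro continuous_intros isCont_o2[OF _ isCont_sin_over]) auto
      moreover have "eventually (\<lambda>z. f z = 1 / (sin_over (z / 2))\<^sup>2) (nhds y)"
        using near by eventually_elim (auto simp: f_def)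
      ultimately show ?thesis by (simp add: isCont_cong)
    next
      case False
      have "eventually (\<lambda>z. z \<in> - {-1..1}) (nhds y)"
        using that False by (intro eventually_nhds_in_open) (auto simp: abs_if split: if_splits)
      then have "eventually (\<lambda>z. f z = 0) (nhds y)" by eventually_elim (auto simp: f_def)
      then show ?thesis by (simp add: isCont_cong)
    qed
    then show ?thesis by auto
  qed
  have f_bdd: "\<bar>f y\<bar> \<le> 9" for y
  proof (cases "\<bar>y\<bar> \<le> 1")
    case True
    then have "y\<^sup>2 \<le> 1" by (simp add: abs_square_le_1)
    then have "1 / 3 \<le> sin_over (y / 2)"
      using sin_over_lower_bound[of "y / 2"] by (simp add: power_divide)
    then have "(1 / 3)\<^sup>2 \<le> (sin_over (y / 2))\<^sup>2" by (intro power_mono) auto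
    then have "1 / (sin_over (y / 2))\<^sup>2 \<le> 1 / (1 / 3)\<^sup>2" by (intro divide_left_mono) (auto simp: power2_eq_square)
    then show ?thesis by (auto simp: f_def indicator_def power2_eq_square)
  qed (auto simp: f_def indicator_def)
  have f_even: "f (- y) = f y" for y
  proof -
    have "sin_over (- y / 2) = sin_over (y / 2)" by (simp add: sin_over_def)
    moreover have "indicator {-1..1} (- y) = (indicator {-1..1} y :: real)" by (auto simp: indicator_def)
    ultimately show ?thesis by (simp only: f_def)
  qed
  have f_meas: "f \<in> borel_measurable borel" unfolding f_def by measurable
  have "(\<lambda>n. integral\<^sup>L (growth_law (Y n)) f) \<longlonglongrightarrow> integral\<^sup>L (limit_law \<alpha>) f"
    by (rule cosine_continuity_theorem[OF real_distribution_growth_law[OF Y_pos] real_distribution_limit_law[OF \<alpha>]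
          conv f_meas f_bdd f_even discont _ _ null]) auto
  then have J: "(\<lambda>n. integral\<^sup>L (growth_law (Y n)) f) \<longlonglongrightarrow> C_const \<alpha>"
    using integral_limit_law_truncated[OF \<alpha>] by (simp only: f_def[abs_def])
  have "((\<lambda>s::real. (1 - 1 / (24 * s\<^sup>2))\<^sup>2) \<longlongrightarrow> 1) at_top" by real_asymp
  then have "(\<lambda>n. (1 - 1 / (24 * (Y n)\<^sup>2))\<^sup>2) \<longlonglongrightarrow> 1" using Y by (rule filterlim_compose)
  then have lower: "(\<lambda>n. (1 - 1 / (24 * (Y n)\<^sup>2))\<^sup>2 * integral\<^sup>L (growth_law (Y n)) f) \<longlonglongrightarrow> 1 * C_const \<alpha>"
    using J by (rule tendsto_mult)
  have bounds: "(Y n)\<^sup>2 * mass (1 / Y n) / growth (Y n) \<le> integral\<^sup>L (growth_law (Y n)) f"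
    "(1 - 1 / (24 * (Y n)\<^sup>2))\<^sup>2 * integral\<^sup>L (growth_law (Y n)) f \<le> (Y n)\<^sup>2 * mass (1 / Y n) / growth (Y n)" for n
    using growth_law_truncated_bounds[OF Y_ge Y_pos] by (simp_all only: f_def[abs_def])
  have "(\<lambda>n. (Y n)\<^sup>2 * mass (1 / Y n) / growth (Y n)) \<longlonglongrightarrow> C_const \<alpha>"
  proof (rule tendsto_sandwich[OF _ _ _ J])
    show "(\<lambda>n. (1 - 1 / (24 * (Y n)\<^sup>2))\<^sup>2 * integral\<^sup>L (growth_law (Y n)) f) \<longlonglongrightarrow> C_const \<alpha>"
      using lower by simp
  qed (use bounds in auto)
  then show "(\<lambda>n. (X n)\<^sup>2 * mass (1 / X n) / growth (X n)) \<longlonglongrightarrow> C_const \<alpha>"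
    unfolding Y_def by (rule LIMSEQ_offset)
qed

end

section \<open>From spectral mass to variance growth\<close>

context half_circle_measure begin

text \<open>\<open>M\<close> conditioned on frequencies at most \<open>c/s\<close>, observed at scale \<open>1/s\<close>.\<close>

definition truncated_law :: "real \<Rightarrow> real \<Rightarrow> real measure" where
  "truncated_law c s = distr (density M (\<lambda>t. ennreal (indicator {0..c / s} t / mass (c / s)))) borel (\<lambda>t. s * t)"

lemma prob_space_truncation:
  assumes "mass x > 0"
  shows "prob_space (density M (\<lambda>t. ennreal (indicator {0..x} t / mass x)))"
proof (rule prob_spaceI)
  let ?D = "density M (\<lambda>t. ennreal (indicator {0..x} t / mass x))"
  have "emeasure ?D (space ?D) = (\<integral>\<^sup>+t. ennreal (indicator {0..x} t / mass x) \<partial>M)"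
    by (subst emeasure_density) (auto simp: measurable_M_eq intro!: nn_integral_cong)
  also have "\<dots> = ennreal (\<integral>t. indicator {0..x} t / mass x \<partial>M)"
    using assms by (intro nn_integral_eq_integral) auto
  also have "\<dots> = 1" using assms by (simp only: integral_divide_zero integral_indicator_mass) simp
  finally show "emeasure ?D (space ?D) = 1" .
qed

lemma real_distribution_truncated_law:
  assumes "mass (c / s) > 0"
  shows "real_distribution (truncated_law c s)"
  unfolding truncated_law_def
  by (intro prob_space.real_distribution_distr prob_space_truncation assms) (simp add: measurable_M_eq)

lemma integral_truncated_law:
  fixes f :: "real \<Rightarrow> real"
  assumes "mass (c / s) > 0" and [measurable]: "f \<in> borel_measurable borel"
  shows "integral\<^sup>L (truncated_law c s) f = (\<integral>t. indicator {0..c / s} t * f (s * t) \<partial>M) / mass (c / s)"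
proof -
  have "integral\<^sup>L (truncated_law c s) f = (\<integral>t. f (s * t) \<partial>density M (\<lambda>t. ennreal (indicator {0..c / s} t / mass (c / s))))"
    unfolding truncated_law_def by (subst integral_distr) (auto simp: measurable_M_eq)
  also have "\<dots> = (\<integral>t. indicator {0..c / s} t / mass (c / s) * f (s * t) \<partial>M)"
    using assms(1) by (subst integral_density) (auto simp: measurable_M_eq)
  also have "\<dots> = (\<integral>t. indicator {0..c / s} t * f (s * t) / mass (c / s) \<partial>M)"
    by (intro Bochner_Integration.integral_cong) auto
  finally show ?thesis by simp
qed

lemma cdf_truncated_law:
  assumes "mass (c / s) > 0" "s > 0"
  shows "cdf (truncated_law c s) x = (if x < 0 then 0 else mass (min c x / s) / mass (c / s))"
proof -
  interpret T: real_distribution "truncated_law c s" by (rule real_distribution_truncated_law) fact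
  have "cdf (truncated_law c s) x = (\<integral>y. indicator {..x} y \<partial>truncated_law c s)"
    by (simp add: cdf_def)
  also have "\<dots> = (\<integral>t. indicator {0..c / s} t * indicator {..x} (s * t) \<partial>M) / mass (c / s)"
    by (rule integral_truncated_law[OF assms(1)]) measurable
  also have "(\<integral>t. indicator {0..c / s} t * indicator {..x} (s * t) \<partial>M) = (if x < 0 then 0 else mass (min c x / s))"
  proof (cases "x < 0")
    case True
    have "indicator {0..c / s} t * indicator {..x} (s * t) = (0::real)" for t
    proof (cases "t \<ge> 0")
      case t: True
      then have "\<not> s * t \<le> x" using True assms(2) mult_nonneg_nonneg[of s t] by linarith
      then show ?thesis by simp
    qed simp
    then show ?thesis using True by (simp only: Bochner_Integration.integral_zero if_True)
  next
    case False
    have "indicator {0..c / s} t * indicator {..x} (s * t) = (indicator {0..min c x / s} t :: real)" for t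
    proof -
      have "t \<le> c / s \<longleftrightarrow> s * t \<le> c" "t \<le> min c x / s \<longleftrightarrow> s * t \<le> min c x"
        using assms(2) by (simp_all add: pos_le_divide_eq mult.commute)
      then show ?thesis by (auto simp: indicator_def)
    qed
    then show ?thesis using False by (simp only: integral_indicator_mass) simp
  qed
  finally show ?thesis by simp
qed

end

definition power_law :: "real \<Rightarrow> real \<Rightarrow> real measure" where
  "power_law \<beta> c = density lborel (\<lambda>y. ennreal (\<beta> / c powr \<beta> * (y powr (\<beta> - 1) * indicator {0<..c} y)))"

context
  fixes \<beta> c :: real
  assumes \<beta>: "\<beta> > 0" and c: "c > 0"
begin

lemma has_bochner_integral_power_density:
  assumes "x \<ge> 0"
  shows "has_bochner_integral lborel (\<lambda>y. \<beta> / c powr \<beta> * (y powr (\<beta> - 1) * indicator {0<..x} y)) (x powr \<beta> / c powr \<beta>)"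
  using has_bochner_integral_mult_right[OF has_bochner_integral_powr_initial[of "\<beta> - 1" x], of "\<beta> / c powr \<beta>"] assms \<beta>
  by simp

lemma real_distribution_power_law: "real_distribution (power_law \<beta> c)"
proof -
  have "emeasure (power_law \<beta> c) (space (power_law \<beta> c)) = (\<integral>\<^sup>+y. ennreal (\<beta> / c powr \<beta> * (y powr (\<beta> - 1) * indicator {0<..c} y)) \<partial>lborel)"
    unfolding power_law_def by (subst emeasure_density) auto
  also have "\<dots> = ennreal (\<integral>y. \<beta> / c powr \<beta> * (y powr (\<beta> - 1) * indicator {0<..c} y) \<partial>lborel)"
    using has_bochner_integral_power_density[of c] \<beta> c
    by (intro nn_integral_eq_integral) (auto simp: has_bochner_integral_iff)
  also have "(\<integral>y. \<beta> / c powr \<beta> * (y powr (\<beta> - 1) * indicator {0<..c} y) \<partial>lborel) = c powr \<beta> / c powr \<beta>"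
    using c by (intro has_bochner_integral_integral_eq has_bochner_integral_power_density) simp
  also have "ennreal \<dots> = 1" using c by simp
  finally have "prob_space (power_law \<beta> c)" by (rule prob_spaceI)
  then show ?thesis by (simp add: real_distribution_def real_distribution_axioms_def power_law_def)
qed

lemma integral_power_law:
  fixes f :: "real \<Rightarrow> real"
  assumes "f \<in> borel_measurable borel"
  shows "integral\<^sup>L (power_law \<beta> c) f = (\<integral>y. \<beta> / c powr \<beta> * (y powr (\<beta> - 1) * indicator {0<..c} y) * f y \<partial>lborel)"
  unfolding power_law_def using assms \<beta> by (subst integral_density) auto

lemma cdf_power_law: "cdf (power_law \<beta> c) x = (if x < 0 then 0 else (min c x) powr \<beta> / c powr \<beta>)"
proof -
  interpret T: real_distribution "power_law \<beta> c" by (rule real_distribution_power_law)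
  have "cdf (power_law \<beta> c) x = (\<integral>y. indicator {..x} y \<partial>power_law \<beta> c)"
    by (simp add: cdf_def)
  also have "\<dots> = (\<integral>y. \<beta> / c powr \<beta> * (y powr (\<beta> - 1) * indicator {0<..max 0 (min c x)} y) \<partial>lborel)"
    by (subst integral_power_law, measurable) (intro Bochner_Integration.integral_cong refl, auto simp: indicator_def)
  also have "\<dots> = (max 0 (min c x)) powr \<beta> / c powr \<beta>"
    by (intro has_bochner_integral_integral_eq has_bochner_integral_power_density) simp
  finally show ?thesis using c \<beta> by (simp add: max_def min_def)
qed

end

context half_circle_measure begin

context
  fixes h :: "real \<Rightarrow> real" and \<alpha> :: real
  assumes h: "slowly_varying h" and \<alpha>: "0 < \<alpha>" "\<alpha> < 2"
    and lim: "((\<lambda>s. mass (1 / s) / (s powr (\<alpha> - 2) * h s)) \<longlongrightarrow> C_const \<alpha>) at_top"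
begin

definition gauge :: "real \<Rightarrow> real" where
  "gauge s = s powr (\<alpha> - 2) * h s"

lemma gauge_pos: "s > 0 \<Longrightarrow> gauge s > 0"
  using slowly_varying_pos[OF h] by (simp add: gauge_def)

lemma weight_eq_square_gauge:
  assumes "s > 0"
  shows "s powr \<alpha> * h s = s\<^sup>2 * gauge s"
proof -
  have "s powr \<alpha> = s powr (2 + (\<alpha> - 2))" by simp
  also have "\<dots> = s\<^sup>2 * s powr (\<alpha> - 2)" using assms by (simp only: powr_add) (simp add: powr_numeral)
  finally show ?thesis by (simp add: gauge_def)
qed

lemma C_const_pos: "C_const \<alpha> > 0"
  using \<alpha> cos_powr_integral_pos[OF \<alpha>] by (simp add: C_const_eq)

lemma mass_gauge_limit:
  assumes c: "c > 0"
  shows "((\<lambda>s. mass (c / s) / gauge s) \<longlongrightarrow> C_const \<alpha> * c powr (2 - \<alpha>)) at_top"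
proof -
  have scale: "filterlim (\<lambda>s. (1 / c) * s) at_top at_top"
    using c by (intro filterlim_tendsto_pos_mult_at_top[OF tendsto_const] filterlim_ident) auto
  have 1: "((\<lambda>s. mass (1 / ((1 / c) * s)) / gauge ((1 / c) * s)) \<longlongrightarrow> C_const \<alpha>) at_top"
    using filterlim_compose[OF lim scale] by (simp add: gauge_def)
  have "((\<lambda>s. (1 / c) powr (\<alpha> - 2) * (h ((1 / c) * s) / h s)) \<longlongrightarrow> (1 / c) powr (\<alpha> - 2) * 1) at_top"
  proof (intro tendsto_mult tendsto_const)
    have "1 / c > 0" using c by simp
    then show "((\<lambda>s. h ((1 / c) * s) / h s) \<longlongrightarrow> 1) at_top"
      using h unfolding slowly_varying_def by blast
  qed
  moreover have "eventually (\<lambda>s. (1 / c) powr (\<alpha> - 2) * (h ((1 / c) * s) / h s) = gauge ((1 / c) * s) / gauge s) at_top"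
    using eventually_gt_at_top[of 0] by eventually_elim (use c in \<open>simp add: gauge_def powr_divide\<close>)
  ultimately have 2: "((\<lambda>s. gauge ((1 / c) * s) / gauge s) \<longlongrightarrow> (1 / c) powr (\<alpha> - 2) * 1) at_top"
    by (rule Lim_transform_eventually)
  have "((\<lambda>s. mass (1 / ((1 / c) * s)) / gauge ((1 / c) * s) * (gauge ((1 / c) * s) / gauge s)) \<longlongrightarrow> C_const \<alpha> * ((1 / c) powr (\<alpha> - 2) * 1)) at_top"
    by (intro tendsto_mult 1 2)
  moreover have "eventually (\<lambda>s. mass (1 / ((1 / c) * s)) / gauge ((1 / c) * s) * (gauge ((1 / c) * s) / gauge s) = mass (c / s) / gauge s) at_top"
    using eventually_gt_at_top[of 0]
  proof eventually_elim
    case (elim s)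
    have "gauge ((1 / c) * s) > 0" using elim c by (intro gauge_pos) auto
    then show ?case by simp
  qed
  ultimately have "((\<lambda>s. mass (c / s) / gauge s) \<longlongrightarrow> C_const \<alpha> * ((1 / c) powr (\<alpha> - 2) * 1)) at_top"
    by (rule Lim_transform_eventually)
  moreover have "(1 / c) powr (\<alpha> - 2) = c powr (2 - \<alpha>)"
    using c powr_minus[of c "2 - \<alpha>"] by (simp add: powr_divide field_simps)
  ultimately show ?thesis by simp
qed

lemma mass_pos:
  assumes "x > 0"
  shows "mass x > 0"
proof -
  have "eventually (\<lambda>s. mass (1 / s) / gauge s > 0) at_top"
    using order_tendstoD(1)[OF lim C_const_pos] by (simp add: gauge_def)
  then have "eventually (\<lambda>s. mass (1 / s) / gauge s > 0 \<and> s \<ge> 1 / x \<and> s > 0) at_top"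
    using eventually_ge_at_top[of "1 / x"] eventually_gt_at_top[of 0] by eventually_elim auto
  then obtain s where s: "mass (1 / s) / gauge s > 0" "s \<ge> 1 / x" "s > 0"
    using eventually_happens'[OF trivial_limit_at_top_linorder] by blast
  have "0 < mass (1 / s)" using s gauge_pos[of s] by (simp add: zero_less_divide_iff)
  also have "\<dots> \<le> mass x" using s assms by (intro mass_mono) (simp add: field_simps)
  finally show ?thesis .
qed

text \<open>An atom at \<open>0\<close> would be dominated by \<open>mass (1 / s)\<close>, which tends to \<open>0\<close>.\<close>

lemma mass_0: "mass 0 = 0"
proof -
  have "((\<lambda>s. mass (1 / s) / gauge s * gauge s) \<longlongrightarrow> C_const \<alpha> * 0) at_top"
    using lim slowly_varying_times_power_to_0[OF h, of "\<alpha> - 2"] \<alpha>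
    by (intro tendsto_mult) (auto simp: gauge_def)
  moreover have "eventually (\<lambda>s. mass 0 \<le> mass (1 / s) / gauge s * gauge s) at_top"
    using eventually_gt_at_top[of 0]
  proof eventually_elim
    case (elim s)
    then have "mass 0 \<le> mass (1 / s)" by (intro mass_mono) simp
    then show ?case using gauge_pos[OF elim] by simp
  qed
  ultimately have "mass 0 \<le> C_const \<alpha> * 0"
    by (rule tendsto_lowerbound) simp
  then show ?thesis using mass_nonneg[of 0] by simp
qed

definition truncated_growth :: "real \<Rightarrow> real \<Rightarrow> real" where
  "truncated_growth c s = (\<integral>t. indicator {0..c / s} t * (dirichlet_ratio s t)\<^sup>2 \<partial>M)"

text \<open>The truncated laws have distribution functions that converge to those of the power law, so the
bounded continuous function \<open>(sin (y/2) / (y/2))\<^sup>2\<close> can be integrated in the limit; by the formula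
for the limit density the result is the mass that the limit law gives to \<open>[0, c]\<close>.\<close>

lemma sin_over_square_limit:
  assumes c: "c > 0"
  shows "((\<lambda>s. (\<integral>t. indicator {0..c / s} t * (sin_over (s * t / 2))\<^sup>2 \<partial>M) / gauge s)
    \<longlongrightarrow> cdf (limit_law \<alpha>) c) at_top"
proof (rule tendsto_at_topI_sequentially)
  fix X :: "nat \<Rightarrow> real"
  assume "filterlim X at_top sequentially"
  then have "eventually (\<lambda>n. X n > 0) sequentially"
    using eventually_gt_at_top[of 0] by (rule eventually_compose_filterlim[rotated])
  then obtain N where N: "\<And>n. n \<ge> N \<Longrightarrow> X n > 0" by (auto simp: eventually_sequentially)
  define Y where "Y n = X (n + N)" for n
  have Y_pos: "Y n > 0" for n using N[of "n + N"] by (simp add: Y_def)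
  have Y: "filterlim Y at_top sequentially"
    unfolding Y_def using \<open>filterlim X at_top sequentially\<close>
    by (rule filterlim_compose) (rule filterlim_add_const_nat_at_top)
  define \<beta> where "\<beta> = 2 - \<alpha>"
  have \<beta>: "\<beta> > 0" using \<alpha> by (simp add: \<beta>_def)
  define g where "g y = (sin_over (y / 2))\<^sup>2" for y
  have g [measurable]: "g \<in> borel_measurable borel" unfolding g_def by measurable
  have mass_Y: "mass (c / Y n) > 0" for n using c Y_pos by (intro mass_pos) auto
  have "(\<lambda>n. integral\<^sup>L (truncated_law c (Y n)) g) \<longlonglongrightarrow> integral\<^sup>L (power_law \<beta> c) g"
  proof (rule weak_conv_imp_integral_bdd_continuous_conv)
    show "real_distribution (truncated_law c (Y n))" for n by (rule real_distribution_truncated_law[OF mass_Y])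
    show "real_distribution (power_law \<beta> c)" by (rule real_distribution_power_law[OF \<beta> c])
    show "isCont g y" for y
      unfolding g_def by (intro continuous_intros isCont_o2[OF _ isCont_sin_over]) auto
    show "norm (g y) \<le> 1" for y
      using abs_sin_over_le_1[of "y / 2"] by (simp add: g_def abs_square_le_1)
    show "weak_conv_m (\<lambda>n. truncated_law c (Y n)) (power_law \<beta> c)"
      unfolding weak_conv_m_def weak_conv_def
    proof (intro allI impI)
      fix x :: real
      have "(\<lambda>n. mass (min c x / Y n) / mass (c / Y n)) \<longlonglongrightarrow> min c x powr \<beta> / c powr \<beta>" if "x \<ge> 0"
      proof (cases "x = 0")
        case True
        then show ?thesis using c by (simp add: mass_0)
      next
        case False
        then have m: "min c x > 0" using that c by simp
        have "(\<lambda>n. (mass (min c x / Y n) / gauge (Y n)) / (mass (c / Y n) / gauge (Y n)))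
          \<longlonglongrightarrow> (C_const \<alpha> * min c x powr (2 - \<alpha>)) / (C_const \<alpha> * c powr (2 - \<alpha>))"
          using C_const_pos c
          by (intro tendsto_divide filterlim_compose[OF mass_gauge_limit Y] m c) auto
        moreover have "(mass (min c x / Y n) / gauge (Y n)) / (mass (c / Y n) / gauge (Y n)) = mass (min c x / Y n) / mass (c / Y n)" for n
          using gauge_pos[OF Y_pos[of n]] by simp
        ultimately have "(\<lambda>n. mass (min c x / Y n) / mass (c / Y n))
            \<longlonglongrightarrow> (C_const \<alpha> * min c x powr (2 - \<alpha>)) / (C_const \<alpha> * c powr (2 - \<alpha>))"
          by (simp only:)
        then show ?thesis using C_const_pos by (simp add: \<beta>_def)
      qed
      then show "(\<lambda>n. cdf (truncated_law c (Y n)) x) \<longlonglongrightarrow> cdf (power_law \<beta> c) x"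
        unfolding cdf_truncated_law[OF mass_Y Y_pos] cdf_power_law[OF \<beta> c] by (cases "x < 0") auto
    qed
  qed
  moreover have "(\<lambda>n. mass (c / Y n) / gauge (Y n)) \<longlonglongrightarrow> C_const \<alpha> * c powr \<beta>"
    unfolding \<beta>_def by (rule filterlim_compose[OF mass_gauge_limit[OF c] Y])
  ultimately have "(\<lambda>n. mass (c / Y n) / gauge (Y n) * integral\<^sup>L (truncated_law c (Y n)) g)
    \<longlonglongrightarrow> C_const \<alpha> * c powr \<beta> * integral\<^sup>L (power_law \<beta> c) g"
    by (intro tendsto_mult)
  moreover have "mass (c / Y n) / gauge (Y n) * integral\<^sup>L (truncated_law c (Y n)) g
    = (\<integral>t. indicator {0..c / Y n} t * (sin_over (Y n * t / 2))\<^sup>2 \<partial>M) / gauge (Y n)" for n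
    using mass_Y[of n] by (simp add: integral_truncated_law[OF mass_Y g]) (simp add: g_def)
  moreover have "C_const \<alpha> * c powr \<beta> * integral\<^sup>L (power_law \<beta> c) g = cdf (limit_law \<alpha>) c"
  proof -
    interpret L: real_distribution "limit_law \<alpha>" by (rule real_distribution_limit_law[OF \<alpha>])
    have "C_const \<alpha> * c powr \<beta> * integral\<^sup>L (power_law \<beta> c) g
      = (\<integral>y. C_const \<alpha> * c powr \<beta> * (\<beta> / c powr \<beta> * (y powr (\<beta> - 1) * indicator {0<..c} y) * g y) \<partial>lborel)"
      unfolding integral_power_law[OF \<beta> c g] by (rule integral_mult_right_zero[symmetric])
    also have "\<dots> = (\<integral>y. limit_density \<alpha> y * indicator {..c} y \<partial>lborel)"
      by (intro Bochner_Integration.integral_cong refl)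
         (use c in \<open>auto simp: limit_density_eq[OF \<alpha>] g_def \<beta>_def indicator_def\<close>)
    also have "\<dots> = (\<integral>y. indicator {..c} y \<partial>limit_law \<alpha>)"
      by (subst integral_limit_law[OF \<alpha>]) auto
    finally show ?thesis by (simp add: cdf_def)
  qed
  ultimately have "(\<lambda>n. (\<integral>t. indicator {0..c / Y n} t * (sin_over (Y n * t / 2))\<^sup>2 \<partial>M) / gauge (Y n)) \<longlonglongrightarrow> cdf (limit_law \<alpha>) c"
    by (simp only:)
  then show "(\<lambda>n. (\<integral>t. indicator {0..c / X n} t * (sin_over (X n * t / 2))\<^sup>2 \<partial>M) / gauge (X n)) \<longlonglongrightarrow> cdf (limit_law \<alpha>) c"
    unfolding Y_def by (rule LIMSEQ_offset)
qed

text \<open>On \<open>t \<le> c/s\<close> the denominator \<open>sin_over (t / 2)\<close> of the Dirichlet ratio tends to \<open>1\<close> uniformly.\<close>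

lemma truncated_growth_limit:
  assumes c: "c > 0"
  shows "((\<lambda>s. truncated_growth c s / (s powr \<alpha> * h s)) \<longlongrightarrow> cdf (limit_law \<alpha>) c) at_top"
proof -
  define b where "b s = 1 - (c / s)\<^sup>2 / 24" for s
  define T where "T s = (\<integral>t. indicator {0..c / s} t * (sin_over (s * t / 2))\<^sup>2 \<partial>M)" for s
  have T: "((\<lambda>s. T s / gauge s) \<longlongrightarrow> cdf (limit_law \<alpha>) c) at_top"
    unfolding T_def by (rule sin_over_square_limit[OF c])
  have b: "(b \<longlongrightarrow> 1) at_top" unfolding b_def using c by real_asymp
  have b_pos: "eventually (\<lambda>s. b s > 0) at_top" by (rule order_tendstoD(1)[OF b]) simp
  have upper_lim: "((\<lambda>s. T s / gauge s / (b s)\<^sup>2) \<longlongrightarrow> cdf (limit_law \<alpha>) c / 1\<^sup>2) at_top"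
    by (intro tendsto_divide tendsto_power T b) simp
  have bounds: "T s / gauge s \<le> truncated_growth c s / (s powr \<alpha> * h s)
      \<and> truncated_growth c s / (s powr \<alpha> * h s) \<le> T s / gauge s / (b s)\<^sup>2"
    if s: "s > 0" and bs: "b s > 0" for s
  proof -
    have pw: "indicator {0..c / s} t * (sin_over (s * t / 2))\<^sup>2 * s\<^sup>2 \<le> indicator {0..c / s} t * (dirichlet_ratio s t)\<^sup>2
       \<and> indicator {0..c / s} t * (dirichlet_ratio s t)\<^sup>2 \<le> indicator {0..c / s} t * (sin_over (s * t / 2))\<^sup>2 * s\<^sup>2 / (b s)\<^sup>2" for t
    proof (cases "t \<in> {0..c / s}")
      case True
      have "t\<^sup>2 \<le> (c / s)\<^sup>2" using True by (intro power_mono) auto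
      then have "b s \<le> 1 - (t / 2)\<^sup>2 / 6" by (simp add: b_def power_divide)
      then have le: "b s \<le> sin_over (t / 2)" using sin_over_lower_bound[of "t / 2"] by linarith
      have sq: "(b s)\<^sup>2 \<le> (sin_over (t / 2))\<^sup>2" "(sin_over (t / 2))\<^sup>2 \<le> 1"
        using abs_sin_over_le_1[of "t / 2"] le bs by (auto intro!: power_mono simp: abs_square_le_1)
      have pos: "0 < (sin_over (t / 2))\<^sup>2 * 1" "0 < (b s)\<^sup>2 * (sin_over (t / 2))\<^sup>2" using bs le by simp_all
      define z where "z = (sin_over (s * t / 2))\<^sup>2 * s\<^sup>2"
      have "z / 1 \<le> z / (sin_over (t / 2))\<^sup>2"
        using sq(2) pos(1) by (intro divide_left_mono) (auto simp: z_def mult.commute)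
      moreover have "z / (sin_over (t / 2))\<^sup>2 \<le> z / (b s)\<^sup>2"
        using sq(1) pos(2) by (intro divide_left_mono) (auto simp: z_def mult.commute)
      moreover have "(dirichlet_ratio s t)\<^sup>2 = z / (sin_over (t / 2))\<^sup>2"
        by (simp add: dirichlet_ratio_def z_def power_divide power_mult_distrib)
      ultimately show ?thesis using True by (simp add: z_def)
    qed simp
    have int_T: "integrable M (\<lambda>t. indicator {0..c / s} t * (sin_over (s * t / 2))\<^sup>2)"
      using abs_sin_over_le_1 by (intro integrable_AE_bounded[of _ 1]) (auto simp: indicator_def abs_square_le_1)
    have int_D: "integrable M (\<lambda>t. indicator {0..c / s} t * (dirichlet_ratio s t)\<^sup>2)"
      by (rule integrable_dirichlet_ratio[of _ 1]) (auto simp: indicator_def)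
    have "T s * s\<^sup>2 = (\<integral>t. indicator {0..c / s} t * (sin_over (s * t / 2))\<^sup>2 * s\<^sup>2 \<partial>M)"
      unfolding T_def by (rule integral_mult_left_zero[symmetric])
    also have "\<dots> \<le> truncated_growth c s"
      unfolding truncated_growth_def using int_T int_D pw by (intro integral_mono) auto
    finally have 1: "T s * s\<^sup>2 \<le> truncated_growth c s" .
    have "truncated_growth c s \<le> (\<integral>t. indicator {0..c / s} t * (sin_over (s * t / 2))\<^sup>2 * s\<^sup>2 / (b s)\<^sup>2 \<partial>M)"
      unfolding truncated_growth_def using int_T int_D pw by (intro integral_mono) auto
    also have "\<dots> = T s * s\<^sup>2 / (b s)\<^sup>2"
      unfolding T_def by (simp only: integral_divide_zero integral_mult_left_zero)
    finally have 2: "truncated_growth c s \<le> T s * s\<^sup>2 / (b s)\<^sup>2" .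
    have g: "gauge s > 0" using s by (rule gauge_pos)
    then have nn: "0 \<le> s\<^sup>2 * gauge s" by simp
    have "T s * s\<^sup>2 / (s\<^sup>2 * gauge s) \<le> truncated_growth c s / (s\<^sup>2 * gauge s)"
      "truncated_growth c s / (s\<^sup>2 * gauge s) \<le> T s * s\<^sup>2 / (b s)\<^sup>2 / (s\<^sup>2 * gauge s)"
      using divide_right_mono[OF 1 nn] divide_right_mono[OF 2 nn] .
    moreover have "T s * s\<^sup>2 / (s\<^sup>2 * gauge s) = T s / gauge s"
      "T s * s\<^sup>2 / (b s)\<^sup>2 / (s\<^sup>2 * gauge s) = T s / gauge s / (b s)\<^sup>2"
      using s by simp_all
    ultimately show ?thesis by (simp only: weight_eq_square_gauge[OF s])
  qed
  show ?thesis
  proof (rule tendsto_sandwich[OF _ _ T])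
    show "((\<lambda>s. T s / gauge s / (b s)\<^sup>2) \<longlongrightarrow> cdf (limit_law \<alpha>) c) at_top" using upper_lim by simp
    show "eventually (\<lambda>s. T s / gauge s \<le> truncated_growth c s / (s powr \<alpha> * h s)) at_top"
      using eventually_gt_at_top[of 0] b_pos by eventually_elim (use bounds in blast)
    show "eventually (\<lambda>s. truncated_growth c s / (s powr \<alpha> * h s) \<le> T s / gauge s / (b s)\<^sup>2) at_top"
      using eventually_gt_at_top[of 0] b_pos by eventually_elim (use bounds in blast)
  qed
qed

text \<open>On \<open>0 < t \<le> \<pi>\<close> the squared Dirichlet ratio is at most \<open>1 / sin\<^sup>2(t/2) \<le> 36 / t\<^sup>2\<close>, for every \<open>s\<close>.\<close>

definition tail :: "real \<Rightarrow> real" where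
  "tail x = (\<integral>t. indicator {x<..} t * (36 / t\<^sup>2) \<partial>M)"

lemma integrable_tail:
  assumes "x > 0"
  shows "integrable M (\<lambda>t. indicator {x<..} t * (36 / t\<^sup>2))"
proof (rule integrable_bounded_borel[of _ "36 / x\<^sup>2"])
  fix t :: real
  have "36 / t\<^sup>2 \<le> 36 / x\<^sup>2" if "x < t"
    using that assms by (intro divide_left_mono power_mono) auto
  then show "norm (indicator {x<..} t * (36 / t\<^sup>2)) \<le> 36 / x\<^sup>2"
    by (auto simp: indicator_def)
qed measurable

lemma tail_antimono:
  assumes "0 < x" "x \<le> y"
  shows "tail y \<le> tail x"
  unfolding tail_def using assms by (intro integral_mono integrable_tail) (auto simp: indicator_def)

lemma tail_double:
  assumes x: "x > 0"
  shows "tail x \<le> tail (2 * x) + 36 / x\<^sup>2 * mass (2 * x)"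
proof -
  have "tail x \<le> (\<integral>t. indicator {2 * x<..} t * (36 / t\<^sup>2) + 36 / x\<^sup>2 * indicator {0..2 * x} t \<partial>M)"
    unfolding tail_def
  proof (rule integral_mono)
    fix t :: real
    have "36 / t\<^sup>2 \<le> 36 / x\<^sup>2" if "x < t"
      using that x by (intro divide_left_mono power_mono) auto
    then show "indicator {x<..} t * (36 / t\<^sup>2) \<le> indicator {2 * x<..} t * (36 / t\<^sup>2) + 36 / x\<^sup>2 * indicator {0..2 * x} t"
      using x by (auto simp: indicator_def)
    show "integrable M (\<lambda>t. indicator {x<..} t * (36 / t\<^sup>2))" using x by (rule integrable_tail)
    show "integrable M (\<lambda>t. indicator {2 * x<..} t * (36 / t\<^sup>2) + 36 / x\<^sup>2 * indicator {0..2 * x} t)"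
      using x by (intro Bochner_Integration.integrable_add integrable_tail integrable_mult_right integrable_indicator_mass) simp
  qed
  also have "\<dots> = tail (2 * x) + 36 / x\<^sup>2 * mass (2 * x)"
  proof -
    have "integrable M (\<lambda>t. indicator {2 * x<..} t * (36 / t\<^sup>2))" using x by (intro integrable_tail) simp
    moreover have "integrable M (\<lambda>t. 36 / x\<^sup>2 * indicator {0..2 * x} t)"
      by (intro integrable_mult_right integrable_indicator_mass)
    ultimately show ?thesis
      by (simp only: Bochner_Integration.integral_add integral_mult_right_zero integral_indicator_mass tail_def)
  qed
  finally show ?thesis .
qed

text \<open>\<open>mass x / x\<^sup>2\<close> is regularly varying at \<open>0\<close> with exponent \<open>-\<alpha> < 0\<close>, so doubling \<open>x\<close> shrinks it by a
factor close to \<open>2 powr (-\<alpha>)\<close>.\<close>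

lemma mass_ratio_contracts:
  "\<exists>q x0. 0 < q \<and> q < 1 \<and> 0 < x0 \<and> (\<forall>x. 0 < x \<longrightarrow> x \<le> x0 \<longrightarrow> mass (2 * x) / (2 * x)\<^sup>2 \<le> q * (mass x / x\<^sup>2))"
proof -
  \<comment> \<open>Any number strictly between \<open>2 powr (-\<alpha>)\<close> and \<open>1\<close>.\<close>
  define q where "q = (2 powr (- \<alpha>) + 1) / 2"
  have "2 powr (- \<alpha>) < 2 powr 0" using \<alpha> by (intro powr_less_mono) auto
  then have q: "0 < q" "q < 1" "2 powr (- \<alpha>) < q" by (simp_all add: q_def add_pos_pos)
  have four: "2 powr (2 - \<alpha>) = 4 * 2 powr (- \<alpha>)"
    by (simp add: powr_diff powr_minus divide_inverse powr_numeral)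
  have "((\<lambda>s. (mass (2 / s) / gauge s) / (mass (1 / s) / gauge s)) \<longlongrightarrow> (C_const \<alpha> * 2 powr (2 - \<alpha>)) / (C_const \<alpha> * 1 powr (2 - \<alpha>))) at_top"
    using C_const_pos by (intro tendsto_divide mass_gauge_limit) auto
  moreover have "(C_const \<alpha> * 2 powr (2 - \<alpha>)) / (C_const \<alpha> * 1 powr (2 - \<alpha>)) < 4 * q"
    using C_const_pos q four by simp
  ultimately have "eventually (\<lambda>s. (mass (2 / s) / gauge s) / (mass (1 / s) / gauge s) < 4 * q) at_top"
    by (rule order_tendstoD(2))
  then obtain B where B: "\<And>s. s \<ge> B \<Longrightarrow> (mass (2 / s) / gauge s) / (mass (1 / s) / gauge s) < 4 * q"
    by (auto simp: eventually_at_top_linorder)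
  define m where "m = max B 1"
  have m: "m > 0" "B \<le> m" by (simp_all add: m_def)
  define x0 where "x0 = 1 / m"
  have "mass (2 * x) / (2 * x)\<^sup>2 \<le> q * (mass x / x\<^sup>2)" if "0 < x" "x \<le> x0" for x
  proof -
    have "m \<le> 1 / x" using that m by (simp add: x0_def field_simps)
    then have "(mass (2 / (1 / x)) / gauge (1 / x)) / (mass (1 / (1 / x)) / gauge (1 / x)) < 4 * q"
      using m by (intro B) simp
    moreover have "gauge (1 / x) > 0" using that by (intro gauge_pos) simp
    ultimately have "mass (2 * x) / mass x < 4 * q" by simp
    then have "mass (2 * x) \<le> 4 * q * mass x" using mass_pos[OF that(1)] by (simp add: pos_divide_less_eq)
    then have "mass (2 * x) / (4 * x\<^sup>2) \<le> 4 * q * mass x / (4 * x\<^sup>2)" by (intro divide_right_mono) auto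
    then show ?thesis by (simp add: power_mult_distrib)
  qed
  moreover have "x0 > 0" using m by (simp add: x0_def)
  ultimately show ?thesis using q by blast
qed

text \<open>Passing from \<open>2 x\<close> to \<open>x\<close> adds at most \<open>144 mass (2 x) / (2 x)\<^sup>2\<close> to the tail, and by \<open>mass_ratio_contracts\<close> this
increment and the old bound are both absorbed by the growth of \<open>mass x / x\<^sup>2\<close>. The induction runs over
dyadic scales.\<close>

lemma tail_le_mass:
  "\<exists>K x0. 0 < K \<and> 0 < x0 \<and> (\<forall>x. 0 < x \<longrightarrow> x \<le> x0 \<longrightarrow> tail x \<le> K * (mass x / x\<^sup>2))"
proof -
  obtain q x0 where q: "0 < q" "q < 1" and x0: "0 < x0"
    and contr: "\<And>x. 0 < x \<Longrightarrow> x \<le> x0 \<Longrightarrow> mass (2 * x) / (2 * x)\<^sup>2 \<le> q * (mass x / x\<^sup>2)"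
    using mass_ratio_contracts by blast
  \<comment> \<open>The first entry starts the induction on \<open>[x0, 2 x0]\<close>; the second makes \<open>q (K + 144) \<le> K\<close>.\<close>
  define K where "K = max (tail x0 * (2 * x0)\<^sup>2 / mass x0) (144 * q / (1 - q))"
  have "144 * q / (1 - q) > 0" using q by simp
  then have K: "K > 0" by (simp add: K_def)
  have K_ge: "q * (K + 144) \<le> K"
  proof -
    have "144 * q / (1 - q) \<le> K" by (simp add: K_def)
    then have "144 * q \<le> K * (1 - q)" using q by (simp add: pos_divide_le_eq)
    then show ?thesis by (simp add: algebra_simps)
  qed
  have base: "tail x \<le> K * (mass x / x\<^sup>2)" if "x0 \<le> x" "x \<le> 2 * x0" for x
  proof -
    have m0: "mass x0 > 0" using x0 by (rule mass_pos)
    have "tail x \<le> tail x0" using that x0 by (intro tail_antimono) auto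
    also have "\<dots> = tail x0 * (2 * x0)\<^sup>2 / mass x0 * (mass x0 / (2 * x0)\<^sup>2)"
      using m0 x0 by simp
    also have "\<dots> \<le> K * (mass x / x\<^sup>2)"
    proof (rule mult_mono)
      show "mass x0 / (2 * x0)\<^sup>2 \<le> mass x / x\<^sup>2"
        using that x0 by (intro frac_le mass_mono mass_nonneg power_mono) auto
    qed (use K m0 in \<open>auto simp: K_def\<close>)
    finally show ?thesis .
  qed
  have step: "\<forall>x. x0 / 2 ^ n \<le> x \<longrightarrow> x \<le> 2 * x0 \<longrightarrow> tail x \<le> K * (mass x / x\<^sup>2)" for n
  proof (induction n)
    case 0
    show ?case using base by simp
  next
    case (Suc n)
    show ?case
    proof (intro allI impI)
      fix x assume x: "x0 / 2 ^ Suc n \<le> x" "x \<le> 2 * x0"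
      show "tail x \<le> K * (mass x / x\<^sup>2)"
      proof (cases "x \<le> x0")
        case True
        have "x0 / 2 ^ Suc n > 0" using x0 by simp
        then have "x > 0" using x by linarith
        have "x0 / 2 ^ n \<le> 2 * x" using x by (simp add: field_simps)
        then have "tail (2 * x) \<le> K * (mass (2 * x) / (2 * x)\<^sup>2)" using Suc[rule_format, of "2 * x"] True by simp
        moreover have "36 / x\<^sup>2 * mass (2 * x) = 144 * (mass (2 * x) / (2 * x)\<^sup>2)"
          by (simp add: power_mult_distrib)
        ultimately have "tail x \<le> (K + 144) * (mass (2 * x) / (2 * x)\<^sup>2)"
          using tail_double[OF \<open>x > 0\<close>] by (simp only: distrib_right)
        also have "\<dots> \<le> (K + 144) * (q * (mass x / x\<^sup>2))"
          using K \<open>x > 0\<close> True by (intro mult_left_mono contr) auto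
        also have "\<dots> = q * (K + 144) * (mass x / x\<^sup>2)" by (simp only: mult.assoc mult.left_commute)
        also have "\<dots> \<le> K * (mass x / x\<^sup>2)"
          using K_ge mass_nonneg by (intro mult_right_mono) auto
        finally show ?thesis .
      next
        case False
        then show ?thesis using base x by simp
      qed
    qed
  qed
  have "tail x \<le> K * (mass x / x\<^sup>2)" if "0 < x" "x \<le> x0" for x
  proof -
    obtain n where "x0 / x < 2 ^ n" using real_arch_pow[of 2 "x0 / x"] by auto
    then have "x0 / 2 ^ n \<le> x" using that by (simp add: field_simps)
    then show ?thesis using step[of n] that x0 by auto
  qed
  then show ?thesis using K x0 by blast
qed

lemma growth_le_truncated_plus_tail:
  assumes c: "c > 0" and s: "s > 0"
  shows "truncated_growth c s \<le> growth s" "growth s \<le> truncated_growth c s + tail (c / s)"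
proof -
  have int_D: "integrable M (\<lambda>t. indicator {0..c / s} t * (dirichlet_ratio s t)\<^sup>2)"
    by (rule integrable_dirichlet_ratio[of _ 1]) (auto simp: indicator_def)
  show "truncated_growth c s \<le> growth s"
    unfolding truncated_growth_def growth_def using int_D integrable_dirichlet_ratio'
    by (intro integral_mono) (auto simp: indicator_def)
  have pos: "c / s > 0" using c s by simp
  have "growth s \<le> (\<integral>t. indicator {0..c / s} t * (dirichlet_ratio s t)\<^sup>2 + indicator {c / s<..} t * (36 / t\<^sup>2) \<partial>M)"
    unfolding growth_def
  proof (rule integral_mono_AE)
    show "AE t in M. (dirichlet_ratio s t)\<^sup>2 \<le> indicator {0..c / s} t * (dirichlet_ratio s t)\<^sup>2 + indicator {c / s<..} t * (36 / t\<^sup>2)"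
      using AE_half_circle
    proof eventually_elim
      case (elim t)
      have "(dirichlet_ratio s t)\<^sup>2 \<le> 36 / t\<^sup>2" if "c / s < t"
      proof -
        have t: "t > 0" using that pos by linarith
        have "1 / 3 \<le> sin_over (t / 2)" using elim by (intro sin_over_half_ge) auto
        then have "t / 6 \<le> sin (t / 2)" unfolding sin_half_eq_sin_over[of t] using t by (simp add: field_simps)
        then have "(t / 6)\<^sup>2 \<le> (sin (t / 2))\<^sup>2" using t by (intro power_mono) auto
        then have "1 / (sin (t / 2))\<^sup>2 \<le> 1 / (t / 6)\<^sup>2"
          using t \<open>t / 6 \<le> sin (t / 2)\<close> by (intro divide_left_mono mult_pos_pos) auto
        moreover have "(sin (s * t / 2))\<^sup>2 / (sin (t / 2))\<^sup>2 \<le> 1 / (sin (t / 2))\<^sup>2"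
          by (intro divide_right_mono) (auto simp: abs_square_le_1)
        ultimately show ?thesis using t by (simp add: dirichlet_ratio_nz power_divide)
      qed
      then show ?case using elim by (auto simp: indicator_def)
    qed
  qed (use int_D integrable_tail[OF pos] integrable_dirichlet_ratio' in auto)
  also have "\<dots> = truncated_growth c s + tail (c / s)"
    unfolding truncated_growth_def tail_def using int_D integrable_tail[OF pos] by simp
  finally show "growth s \<le> truncated_growth c s + tail (c / s)" .
qed

text \<open>The Abelian half: \<open>c\<close> is chosen first, so large that the limit law has nearly full mass on \<open>[0, c]\<close> and
the tail beyond \<open>c/s\<close> is negligible.\<close>

lemma growth_of_spectral_mass:
  "((\<lambda>s. growth s / (s powr \<alpha> * h s)) \<longlongrightarrow> 1) at_top"
proof (rule tendstoI)
  fix e :: real assume "e > 0"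
  obtain K x0 where K: "0 < K" "0 < x0" and tail: "\<And>x. 0 < x \<Longrightarrow> x \<le> x0 \<Longrightarrow> tail x \<le> K * (mass x / x\<^sup>2)"
    using tail_le_mass by blast
  interpret L: real_distribution "limit_law \<alpha>" by (rule real_distribution_limit_law[OF \<alpha>])
  have "eventually (\<lambda>c. 1 - e / 4 < cdf (limit_law \<alpha>) c) at_top"
    using \<open>e > 0\<close> by (intro order_tendstoD(1)[OF L.cdf_lim_at_top_prob]) simp
  moreover have "((\<lambda>c. K * C_const \<alpha> * c powr (- \<alpha>)) \<longlongrightarrow> K * C_const \<alpha> * 0) at_top"
    using \<alpha> by (intro tendsto_mult tendsto_const tendsto_neg_powr filterlim_ident) simp
  then have "eventually (\<lambda>c. K * C_const \<alpha> * c powr (- \<alpha>) < e / 4) at_top"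
    using \<open>e > 0\<close> by (intro order_tendstoD(2)[where y="K * C_const \<alpha> * 0"]) auto
  ultimately have "eventually (\<lambda>c. 1 - e / 4 < cdf (limit_law \<alpha>) c \<and> K * C_const \<alpha> * c powr (- \<alpha>) < e / 4 \<and> c > 0) at_top"
    using eventually_gt_at_top[of 0] by eventually_elim auto
  then obtain c where c: "1 - e / 4 < cdf (limit_law \<alpha>) c" "K * C_const \<alpha> * c powr (- \<alpha>) < e / 4" "c > 0"
    using eventually_happens'[OF trivial_limit_at_top_linorder] by blast
  define w where "w s = s powr \<alpha> * h s" for s
  have w: "w s = s\<^sup>2 * gauge s" if "s > 0" for s
    unfolding w_def using that by (rule weight_eq_square_gauge)
  have "((\<lambda>s. K / c\<^sup>2 * (mass (c / s) / gauge s)) \<longlongrightarrow> K / c\<^sup>2 * (C_const \<alpha> * c powr (2 - \<alpha>))) at_top"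
    by (intro tendsto_mult tendsto_const mass_gauge_limit c)
  moreover have "K / c\<^sup>2 * (C_const \<alpha> * c powr (2 - \<alpha>)) = K * C_const \<alpha> * c powr (- \<alpha>)"
  proof -
    have "c powr (2 - \<alpha>) = c powr (2 + (- \<alpha>))" by simp
    also have "\<dots> = c\<^sup>2 * c powr (- \<alpha>)" using c(3) by (simp only: powr_add) (simp add: powr_numeral)
    finally show ?thesis using c(3) by simp
  qed
  ultimately have "eventually (\<lambda>s. K / c\<^sup>2 * (mass (c / s) / gauge s) < e / 4) at_top"
    using c(2) by (intro order_tendstoD(2)) auto
  moreover have "eventually (\<lambda>s. dist (truncated_growth c s / w s) (cdf (limit_law \<alpha>) c) < e / 4) at_top"
    using tendstoD[OF truncated_growth_limit[OF c(3)], of "e / 4"] \<open>e > 0\<close> by (simp add: w_def)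
  ultimately show "eventually (\<lambda>s. dist (growth s / (s powr \<alpha> * h s)) 1 < e) at_top"
    using eventually_ge_at_top[of "c / x0"] eventually_gt_at_top[of 0]
  proof eventually_elim
    case (elim s)
    have g: "gauge s > 0" using elim by (intro gauge_pos)
    then have w_pos: "w s > 0" using elim by (simp add: w)
    have "c / s \<le> x0" using elim K by (simp add: field_simps)
    then have "tail (c / s) \<le> K * (mass (c / s) / (c / s)\<^sup>2)" using elim c by (intro tail) auto
    then have "tail (c / s) / w s \<le> K * (mass (c / s) / (c / s)\<^sup>2) / w s"
      using w_pos by (intro divide_right_mono) auto
    also have "\<dots> = K / c\<^sup>2 * (mass (c / s) / gauge s)"
      using elim c(3) g by (simp add: w power_divide)
    finally have t: "tail (c / s) / w s < e / 4" using elim by linarith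
    have "truncated_growth c s / w s \<le> growth s / w s"
      using growth_le_truncated_plus_tail(1)[OF c(3) elim(4)] w_pos by (intro divide_right_mono) auto
    moreover have "growth s / w s \<le> (truncated_growth c s + tail (c / s)) / w s"
      using growth_le_truncated_plus_tail(2)[OF c(3) elim(4)] w_pos by (intro divide_right_mono) auto
    moreover have "cdf (limit_law \<alpha>) c \<le> 1" by (rule L.cdf_bounded_prob)
    ultimately show ?case
      using t elim(2) c(1) unfolding w_def[symmetric] dist_real_def add_divide_distrib by linarith
  qed
qed

end
end

section \<open>Folding the circle\<close>

definition fold_angle :: "real \<Rightarrow> real" where
  "fold_angle x = (if x \<le> pi then x else 2 * pi - x)"

lemma measurable_fold_angle [measurable]: "fold_angle \<in> borel_measurable borel"
  unfolding fold_angle_def by measurable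

lemma cos_fold_angle: "cos (of_int n * fold_angle x) = cos (of_int n * x)"
proof (cases "x \<le> pi")
  case False
  have "cos (of_int n * fold_angle x) = cos (of_int n * x - of_int n * (2 * pi))"
    using False by (subst cos_minus[symmetric]) (simp add: fold_angle_def algebra_simps)
  also have "\<dots> = cos (of_int n * x)"
    using sin_int_2pin[of n] cos_int_2pin[of n] by (simp add: cos_diff mult.commute mult.left_commute)
  finally show ?thesis .
qed (simp add: fold_angle_def)

lemma half_circle_measure_fold:
  assumes "finite_borel_measure \<mu>" "AE x in \<mu>. x \<in> {0..<2 * pi}"
  shows "half_circle_measure (distr \<mu> borel fold_angle)"
proof -
  interpret finite_borel_measure \<mu> by fact
  have m: "fold_angle \<in> measurable \<mu> borel"
    using measurable_fold_angle by (simp cong: measurable_cong_sets add: M_is_borel)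
  interpret D: finite_measure "distr \<mu> borel fold_angle" by (rule finite_measure_distr[OF m])
  show ?thesis
  proof
    show "AE t in distr \<mu> borel fold_angle. 0 \<le> t \<and> t \<le> pi"
    proof (subst AE_distr_iff[OF m])
      show "AE x in \<mu>. 0 \<le> fold_angle x \<and> fold_angle x \<le> pi"
        using assms(2) by eventually_elim (auto simp: fold_angle_def)
    qed simp
  qed simp
qed

text \<open>The mirror image of \<open>(0, x]\<close> has the same mass, and only the point \<open>0\<close> is its own mirror image;
\<open>\<pi>\<close>, the other fixed point, is excluded by \<open>x < \<pi>\<close>.\<close>

lemma mass_fold:
  assumes \<mu>: "finite_borel_measure \<mu>" "AE x in \<mu>. x \<in> {0..<2 * pi}"
    and odd: "\<And>n::int. (\<integral>x. sin (of_int n * x) \<partial>\<mu>) = 0"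
    and x: "0 \<le> x" "x < pi"
  shows "measure (distr \<mu> borel fold_angle) {0..x} = 2 * measure \<mu> {0..x} - measure \<mu> {0}"
proof -
  interpret finite_borel_measure \<mu> by fact
  have [simp]: "space \<mu> = UNIV" by (rule borel_UNIV)
  have borel_sets: "A \<in> sets borel \<Longrightarrow> A \<in> sets \<mu>" for A by (simp add: M_is_borel)
  have int: "integrable \<mu> (\<lambda>t. indicator A t :: real)" if "A \<in> sets borel" for A
    using that by (intro integrable_bounded_borel[of _ 1]) (auto simp: indicator_def)
  have m: "fold_angle \<in> measurable \<mu> borel"
    using measurable_fold_angle by (simp cong: measurable_cong_sets add: M_is_borel)
  have "(\<integral>t. indicator {t. cos t \<ge> cos x} t * sgn (sin t) \<partial>\<mu>)
     = (\<integral>t. indicator {0..x} t - indicator {0} t - indicator {2 * pi - x..} t \<partial>\<mu>)"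
  proof (rule integral_cong_AE)
    show "AE t in \<mu>. indicator {t. cos t \<ge> cos x} t * sgn (sin t)
        = (indicator {0..x} t - indicator {0} t - indicator {2 * pi - x..} t :: real)"
      using \<mu>(2)
    proof eventually_elim
      case (elim t)
      consider "t = 0" | "0 < t" "t < pi" | "t = pi" | "pi < t" "t < 2 * pi" using elim by fastforce
      then show ?case
      proof cases
        case 2
        have "sin t > 0" using 2 by (intro sin_gt_zero)
        moreover have "cos x \<le> cos t \<longleftrightarrow> t \<le> x" using 2 x by (intro cos_mono_le_eq) auto
        ultimately show ?thesis using 2 x by (auto simp: indicator_def)
      next
        case 4
        have "sin t < 0" using 4 by (intro sin_lt_zero) auto
        moreover have "cos x \<le> cos (2 * pi - t) \<longleftrightarrow> 2 * pi - t \<le> x" using 4 x by (intro cos_mono_le_eq) auto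
        ultimately show ?thesis using 4 x by (auto simp: indicator_def cos_diff)
      qed (use x in \<open>auto simp: indicator_def\<close>)
    qed
  qed (use M_is_borel in \<open>simp_all cong: measurable_cong_sets add: sgn_real_def\<close>)
  also have "\<dots> = measure \<mu> {0..x} - measure \<mu> {0} - measure \<mu> {2 * pi - x..}"
    using int by (simp add: borel_sets)
  finally have sym: "measure \<mu> {2 * pi - x..} = measure \<mu> {0..x} - measure \<mu> {0}"
    using integral_cos_threshold_sgn_sin_eq_0[OF odd, of "cos x"] by simp
  have "measure (distr \<mu> borel fold_angle) {0..x} = (\<integral>t. indicator {0..x} (fold_angle t) \<partial>\<mu>)"
  proof -
    have "measure (distr \<mu> borel fold_angle) {0..x} = (\<integral>t. indicator {0..x} t \<partial>distr \<mu> borel fold_angle)"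
      by simp
    then show ?thesis by (simp only: integral_distr[OF m] borel_measurable_indicator borel_closed closed_atLeastAtMost)
  qed
  also have "\<dots> = (\<integral>t. indicator {0..x} t + indicator {2 * pi - x..} t \<partial>\<mu>)"
  proof (rule integral_cong_AE)
    show "AE t in \<mu>. indicator {0..x} (fold_angle t) = (indicator {0..x} t + indicator {2 * pi - x..} t :: real)"
      using \<mu>(2) by eventually_elim (use x in \<open>auto simp: fold_angle_def indicator_def\<close>)
  qed (use M_is_borel in \<open>simp_all cong: measurable_cong_sets\<close>)
  also have "\<dots> = measure \<mu> {0..x} + measure \<mu> {2 * pi - x..}"
    using int by (simp add: borel_sets)
  finally show ?thesis using sym by simp
qed

section \<open>The variance of partial sums of a stationary sequence\<close>

lemma sum_cos_sin_closed_form: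
  fixes t :: real
  shows "sin (t / 2) * (\<Sum>j=1..n. cos (real j * t)) = cos ((real n + 1) * t / 2) * sin (real n * t / 2)"
    and "sin (t / 2) * (\<Sum>j=1..n. sin (real j * t)) = sin ((real n + 1) * t / 2) * sin (real n * t / 2)"
proof (induction n)
  case (Suc n)
  define a b where "a = (real n + 1) * t / 2" and "b = t / 2"
  have args: "real n * t / 2 = a - b" "real (Suc n) * t = 2 * a" "(real (Suc n) + 1) * t / 2 = a + b"
    "real (Suc n) * t / 2 = a" by (simp_all add: a_def b_def field_simps)
  have IH: "sin b * (\<Sum>j=1..n. cos (real j * t)) = cos a * sin (a - b)"
    "sin b * (\<Sum>j=1..n. sin (real j * t)) = sin a * sin (a - b)"
    using Suc.IH by (simp_all only: args(1) a_def[symmetric] b_def[symmetric])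
  have "sin b * (\<Sum>j=1..Suc n. cos (real j * t)) = sin b * (\<Sum>j=1..n. cos (real j * t)) + sin b * cos (real (Suc n) * t)"
    by (simp add: distrib_left del: of_nat_Suc)
  also have "\<dots> = cos a * sin (a - b) + sin b * cos (2 * a)" by (simp only: IH args(2))
  also have "\<dots> = cos (a + b) * sin a"
    by (simp only: sin_diff cos_add cos_double) (simp add: algebra_simps power2_eq_square)
  finally show "sin (t / 2) * (\<Sum>j=1..Suc n. cos (real j * t)) = cos ((real (Suc n) + 1) * t / 2) * sin (real (Suc n) * t / 2)"
    unfolding args by (simp add: b_def)
  have "sin b * (\<Sum>j=1..Suc n. sin (real j * t)) = sin b * (\<Sum>j=1..n. sin (real j * t)) + sin b * sin (real (Suc n) * t)"
    by (simp add: distrib_left del: of_nat_Suc)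
  also have "\<dots> = sin a * sin (a - b) + sin b * sin (2 * a)" by (simp only: IH args(2))
  also have "\<dots> = sin (a + b) * sin a"
    by (simp only: sin_diff sin_add sin_double) (simp add: algebra_simps)
  finally show "sin (t / 2) * (\<Sum>j=1..Suc n. sin (real j * t)) = sin ((real (Suc n) + 1) * t / 2) * sin (real (Suc n) * t / 2)"
    unfolding args by (simp add: b_def)
qed simp_all

text \<open>The double sum is the squared modulus of the sum of \<open>exp (i j t)\<close> over \<open>j = 1, \<dots>, n\<close>, whose real and imaginary parts
have closed forms.\<close>

lemma double_sum_cos_eq_dirichlet_ratio:
  assumes "0 \<le> t" "t \<le> pi"
  shows "(\<Sum>i=1..n. \<Sum>j=1..n. cos (of_int (int j - int i) * t)) = (dirichlet_ratio (real n) t)\<^sup>2"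
proof -
  define A B where "A = (\<Sum>j=1..n. cos (real j * t))" and "B = (\<Sum>j=1..n. sin (real j * t))"
  have "(\<Sum>i=1..n. \<Sum>j=1..n. cos (of_int (int j - int i) * t))
     = (\<Sum>i=1..n. \<Sum>j=1..n. cos (real i * t) * cos (real j * t) + sin (real i * t) * sin (real j * t))"
  proof (intro sum.cong refl)
    fix i j :: nat
    have "of_int (int j - int i) * t = real j * t - real i * t" by (simp add: left_diff_distrib)
    then show "cos (of_int (int j - int i) * t) = cos (real i * t) * cos (real j * t) + sin (real i * t) * sin (real j * t)"
      by (simp only: cos_diff mult.commute)
  qed
  also have "\<dots> = A * A + B * B"
    by (simp only: sum.distrib A_def B_def sum_product)
  also have "\<dots> = (dirichlet_ratio (real n) t)\<^sup>2"
  proof (cases "t = 0")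
    case True
    then show ?thesis by (simp add: A_def B_def power2_eq_square)
  next
    case False
    have nz: "sin (t / 2) \<noteq> 0" using sin_gt_zero[of "t / 2"] assms False by auto
    have "(sin (t / 2))\<^sup>2 * (A * A + B * B) = (sin (t / 2) * A)\<^sup>2 + (sin (t / 2) * B)\<^sup>2"
      by (simp add: power2_eq_square algebra_simps)
    also have "\<dots> = (sin (real n * t / 2))\<^sup>2 * ((cos ((real n + 1) * t / 2))\<^sup>2 + (sin ((real n + 1) * t / 2))\<^sup>2)"
      unfolding A_def B_def sum_cos_sin_closed_form by (simp only: power_mult_distrib distrib_left mult.commute)
    finally have "(sin (t / 2))\<^sup>2 * (A * A + B * B) = (sin (real n * t / 2))\<^sup>2" by simp
    then show ?thesis using nz False
      by (simp add: dirichlet_ratio_nz power_divide eq_divide_eq mult.commute)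
  qed
  finally show ?thesis .
qed

lemma stationary_shift:
  fixes \<phi> :: "(int \<Rightarrow> 's) \<Rightarrow> real"
  assumes stat: "stationary_process M S \<xi>" and \<phi>: "\<phi> \<in> borel_measurable (PiM UNIV (\<lambda>_. S))"
  shows stationary_integral_shift: "(\<integral>\<omega>. \<phi> (\<lambda>n. \<xi> (n + k) \<omega>) \<partial>M) = (\<integral>\<omega>. \<phi> (\<lambda>n. \<xi> n \<omega>) \<partial>M)"
    and stationary_integrable_shift: "integrable M (\<lambda>\<omega>. \<phi> (\<lambda>n. \<xi> (n + k) \<omega>)) \<longleftrightarrow> integrable M (\<lambda>\<omega>. \<phi> (\<lambda>n. \<xi> n \<omega>))"
proof -
  let ?P = "PiM (UNIV :: int set) (\<lambda>_. S)"
  have meas: "\<xi> n \<in> measurable M S" for n using stat by (simp add: stationary_process_def)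
  have path: "(\<lambda>\<omega> n. \<xi> (n + l) \<omega>) \<in> measurable M ?P" for l
    using meas by (intro measurable_PiM_single') (auto simp: PiE_UNIV_domain dest: measurable_space)
  have path0: "(\<lambda>\<omega> n. \<xi> n \<omega>) \<in> measurable M ?P" using path[of 0] by simp
  have law: "distr M ?P (\<lambda>\<omega> n. \<xi> (n + k) \<omega>) = distr M ?P (\<lambda>\<omega> n. \<xi> n \<omega>)"
    using stat by (simp add: stationary_process_def)
  have "(\<integral>\<omega>. \<phi> (\<lambda>n. \<xi> (n + k) \<omega>) \<partial>M) = integral\<^sup>L (distr M ?P (\<lambda>\<omega> n. \<xi> (n + k) \<omega>)) \<phi>"
    by (rule integral_distr[OF path \<phi>, symmetric])
  also have "\<dots> = (\<integral>\<omega>. \<phi> (\<lambda>n. \<xi> n \<omega>) \<partial>M)"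
    unfolding law by (rule integral_distr[OF path0 \<phi>])
  finally show "(\<integral>\<omega>. \<phi> (\<lambda>n. \<xi> (n + k) \<omega>) \<partial>M) = (\<integral>\<omega>. \<phi> (\<lambda>n. \<xi> n \<omega>) \<partial>M)" .
  have "integrable M (\<lambda>\<omega>. \<phi> (\<lambda>n. \<xi> (n + k) \<omega>)) \<longleftrightarrow> integrable (distr M ?P (\<lambda>\<omega> n. \<xi> (n + k) \<omega>)) \<phi>"
    by (rule integrable_distr_eq[OF path \<phi>, symmetric])
  also have "\<dots> \<longleftrightarrow> integrable M (\<lambda>\<omega>. \<phi> (\<lambda>n. \<xi> n \<omega>))"
    unfolding law by (rule integrable_distr_eq[OF path0 \<phi>])
  finally show "integrable M (\<lambda>\<omega>. \<phi> (\<lambda>n. \<xi> (n + k) \<omega>)) \<longleftrightarrow> integrable M (\<lambda>\<omega>. \<phi> (\<lambda>n. \<xi> n \<omega>))" .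
qed

lemma variance_sum_stationary:
  fixes g :: "'s \<Rightarrow> real"
  assumes prob: "prob_space M" and stat: "stationary_process M S \<xi>" and \<pi>: "\<pi> = distr M S (\<xi> 0)"
    and g: "g \<in> L2_0 \<pi>"
  shows "prob_space.variance M (\<lambda>\<omega>. \<Sum>i=1..n. g (\<xi> (int i) \<omega>))
    = (\<Sum>i=1..n. \<Sum>j=1..n. covar M (\<lambda>\<omega>. g (\<xi> 0 \<omega>)) (\<lambda>\<omega>. g (\<xi> (int j - int i) \<omega>)))"
proof -
  interpret prob_space M by fact
  define X where "X i \<omega> = g (\<xi> i \<omega>)" for i \<omega>
  have \<xi>: "\<xi> n \<in> measurable M S" for n using stat by (simp add: stationary_process_def)
  have g_meas [measurable]: "g \<in> borel_measurable S"
    using g by (simp add: L2_0_def L2_def \<pi>)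
  have X_meas [measurable]: "X i \<in> borel_measurable M" for i
    unfolding X_def using \<xi> by measurable
  have coord: "(\<lambda>x. g (x i)) \<in> borel_measurable (PiM UNIV (\<lambda>_. S))" for i :: int by measurable
  have "integrable \<pi> (\<lambda>x. (g x)\<^sup>2)" "(\<integral>x. g x \<partial>\<pi>) = 0" using g by (simp_all add: L2_0_def L2_def)
  then have X0: "integrable M (\<lambda>\<omega>. (X 0 \<omega>)\<^sup>2)" "expectation (X 0) = 0"
    unfolding \<pi> X_def by (simp_all add: integrable_distr_eq[OF \<xi>] integral_distr[OF \<xi>])
  have sq: "integrable M (\<lambda>\<omega>. (X i \<omega>)\<^sup>2)" for i
    using stationary_integrable_shift[OF stat borel_measurable_power[OF coord, of 0 2], of i] X0(1) by (simp add: X_def)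
  have int: "integrable M (X i)" for i
    using square_integrable_imp_integrable[OF X_meas sq] .
  have mean: "expectation (X i) = 0" for i
    using stationary_integral_shift[OF stat coord[of 0], of i] X0(2) by (simp add: X_def[abs_def])
  have prod_int: "integrable M (\<lambda>\<omega>. X i \<omega> * X j \<omega>)" for i j
  proof (rule Bochner_Integration.integrable_bound)
    show "integrable M (\<lambda>\<omega>. (X i \<omega>)\<^sup>2 + (X j \<omega>)\<^sup>2)" using sq by simp
    show "AE \<omega> in M. norm (X i \<omega> * X j \<omega>) \<le> norm ((X i \<omega>)\<^sup>2 + (X j \<omega>)\<^sup>2)"
    proof (rule AE_I2)
      fix \<omega>
      have "2 * (\<bar>X i \<omega>\<bar> * \<bar>X j \<omega>\<bar>) \<le> (X i \<omega>)\<^sup>2 + (X j \<omega>)\<^sup>2"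
        using sum_squares_bound[of "\<bar>X i \<omega>\<bar>" "\<bar>X j \<omega>\<bar>"] by (simp add: mult.assoc)
      moreover have "0 \<le> \<bar>X i \<omega>\<bar> * \<bar>X j \<omega>\<bar>" by simp
      ultimately show "norm (X i \<omega> * X j \<omega>) \<le> norm ((X i \<omega>)\<^sup>2 + (X j \<omega>)\<^sup>2)"
        unfolding real_norm_def abs_mult by linarith
    qed
  qed measurable
  have cov: "expectation (\<lambda>\<omega>. X i \<omega> * X j \<omega>) = covar M (X 0) (X (j - i))" for i j
  proof -
    have "expectation (\<lambda>\<omega>. X (0 + i) \<omega> * X (j - i + i) \<omega>) = expectation (\<lambda>\<omega>. X 0 \<omega> * X (j - i) \<omega>)"
      using stationary_integral_shift[OF stat borel_measurable_times[OF coord[of 0] coord[of "j - i"]], of i]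
      by (simp add: X_def)
    then show ?thesis by (simp add: covar_def mean)
  qed
  have "expectation (\<lambda>\<omega>. \<Sum>i=1..n. X (int i) \<omega>) = 0"
    using int by (simp add: mean)
  then have "variance (\<lambda>\<omega>. \<Sum>i=1..n. X (int i) \<omega>) = expectation (\<lambda>\<omega>. (\<Sum>i=1..n. X (int i) \<omega>)\<^sup>2)"
    by simp
  also have "\<dots> = expectation (\<lambda>\<omega>. \<Sum>i=1..n. \<Sum>j=1..n. X (int i) \<omega> * X (int j) \<omega>)"
    by (simp add: power2_eq_square sum_product)
  also have "\<dots> = (\<Sum>i=1..n. \<Sum>j=1..n. covar M (X 0) (X (int j - int i)))"
    using prod_int by (simp add: cov)
  finally show ?thesis by (simp add: X_def[abs_def])
qed

section \<open>Variance growth and the spectral distribution function\<close>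

lemma asymp_equiv_iff_tendsto_quotient:
  fixes f g :: "'a \<Rightarrow> real"
  assumes "eventually (\<lambda>x. g x \<noteq> 0) F"
  shows "f \<sim>[F] g \<longleftrightarrow> ((\<lambda>x. f x / g x) \<longlongrightarrow> 1) F"
  unfolding asymp_equiv_def using assms by (intro tendsto_cong) (auto elim!: eventually_mono)

lemma (in half_circle_measure) growth_iff_spectral_mass:
  assumes h: "slowly_varying h" and \<alpha>: "0 < \<alpha>" "\<alpha> < 2"
  shows "(\<lambda>n. growth (real n) / (real n powr \<alpha> * h (real n))) \<longlonglongrightarrow> 1
    \<longleftrightarrow> ((\<lambda>s. mass (1 / s) / (s powr (\<alpha> - 2) * h s)) \<longlongrightarrow> C_const \<alpha>) at_top"
proof
  assume "(\<lambda>n. growth (real n) / (real n powr \<alpha> * h (real n))) \<longlonglongrightarrow> 1"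
  then have V: "((\<lambda>s. growth s / (s powr \<alpha> * h s)) \<longlongrightarrow> 1) at_top"
    by (rule growth_asymp_of_nat[OF h \<alpha>(1)])
  have "((\<lambda>s. s\<^sup>2 * mass (1 / s) / growth s * (growth s / (s powr \<alpha> * h s))) \<longlongrightarrow> C_const \<alpha> * 1) at_top"
    by (intro tendsto_mult spectral_mass_of_growth[OF h \<alpha> V] V)
  moreover have "eventually (\<lambda>s. growth s / (s powr \<alpha> * h s) > 0) at_top"
    by (rule order_tendstoD(1)[OF V]) simp
  then have "eventually (\<lambda>s. s\<^sup>2 * mass (1 / s) / growth s * (growth s / (s powr \<alpha> * h s)) = mass (1 / s) / (s powr (\<alpha> - 2) * h s)) at_top"
    using eventually_gt_at_top[of 0]
  proof eventually_elim
    case (elim s)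
    then have "growth s \<noteq> 0" by auto
    moreover have "s powr (\<alpha> - 2) = s powr \<alpha> / s\<^sup>2" using elim by (simp add: powr_diff powr_numeral)
    ultimately show ?case using elim by simp
  qed
  ultimately have "((\<lambda>s. mass (1 / s) / (s powr (\<alpha> - 2) * h s)) \<longlongrightarrow> C_const \<alpha> * 1) at_top"
    by (rule Lim_transform_eventually)
  then show "((\<lambda>s. mass (1 / s) / (s powr (\<alpha> - 2) * h s)) \<longlongrightarrow> C_const \<alpha>) at_top" by simp
next
  assume "((\<lambda>s. mass (1 / s) / (s powr (\<alpha> - 2) * h s)) \<longlongrightarrow> C_const \<alpha>) at_top"
  from growth_of_spectral_mass[OF h \<alpha> this]
  show "(\<lambda>n. growth (real n) / (real n powr \<alpha> * h (real n))) \<longlonglongrightarrow> 1"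
    by (rule filterlim_compose) (rule filterlim_real_sequentially)
qed

text \<open>Both sides force \<open>F 0 = 0\<close>, because \<open>F 0\<close> is a lower bound of a function that tends to \<open>0\<close>; then
\<open>mass x = 2 F x\<close>.\<close>

lemma (in half_circle_measure) half_mass_asymp_equiv_iff:
  assumes h: "slowly_varying h" and \<alpha>: "0 < \<alpha>" "\<alpha> < 2"
    and F: "\<And>x. 0 \<le> x \<Longrightarrow> x < pi \<Longrightarrow> mass x = 2 * F x - F 0" and F0: "F 0 \<ge> 0" and F_mono: "\<And>x. 0 \<le> x \<Longrightarrow> x < pi \<Longrightarrow> F 0 \<le> F x"
  shows "F \<sim>[at_right 0] (\<lambda>x. C_const \<alpha> / 2 * x powr (2 - \<alpha>) * h (1 / x))
    \<longleftrightarrow> ((\<lambda>s. mass (1 / s) / (s powr (\<alpha> - 2) * h s)) \<longlongrightarrow> C_const \<alpha>) at_top"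
proof -
  define G where "G s = s powr (\<alpha> - 2) * h s" for s
  have G_pos: "s > 0 \<Longrightarrow> G s > 0" for s using slowly_varying_pos[OF h] by (simp add: G_def)
  have G_lim: "(G \<longlongrightarrow> 0) at_top"
    unfolding G_def[abs_def] using \<alpha> by (intro slowly_varying_times_power_to_0[OF h]) auto
  have C: "C_const \<alpha> > 0" using \<alpha> cos_powr_integral_pos[OF \<alpha>] by (simp add: C_const_eq)
  have rhs: "C_const \<alpha> / 2 * x powr (2 - \<alpha>) * h (1 / x) = C_const \<alpha> / 2 * G (1 / x)" if "x > 0" for x
  proof -
    have "(1 / x) powr (\<alpha> - 2) = x powr (2 - \<alpha>)"
      using that powr_minus[of x "\<alpha> - 2"] by (simp add: powr_divide inverse_eq_divide)
    then show ?thesis by (simp add: G_def)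
  qed
  have "F \<sim>[at_right 0] (\<lambda>x. C_const \<alpha> / 2 * x powr (2 - \<alpha>) * h (1 / x))
     \<longleftrightarrow> ((\<lambda>x. F x / (C_const \<alpha> / 2 * x powr (2 - \<alpha>) * h (1 / x))) \<longlongrightarrow> 1) (at_right 0)"
  proof (intro asymp_equiv_iff_tendsto_quotient)
    show "eventually (\<lambda>x. C_const \<alpha> / 2 * x powr (2 - \<alpha>) * h (1 / x) \<noteq> 0) (at_right 0)"
      using eventually_at_right_less
    proof eventually_elim
      case (elim x)
      have "h (1 / x) > 0" using elim by (intro slowly_varying_pos[OF h]) simp
      then show ?case using elim C by simp
    qed
  qed
  also have "\<dots> \<longleftrightarrow> ((\<lambda>s. F (1 / s) / (C_const \<alpha> / 2 * G s)) \<longlongrightarrow> 1) at_top"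
    unfolding filterlim_at_right_to_top
  proof (rule tendsto_cong)
    show "eventually (\<lambda>s. F (inverse s) / (C_const \<alpha> / 2 * inverse s powr (2 - \<alpha>) * h (1 / inverse s)) = F (1 / s) / (C_const \<alpha> / 2 * G s)) at_top"
      using eventually_gt_at_top[of 0] by eventually_elim (subst rhs, simp_all add: inverse_eq_divide)
  qed
  also have "\<dots> \<longleftrightarrow> ((\<lambda>s. mass (1 / s) / G s) \<longlongrightarrow> C_const \<alpha>) at_top"
  proof
    assume A: "((\<lambda>s. F (1 / s) / (C_const \<alpha> / 2 * G s)) \<longlongrightarrow> 1) at_top"
    have "((\<lambda>s. F (1 / s) / (C_const \<alpha> / 2 * G s) * (C_const \<alpha> / 2 * G s)) \<longlongrightarrow> 1 * (C_const \<alpha> / 2 * 0)) at_top"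
      by (intro tendsto_mult tendsto_const A G_lim)
    moreover have "eventually (\<lambda>s. F 0 \<le> F (1 / s) / (C_const \<alpha> / 2 * G s) * (C_const \<alpha> / 2 * G s)) at_top"
      using eventually_gt_at_top[of 1]
    proof eventually_elim
      case (elim s)
      have "1 / s < pi" using elim pi_gt3 by (simp add: divide_less_eq less_trans)
      then have "F 0 \<le> F (1 / s)" using elim by (intro F_mono) auto
      then show ?case using G_pos[of s] C elim by simp
    qed
    ultimately have "F 0 \<le> 1 * (C_const \<alpha> / 2 * 0)" by (rule tendsto_lowerbound) simp
    then have "F 0 = 0" using F0 by simp
    have "((\<lambda>s. C_const \<alpha> * (F (1 / s) / (C_const \<alpha> / 2 * G s))) \<longlongrightarrow> C_const \<alpha> * 1) at_top"
      by (intro tendsto_mult tendsto_const A)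
    moreover have "eventually (\<lambda>s. C_const \<alpha> * (F (1 / s) / (C_const \<alpha> / 2 * G s)) = mass (1 / s) / G s) at_top"
      using eventually_gt_at_top[of 1]
    proof eventually_elim
      case (elim s)
      have "1 / s < pi" using elim pi_gt3 by (simp add: divide_less_eq less_trans)
      then have "mass (1 / s) = 2 * F (1 / s)" using elim F[of "1 / s"] \<open>F 0 = 0\<close> by simp
      then show ?case using C by simp
    qed
    ultimately have "((\<lambda>s. mass (1 / s) / G s) \<longlongrightarrow> C_const \<alpha> * 1) at_top" by (rule Lim_transform_eventually)
    then show "((\<lambda>s. mass (1 / s) / G s) \<longlongrightarrow> C_const \<alpha>) at_top" by simp
  next
    assume A: "((\<lambda>s. mass (1 / s) / G s) \<longlongrightarrow> C_const \<alpha>) at_top"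
    have "mass 0 = 0" by (rule mass_0[OF h \<alpha>]) (use A in \<open>simp add: G_def\<close>)
    then have "F 0 = 0" using F[of 0] by simp
    have "((\<lambda>s. mass (1 / s) / G s / C_const \<alpha>) \<longlongrightarrow> C_const \<alpha> / C_const \<alpha>) at_top"
      using C by (intro tendsto_divide tendsto_const A) simp
    moreover have "eventually (\<lambda>s. mass (1 / s) / G s / C_const \<alpha> = F (1 / s) / (C_const \<alpha> / 2 * G s)) at_top"
      using eventually_gt_at_top[of 1]
    proof eventually_elim
      case (elim s)
      have "1 / s < pi" using elim pi_gt3 by (simp add: divide_less_eq less_trans)
      then have "mass (1 / s) = 2 * F (1 / s)" using elim F[of "1 / s"] \<open>F 0 = 0\<close> by simp
      then show ?case by (simp add: mult.commute)
    qed
    ultimately have "((\<lambda>s. F (1 / s) / (C_const \<alpha> / 2 * G s)) \<longlongrightarrow> C_const \<alpha> / C_const \<alpha>) at_top"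
      by (rule Lim_transform_eventually)
    then show "((\<lambda>s. F (1 / s) / (C_const \<alpha> / 2 * G s)) \<longlongrightarrow> 1) at_top" using C by simp
  qed
  finally show ?thesis by (simp add: G_def)
qed

theorem corollary3:
  fixes M :: "'w measure" and S :: "'s measure" and \<xi> :: "int \<Rightarrow> 'w \<Rightarrow> 's"
    and \<pi> :: "'s measure" and Q :: "'s \<Rightarrow> 's measure" and g :: "'s \<Rightarrow> real"
    and F h :: "real \<Rightarrow> real" and \<alpha> :: real
  assumes "stationary_markov_chain M S \<xi> \<pi> Q"
    and "normal_operator_L2 \<pi> (transition_operator Q)"
    and "g \<in> L2_0 \<pi>"
    and "spectral_distribution_function M (\<lambda>i \<omega>. g (\<xi> i \<omega>)) F"
    and "0 < \<alpha>" and "\<alpha> < 2"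
    and "slowly_varying h"
  shows "(\<lambda>n::nat. prob_space.variance M (\<lambda>\<omega>. \<Sum>i=1..n. g (\<xi> (int i) \<omega>)))
           \<sim>[at_top] (\<lambda>n. real n powr \<alpha> * h (real n))
     \<longleftrightarrow> F \<sim>[at_right 0] (\<lambda>x. C_const \<alpha> / 2 * x powr (2 - \<alpha>) * h (1 / x))"
proof -
  note h = \<open>slowly_varying h\<close> and \<alpha> = \<open>0 < \<alpha>\<close> \<open>\<alpha> < 2\<close>
  have prob: "prob_space M" and stat: "stationary_process M S \<xi>" and \<pi>: "\<pi> = distr M S (\<xi> 0)"
    using assms(1) by (simp_all add: stationary_markov_chain_def)
  define cv where "cv n = covar M (\<lambda>\<omega>. g (\<xi> 0 \<omega>)) (\<lambda>\<omega>. g (\<xi> n \<omega>))" for n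
  obtain \<mu> :: "real measure" where \<mu>: "finite_borel_measure \<mu>" "AE \<theta> in \<mu>. \<theta> \<in> {0..<2 * pi}"
    and four: "\<And>n::int. complex_of_real (cv n) = (\<integral>\<theta>. cis (of_int n * \<theta>) \<partial>\<mu>)"
    and F: "\<And>x. x \<in> {0..2 * pi} \<Longrightarrow> F x = measure \<mu> {0..x}"
    using assms(4) unfolding spectral_distribution_function_def cv_def by blast
  interpret \<mu>: finite_borel_measure \<mu> by fact
  define \<rho> where "\<rho> = distr \<mu> borel fold_angle"
  interpret \<rho>: half_circle_measure \<rho> unfolding \<rho>_def by (rule half_circle_measure_fold[OF \<mu>])
  have int_cis: "integrable \<mu> (\<lambda>\<theta>. cis (of_int n * \<theta>))" for n :: int
    by (rule \<mu>.integrable_bounded_borel[of _ 1]) (auto intro!: borel_measurable_continuous_onI continuous_intros)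
  have cv_cos: "cv n = (\<integral>\<theta>. cos (of_int n * \<theta>) \<partial>\<mu>)" for n
    using arg_cong[OF four[of n], of Re] integral_Re[OF int_cis[of n]] by simp
  have odd: "(\<integral>\<theta>. sin (of_int n * \<theta>) \<partial>\<mu>) = 0" for n :: int
    using arg_cong[OF four[of n], of Im] integral_Im[OF int_cis[of n]] by simp
  have fold: "fold_angle \<in> measurable \<mu> borel"
    using measurable_fold_angle by (simp cong: measurable_cong_sets add: \<mu>.M_is_borel)
  have cv_fold: "cv n = (\<integral>t. cos (of_int n * t) \<partial>\<rho>)" for n
    unfolding \<rho>_def cv_cos by (subst integral_distr[OF fold]) (simp_all add: cos_fold_angle)
  have var: "prob_space.variance M (\<lambda>\<omega>. \<Sum>i=1..n. g (\<xi> (int i) \<omega>)) = \<rho>.growth (real n)" for n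
  proof -
    have int: "integrable \<rho> (\<lambda>t. cos (of_int k * t))" for k :: int
      by (rule \<rho>.integrable_bounded_borel[of _ 1]) auto
    have "prob_space.variance M (\<lambda>\<omega>. \<Sum>i=1..n. g (\<xi> (int i) \<omega>)) = (\<Sum>i=1..n. \<Sum>j=1..n. cv (int j - int i))"
      unfolding cv_def by (rule variance_sum_stationary[OF prob stat \<pi> assms(3)])
    also have "\<dots> = (\<integral>t. (\<Sum>i=1..n. \<Sum>j=1..n. cos (of_int (int j - int i) * t)) \<partial>\<rho>)"
      unfolding cv_fold by (simp only: Bochner_Integration.integral_sum Bochner_Integration.integrable_sum int)
    also have "\<dots> = \<rho>.growth (real n)"
      unfolding \<rho>.growth_def
    proof (rule integral_cong_AE)
      show "AE t in \<rho>. (\<Sum>i=1..n. \<Sum>j=1..n. cos (of_int (int j - int i) * t)) = (dirichlet_ratio (real n) t)\<^sup>2"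
        using \<rho>.AE_half_circle by eventually_elim (rule double_sum_cos_eq_dirichlet_ratio; simp)
    qed (unfold \<rho>.measurable_M_eq, measurable)
    finally show ?thesis .
  qed
  have "(\<lambda>n::nat. prob_space.variance M (\<lambda>\<omega>. \<Sum>i=1..n. g (\<xi> (int i) \<omega>))) \<sim>[at_top] (\<lambda>n. real n powr \<alpha> * h (real n))
    \<longleftrightarrow> (\<lambda>n. \<rho>.growth (real n) / (real n powr \<alpha> * h (real n))) \<longlonglongrightarrow> 1"
    unfolding var
  proof (rule asymp_equiv_iff_tendsto_quotient)
    show "eventually (\<lambda>n. real n powr \<alpha> * h (real n) \<noteq> 0) sequentially"
      using eventually_gt_at_top[of 0]
      by eventually_elim (use slowly_varying_pos[OF h] in \<open>simp add: less_imp_neq[symmetric]\<close>)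
  qed
  also have "\<dots> \<longleftrightarrow> ((\<lambda>s. \<rho>.mass (1 / s) / (s powr (\<alpha> - 2) * h s)) \<longlongrightarrow> C_const \<alpha>) at_top"
    by (rule \<rho>.growth_iff_spectral_mass[OF h \<alpha>])
  also have "\<dots> \<longleftrightarrow> F \<sim>[at_right 0] (\<lambda>x. C_const \<alpha> / 2 * x powr (2 - \<alpha>) * h (1 / x))"
  proof (rule \<rho>.half_mass_asymp_equiv_iff[OF h \<alpha>, symmetric])
    have F': "F x = measure \<mu> {0..x}" if "0 \<le> x" "x < pi" for x
    proof (rule F)
      have "x \<le> 2 * pi" using that by linarith
      then show "x \<in> {0..2 * pi}" using that by simp
    qed
    have F0: "F 0 = measure \<mu> {0}" using F'[of 0] by simp
    then show "0 \<le> F 0" by simp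
    fix x :: real assume x: "0 \<le> x" "x < pi"
    show "\<rho>.mass x = 2 * F x - F 0"
      unfolding \<rho>.mass_def F'[OF x] F0 unfolding \<rho>_def by (rule mass_fold[OF \<mu> odd x])
    show "F 0 \<le> F x"
      unfolding F'[OF x] F0 using x
      by (intro \<mu>.finite_measure_mono) (simp_all add: \<mu>.M_is_borel)
  qed
  finally show ?thesis .
qed

end
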